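(* Let $\Gamma$ be a connected graph of prime valency $p$ that is $2$-geodesic transitive but not $2$-arc transitive. Then $\Gamma$ is a nonbipartite antipodal double cover of the complete graph $K_{p+1}$, where $p\equiv 1\pmod 4$. Further, $\Gamma$ is geodesic transitive, and (for the given $p$) $\Gamma$ is unique up to isomorphism, with automorphism group $\mathrm{Aut}(\Gamma)\cong PSL(2,p)\times \mathbb{Z}_2$.
   Context: All graphs are finite, undirected and simple. For a connected graph $\Gamma$, $\mathrm{diam}(\Gamma)$ is its diameter. An $s$-arc is a sequence of vertices $(v_0,\dots,v_s)$ with consecutive vertices adjacent and $v_{j-1}\neq v_{j+1}$ for $1\le j\le s-1$; $\Gamma$ is $s$-arc transitive if for each $1\le t\le s$ the group $\mathrm{Aut}(\Gamma)$ is transitive on $t$-arcs. An $i$-geodesic is a path $(v_0,\dots,v_i)$ such that the distance from $v_0$ to $v_i$ is $i$. For $s\le \mathrm{diam}(\Gamma)$, $\Gamma$ is $s$-geodesic transitive if for each $i=1,\dots,s$ the group $\mathrm{Aut}(\Gamma)$ is transitive on the set of $i$-geodesics (so $2$-geodesic transitivity presupposes $\mathrm{diam}(\Gamma)\ge 2$); $\Gamma$ is geodesic transitive if this holds for $s=\mathrm{diam}(\Gamma)$. A connected graph $\Gamma$ of diameter $d\ge 2$ is antipodal if the graph on $V\Gamma$ in which two vertices are adjacent exactly when they are at distance $d$ in $\Gamma$ is a disjoint union of complete graphs; the vertex sets of these complete graphs are the fibres. $\Gamma$ is an antipodal double cover of $K_{n}$ if it is antipodal, all fibres have size $2$, the quotient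 graph on the set $\mathcal{B}$ of fibres (two distinct fibres adjacent when some edge of $\Gamma$ joins them) is isomorphic to $K_n$, and $\Gamma$ is a cover of this quotient, i.e. for any two adjacent fibres $B,B'$ each vertex of $B$ is adjacent to exactly one vertex of $B'$. *)

theory Defs
  imports
    "Graph_Theory.Graph_Theory"
    "HOL-Library.Disjoint_Sets"
    "HOL-Algebra.Bij"
    "HOL-Algebra.Elementary_Groups"
    "HOL-Number_Theory.Residues"
begin

text \<open>
  Finite simple undirected graphs are those G :: 'a pair_pre_digraph with pair_graph G: finite
  vertex set, and a symmetric irreflexive set parcs G of ordered pairs, so that an undirected
  edge uv is represented by the two pairs (u,v) and (v,u). Vertex sequences are lists; one with
  s + 1 entries has length s in the graph-theoretic sense.
\<close>

section \<open>Distance, diameter, valency, bipartiteness\<close>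

text \<open>Meaningful only for v reachable from u; it is used for connected graphs only.\<close>

definition gdist :: "'a pair_pre_digraph \<Rightarrow> 'a \<Rightarrow> 'a \<Rightarrow> nat" where
  "gdist G u v = (LEAST n. \<exists>w. vwalk w (with_proj G) \<and> hd w = u \<and> last w = v \<and> vwalk_length w = n)"

definition gdiam :: "'a pair_pre_digraph \<Rightarrow> nat" where
  "gdiam G = Max {gdist G u v | u v. u \<in> pverts G \<and> v \<in> pverts G}"

definition has_valency :: "'a pair_pre_digraph \<Rightarrow> nat \<Rightarrow> bool" where
  "has_valency G k \<longleftrightarrow> (\<forall>v \<in> pverts G. out_degree (with_proj G) v = k)"

definition bipartite :: "'a pair_pre_digraph \<Rightarrow> bool" where
  "bipartite G \<longleftrightarrow> (\<exists>U W. U \<union> W = pverts G \<and> U \<inter> W = {} \<and> parcs G \<subseteq> U \<times> W \<union> W \<times> U)"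


section \<open>Automorphisms and transitivity\<close>

text \<open>
  As in BijGroup, automorphisms are extensional functions on the vertex set, so that distinct
  elements of the carrier are distinct permutations of the vertices.
\<close>

definition graph_auts :: "'a pair_pre_digraph \<Rightarrow> ('a \<Rightarrow> 'a) set" where
  "graph_auts G = {g \<in> Bij (pverts G).
     \<forall>u \<in> pverts G. \<forall>v \<in> pverts G. (g u, g v) \<in> parcs G \<longleftrightarrow> (u, v) \<in> parcs G}"

definition AutGraph :: "'a pair_pre_digraph \<Rightarrow> ('a \<Rightarrow> 'a) monoid" where
  "AutGraph G = BijGroup (pverts G) \<lparr>carrier := graph_auts G\<rparr>"

definition transitive_on_seqs :: "'a pair_pre_digraph \<Rightarrow> 'a list set \<Rightarrow> bool" where
  "transitive_on_seqs G S \<longleftrightarrow> (\<forall>x \<in> S. \<forall>y \<in> S. \<exists>g \<in> carrier (AutGraph G). map g x = y)"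

definition s_arcs :: "'a pair_pre_digraph \<Rightarrow> nat \<Rightarrow> 'a list set" where
  "s_arcs G s = {w. vwalk w (with_proj G) \<and> length w = s + 1 \<and>
     (\<forall>j \<in> {1..<s}. w ! (j - 1) \<noteq> w ! (j + 1))}"

definition s_arc_transitive :: "'a pair_pre_digraph \<Rightarrow> nat \<Rightarrow> bool" where
  "s_arc_transitive G s \<longleftrightarrow> (\<forall>t \<in> {1..s}. transitive_on_seqs G (s_arcs G t))"

definition geodesics :: "'a pair_pre_digraph \<Rightarrow> nat \<Rightarrow> 'a list set" where
  "geodesics G i = {w. vpath w (with_proj G) \<and> length w = i + 1 \<and> gdist G (hd w) (last w) = i}"

definition s_geodesic_transitive :: "'a pair_pre_digraph \<Rightarrow> nat \<Rightarrow> bool" where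
  "s_geodesic_transitive G s \<longleftrightarrow>
     s \<le> gdiam G \<and> (\<forall>i \<in> {1..s}. transitive_on_seqs G (geodesics G i))"

definition geodesic_transitive :: "'a pair_pre_digraph \<Rightarrow> bool" where
  "geodesic_transitive G \<longleftrightarrow> s_geodesic_transitive G (gdiam G)"


section \<open>Antipodal double covers of complete graphs\<close>

definition distance_graph :: "'a pair_pre_digraph \<Rightarrow> nat \<Rightarrow> 'a pair_pre_digraph" where
  "distance_graph G d = \<lparr>pverts = pverts G,
     parcs = {(u, v). u \<in> pverts G \<and> v \<in> pverts G \<and> gdist G u v = d}\<rparr>"

text \<open>H is the disjoint union of the complete graphs on the members of P; P is determined by H.\<close>

definition disjoint_union_of_complete :: "'a pair_pre_digraph \<Rightarrow> 'a set set \<Rightarrow> bool" where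
  "disjoint_union_of_complete H P \<longleftrightarrow> partition_on (pverts H) P \<and>
     parcs H = (\<Union>B \<in> P. {(u, v). u \<in> B \<and> v \<in> B \<and> u \<noteq> v})"

text \<open>G is antipodal with set of fibres P.\<close>

definition antipodal_with_fibres :: "'a pair_pre_digraph \<Rightarrow> 'a set set \<Rightarrow> bool" where
  "antipodal_with_fibres G P \<longleftrightarrow> Digraph_Component.connected (with_proj G) \<and> 2 \<le> gdiam G \<and>
     disjoint_union_of_complete (distance_graph G (gdiam G)) P"

definition quotient_graph :: "'a pair_pre_digraph \<Rightarrow> 'a set set \<Rightarrow> 'a set pair_pre_digraph" where
  "quotient_graph G P = \<lparr>pverts = P,
     parcs = {(B, C). B \<in> P \<and> C \<in> P \<and> B \<noteq> C \<and> (\<exists>u \<in> B. \<exists>v \<in> C. (u, v) \<in> parcs G)}\<rparr>"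

definition covers_quotient :: "'a pair_pre_digraph \<Rightarrow> 'a set set \<Rightarrow> bool" where
  "covers_quotient G P \<longleftrightarrow> (\<forall>(B, C) \<in> parcs (quotient_graph G P).
     \<forall>u \<in> B. \<exists>!v. v \<in> C \<and> (u, v) \<in> parcs G)"

definition antipodal_double_cover_complete :: "'a pair_pre_digraph \<Rightarrow> nat \<Rightarrow> bool" where
  "antipodal_double_cover_complete G n \<longleftrightarrow> (\<exists>P. antipodal_with_fibres G P \<and>
     (\<forall>B \<in> P. card B = 2) \<and> complete_digraph n (with_proj (quotient_graph G P)) \<and>
     covers_quotient G P)"


section \<open>The groups PSL(2,p)\<close>

text \<open>The tuple (a, b, c, d) is the matrix with rows (a, b) and (c, d).\<close>

definition SL2 :: "('r, 'm) ring_scheme \<Rightarrow> ('r \<times> 'r \<times> 'r \<times> 'r) monoid" where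
  "SL2 R = \<lparr>
     carrier = {(a, b, c, d). a \<in> carrier R \<and> b \<in> carrier R \<and> c \<in> carrier R \<and> d \<in> carrier R \<and>
       (a \<otimes>\<^bsub>R\<^esub> d) \<ominus>\<^bsub>R\<^esub> (b \<otimes>\<^bsub>R\<^esub> c) = \<one>\<^bsub>R\<^esub>},
     monoid.mult = (\<lambda>(a, b, c, d) (a', b', c', d').
       (a \<otimes>\<^bsub>R\<^esub> a' \<oplus>\<^bsub>R\<^esub> b \<otimes>\<^bsub>R\<^esub> c', a \<otimes>\<^bsub>R\<^esub> b' \<oplus>\<^bsub>R\<^esub> b \<otimes>\<^bsub>R\<^esub> d',
        c \<otimes>\<^bsub>R\<^esub> a' \<oplus>\<^bsub>R\<^esub> d \<otimes>\<^bsub>R\<^esub> c', c \<otimes>\<^bsub>R\<^esub> b' \<oplus>\<^bsub>R\<^esub> d \<otimes>\<^bsub>R\<^esub> d')),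
     one = (\<one>\<^bsub>R\<^esub>, \<zero>\<^bsub>R\<^esub>, \<zero>\<^bsub>R\<^esub>, \<one>\<^bsub>R\<^esub>)\<rparr>"

definition group_center :: "('g, 'm) monoid_scheme \<Rightarrow> 'g set" where
  "group_center G = {z \<in> carrier G. \<forall>x \<in> carrier G. z \<otimes>\<^bsub>G\<^esub> x = x \<otimes>\<^bsub>G\<^esub> z}"

definition PSL2 :: "nat \<Rightarrow> (int \<times> int \<times> int \<times> int) set monoid" where
  "PSL2 p = (let S = SL2 (residue_ring (int p)) in S Mod group_center S)"

end

theory Submission
  imports
    Defs
    "HOL-Computational_Algebra.Polynomial"
    "HOL-Number_Theory.Euler_Criterion"
    "HOL-Algebra.Sylow"
    "HOL-Algebra.Group_Action"
begin

text \<open>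
  Since \<open>\<Gamma>\<close> has a triangle but is not complete, the vertex stabiliser acts on the \<open>p\<close> neighbours
  transitively but not doubly transitively, hence by affine maps of the field with \<open>p\<close> elements
  (Burnside). Write \<open>m\<close> for the number of vertices of a neighbourhood not adjacent to a given one of
  its vertices. Two-geodesic transitivity makes these \<open>m\<close> vertices one orbit of the multipliers.
  Counting the edges between a neighbourhood and the second sphere shows that the number \<open>c\<close> of
  common neighbours of two vertices at distance two divides \<open>m\<close>, whereas \<open>c > p - 2 m\<close>; this forces
  \<open>p = 2 m + 1\<close>, so that neighbourhoods are Paley graphs, and then \<open>c = m\<close>. From here the graph is
  determined: the second sphere is a copy of the first, joined to it by the nonresidues, and a
  single vertex is left at distance three.

  Equivalently, the vertices are the nonzero vectors of the plane over the field with \<open>p\<close> elements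
  modulo nonzero squares, with \<open>v\<close> adjacent to \<open>w\<close> iff \<open>det (v, w)\<close> is a nonzero square. In these
  coordinates uniqueness is immediate, \<open>SL(2,p)\<close> acts with kernel its centre, a nonsquare scalar acts
  as the antipodal map, and an automorphism is determined by its affine action on a neighbourhood.
\<close>

section \<open>Power sums and interpolation modulo a prime\<close>

text \<open>Burnside's theorem enters as a statement about circulants: a permutation of the residues
  that preserves a connection set which is neither empty nor everything is affine. Sylow's theorem
  supplies the p-cycle that turns a neighbourhood into a circulant; the triangle and the 2-geodesic
  make its connection set proper. The same statement serves once more for the stabiliser of a vertex
  in coordinates, so no list of transitive groups of prime degree is consulted. The plane comes from
  reading labels as slopes: the neighbour with label i lies on the line through (i, 1), the root on
  the line through (1, 0), and each line carries two square classes, an antipodal pair. The rules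
  "residues inside a sphere, nonresidues between the spheres, root and antipode joined to one sphere
  each" then collapse into the sign of one determinant, which is symmetric because -1 is a square.
  The field with p elements is never built: residues are integers up to congruence, labels are
  functions on all integers, and exact values of character sums are recovered from congruences by
  size bounds.\<close>

lemma exists_inverse_mod_prime:
  assumes "Factorial_Ring.prime p" "\<not> int p dvd a"
  shows "\<exists>b. [a * b = 1] (mod int p)"
proof (rule cong_solve_coprime_int)
  show "coprime a (int p)"
    using prime_imp_coprime[of "int p" a] assms by (simp add: coprime_commute)
qed

text \<open>\<open>\<sigma>\<close> reflects congruence, so its reduction is injective on the p
  representatives and, these being finitely many, permutes them.\<close>

lemma rsum_reindex:
  fixes f \<sigma> :: "int \<Rightarrow> int"
  assumes p: "p > (0::int)"
    and f: "\<And>x y. [x = y] (mod p) \<Longrightarrow> [f x = f y] (mod p)"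
    and s: "\<And>x y. [\<sigma> x = \<sigma> y] (mod p) \<Longrightarrow> [x = y] (mod p)"
  shows "[(\<Sum>x\<in>{0..<p}. f (\<sigma> x)) = (\<Sum>x\<in>{0..<p}. f x)] (mod p)"
proof -
  let ?t = "\<lambda>x. \<sigma> x mod p"
  have inj: "inj_on ?t {0..<p}"
  proof (rule inj_onI)
    fix x y assume "x \<in> {0..<p}" "y \<in> {0..<p}" "?t x = ?t y"
    then show "x = y" using s[of x y] by (simp add: cong_def)
  qed
  moreover have "?t ` {0..<p} \<subseteq> {0..<p}" using p by auto
  ultimately have "bij_betw ?t {0..<p} {0..<p}"
    by (simp add: bij_betw_def endo_inj_surj)
  then have "(\<Sum>x\<in>{0..<p}. f (?t x)) = (\<Sum>x\<in>{0..<p}. f x)"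
    by (rule sum.reindex_bij_betw)
  moreover have "[(\<Sum>x\<in>{0..<p}. f (\<sigma> x)) = (\<Sum>x\<in>{0..<p}. f (?t x))] (mod p)"
    by (intro cong_sum f) (simp add: cong_def)
  ultimately show ?thesis by simp
qed

lemma int_interval_sum: "(\<Sum>x\<in>{0..<int n}. f x) = (\<Sum>i<n. f (int i))"
proof -
  have "{0..<int n} = int ` {..<n}"
    by (metis atLeast0LessThan image_int_atLeastLessThan of_nat_0)
  then show ?thesis by (simp add: sum.reindex)
qed

text \<open>Telescoping the differences of x^(k+1) over the residues gives p^(k+1), a multiple of p.
  In the binomial expansion the lower power sums vanish by induction, and the top one carries the
  factor k + 1, a unit because k < p - 1.\<close>

lemma sum_powers_mod_prime:
  assumes "prime p" "k < p - 1"
  shows "[(\<Sum>x\<in>{0..<int p}. x ^ k) = 0] (mod int p)"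
  using assms(2)
proof (induction k rule: less_induct)
  case (less k)
  have "(\<Sum>i<p. (int i + 1) ^ Suc k - int i ^ Suc k) = int p ^ Suc k"
    using sum_lessThan_telescope[of "\<lambda>i. int i ^ Suc k" p] by (simp add: add.commute)
  then have "(\<Sum>x\<in>{0..<int p}. (x + 1) ^ Suc k - x ^ Suc k) = int p ^ Suc k"
    by (simp only: int_interval_sum)
  moreover have "(x + 1) ^ Suc k - x ^ Suc k = (\<Sum>l\<le>k. of_nat (Suc k choose l) * x ^ l)" for x :: int
    by (simp add: binomial_ring[of x 1 "Suc k"] del: power_Suc)
  ultimately have "(\<Sum>x\<in>{0..<int p}. \<Sum>l\<le>k. of_nat (Suc k choose l) * x ^ l) = int p ^ Suc k"
    by simp
  then have "(\<Sum>l\<le>k. of_nat (Suc k choose l) * (\<Sum>x\<in>{0..<int p}. x ^ l)) = int p ^ Suc k"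
    by (subst (asm) sum.swap) (simp add: sum_distrib_left)
  then have "int p dvd (\<Sum>l\<le>k. of_nat (Suc k choose l) * (\<Sum>x\<in>{0..<int p}. x ^ l))"
    by simp
  moreover have "(\<Sum>l\<le>k. of_nat (Suc k choose l) * (\<Sum>x\<in>{0..<int p}. x ^ l)) =
    (\<Sum>l<k. of_nat (Suc k choose l) * (\<Sum>x\<in>{0..<int p}. x ^ l)) + int (Suc k) * (\<Sum>x\<in>{0..<int p}. x ^ k)"
    by (simp add: lessThan_Suc_atMost[symmetric])
  moreover have "int p dvd (\<Sum>l<k. of_nat (Suc k choose l) * (\<Sum>x\<in>{0..<int p}. x ^ l))"
  proof (rule dvd_sum)
    fix l assume "l \<in> {..<k}"
    then show "int p dvd of_nat (Suc k choose l) * (\<Sum>x\<in>{0..<int p}. x ^ l)"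
      using less by (simp add: cong_0_iff)
  qed
  ultimately have "int p dvd int (Suc k) * (\<Sum>x\<in>{0..<int p}. x ^ k)"
    by (simp only: dvd_add_right_iff)
  moreover have "\<not> int p dvd int (Suc k)"
    using less.prems by (simp add: zdvd_not_zless)
  ultimately show ?case
    using assms(1) by (simp add: prime_dvd_mult_iff cong_0_iff)
qed

lemma fermat_int:
  assumes "prime p" "\<not> int p dvd x"
  shows "[x ^ (p - 1) = 1] (mod int p)"
proof -
  have "[nat (x mod int p) ^ (p - 1) = 1] (mod p)"
  proof (rule fermat_theorem[OF assms(1)])
    have "x mod int p > 0" 
      using assms prime_gt_0_nat[OF assms(1)] pos_mod_sign[of "int p" x] by (simp add: dvd_eq_mod_eq_0 order_less_le)
    then show "\<not> p dvd nat (x mod int p)"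
      using prime_gt_0_nat[OF assms(1)] by (intro nat_dvd_not_less) (auto simp: nat_less_iff)
  qed
  then have "[int (nat (x mod int p)) ^ (p - 1) = 1] (mod int p)"
    by (metis cong_int_iff of_nat_1 of_nat_power)
  then have "[(x mod int p) ^ (p - 1) = 1] (mod int p)"
    using assms(1) by (simp add: prime_gt_0_nat)
  then show ?thesis by (simp add: cong_def power_mod)
qed

lemma sum_top_power_mod_prime:
  assumes "prime p"
  shows "[(\<Sum>x\<in>{0..<int p}. x ^ (p - 1)) = - 1] (mod int p)"
proof -
  have p: "p > 1" using assms by (rule prime_gt_1_nat)
  have "(\<Sum>x\<in>{0..<int p}. x ^ (p - 1)) = (\<Sum>x\<in>{1..<int p}. x ^ (p - 1))"
    by (rule sum.mono_neutral_right) (use p in \<open>auto simp: zero_power\<close>)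
  also have "[\<dots> = (\<Sum>x\<in>{1..<int p}. 1)] (mod int p)"
    by (intro cong_sum fermat_int[OF assms]) (auto dest: zdvd_imp_le)
  also have "(\<Sum>x\<in>{1..<int p}. 1) = int p - 1" using p by simp
  also have "[int p - 1 = - 1] (mod int p)" by (simp add: cong_iff_dvd_diff)
  finally show ?thesis .
qed

text \<open>Powers below p - 1 sum to 0 and x^(p-1) sums to -1, so summation over the residues reads
  off one coefficient. This is how degrees are detected later: a polynomial of exact degree p - 1
  with unit leading coefficient cannot have sum 0.\<close>

lemma sum_poly_mod_prime:
  fixes Q :: "int poly"
  assumes "prime p" "degree Q \<le> p - 1"
  shows "[(\<Sum>x\<in>{0..<int p}. poly Q x) = - coeff Q (p - 1)] (mod int p)"
proof -
  have "poly Q x = (\<Sum>k\<le>p - 1. coeff Q k * x ^ k)" for x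
    unfolding poly_altdef using assms(2)
    by (intro sum.mono_neutral_left) (auto simp: coeff_eq_0)
  then have "(\<Sum>x\<in>{0..<int p}. poly Q x) = (\<Sum>x\<in>{0..<int p}. \<Sum>k\<le>p - 1. coeff Q k * x ^ k)"
    by (simp only:)
  also have "\<dots> = (\<Sum>k\<le>p - 1. coeff Q k * (\<Sum>x\<in>{0..<int p}. x ^ k))"
    unfolding sum_distrib_left by (rule sum.swap)
  also have "\<dots> = (\<Sum>k<p - 1. coeff Q k * (\<Sum>x\<in>{0..<int p}. x ^ k)) + coeff Q (p - 1) * (\<Sum>x\<in>{0..<int p}. x ^ (p - 1))"
    by (simp add: lessThan_Suc_atMost[symmetric])
  also have "[\<dots> = (\<Sum>k<p - 1. coeff Q k * 0) + coeff Q (p - 1) * (- 1)] (mod int p)"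
    by (intro cong_add cong_sum cong_mult cong_refl sum_powers_mod_prime sum_top_power_mod_prime assms(1)) auto
  finally show ?thesis by simp
qed

section \<open>Interpolation of functions on residues by integer polynomials\<close>

lemma poly_cong:
  fixes q :: "int poly"
  assumes "[x = y] (mod m)"
  shows "[poly q x = poly q y] (mod m)"
proof (induction q)
  case (pCons a q)
  then have "[a + x * poly q x = a + y * poly q y] (mod m)"
    by (intro cong_add cong_mult cong_refl assms)
  then show ?case by simp
qed simp

text \<open>The last conclusion makes the integer degree of \<open>q\<close> its degree over the
  field, as degree arguments modulo p require. Existence is Lagrange interpolation; the condition on
  the leading coefficient comes from a minimal choice of the degree.\<close>

lemma interpolation_mod_prime:
  fixes f :: "int \<Rightarrow> int"
  assumes p: "prime p" and f: "\<And>x y. [x = y] (mod int p) \<Longrightarrow> [f x = f y] (mod int p)"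
  obtains q :: "int poly" where "degree q \<le> p - 1" "\<And>x. [poly q x = f x] (mod int p)"
    "q = 0 \<or> \<not> int p dvd lead_coeff q"
proof -
  let ?P = "\<lambda>q :: int poly. degree q \<le> p - 1 \<and> (\<forall>x. [poly q x = f x] (mod int p))"
  \<comment> \<open>By Fermat, 1 - (x - a)^(p-1) is the indicator of x = a modulo p.\<close>
  define q0 where "q0 = (\<Sum>a\<in>{0..<int p}. smult (f a) (1 - [:- a, 1:] ^ (p - 1)))"
  have p1: "p > 1" using p by (rule prime_gt_1_nat)
  have "degree q0 \<le> p - 1"
    unfolding q0_def
    by (intro degree_sum_le order.trans[OF degree_smult_le] degree_diff_le order.trans[OF degree_power_le]) auto
  moreover have "[poly q0 x = f x] (mod int p)" for x
  proof -
    define y where "y = x mod int p"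
    have y: "y \<in> {0..<int p}" "[x = y] (mod int p)" using p1 by (auto simp: y_def)
    have "poly q0 y = (\<Sum>a\<in>{0..<int p}. f a * (1 - (y - a) ^ (p - 1)))"
      by (simp add: q0_def poly_sum)
    also have "[\<dots> = (\<Sum>a\<in>{0..<int p}. if a = y then f y else 0)] (mod int p)"
    proof (rule cong_sum)
      fix a assume a: "a \<in> {0..<int p}"
      show "[f a * (1 - (y - a) ^ (p - 1)) = (if a = y then f y else 0)] (mod int p)"
      proof (cases "a = y")
        case True then show ?thesis using p1 by (simp add: zero_power)
      next
        case False
        then have "\<not> int p dvd y - a" using a y by (auto dest!: zdvd_imp_le[rotated] simp: cong_iff_dvd_diff[symmetric] cong_def)
        then have "[f a * (1 - (y - a) ^ (p - 1)) = f a * (1 - 1)] (mod int p)"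
          by (intro cong_mult cong_diff cong_refl fermat_int p)
        then show ?thesis using False by simp
      qed
    qed
    also have "(\<Sum>a\<in>{0..<int p}. if a = y then f y else 0) = f y" using y by simp
    also have "[f y = f x] (mod int p)" using y f by (simp add: cong_sym)
    finally show ?thesis using poly_cong[OF y(2), of q0] cong_trans by blast
  qed
  ultimately have "?P q0" by blast
  then obtain q where q: "?P q" and least: "\<And>q'. ?P q' \<Longrightarrow> degree q \<le> degree q'"
    using exists_least_iff[of "\<lambda>n. \<exists>q. ?P q \<and> degree q = n"] by (metis not_less)
  show ?thesis
  proof (cases "int p dvd lead_coeff q")
    case False then show ?thesis using that q by blast
  next
    case True
    define q' where "q' = q - monom (lead_coeff q) (degree q)"
    have "[poly q' x = f x] (mod int p)" for x
    proof -
      have "[poly q x - lead_coeff q * x ^ degree q = f x - 0] (mod int p)"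
        using q True by (intro cong_diff) (auto simp: cong_0_iff)
      then show ?thesis by (simp add: q'_def poly_monom)
    qed
    moreover have deg: "degree q' \<le> degree q - 1"
    proof (rule degree_le, intro allI impI)
      fix i assume "i > degree q - 1"
      then have "i \<ge> degree q" by simp
      then show "coeff q' i = 0" by (cases "i = degree q") (auto simp: q'_def coeff_eq_0)
    qed
    ultimately have P': "?P q'" using q by (meson diff_le_self order.trans)
    then have "degree q = 0" using least[OF P'] deg by auto
    then have "q' = 0" by (metis deg degree_eq_zeroE diff_0_eq_0 le_zero_eq q'_def diff_self coeff_pCons_0 monom_0)
    then show ?thesis using that[of q'] P' by blast
  qed
qed

section \<open>Permutations of a prime field preserving a connection set\<close>

context
  fixes p :: nat and U :: "int set" and \<pi> :: "int \<Rightarrow> int"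
  assumes prime: "Factorial_Ring.prime p"
    and U: "U \<subseteq> {1..<int p}"
    and inj: "\<And>x y. [\<pi> x = \<pi> y] (mod int p) \<longleftrightarrow> [x = y] (mod int p)"
    and pres: "\<And>x y. (\<pi> y - \<pi> x) mod int p \<in> U \<longleftrightarrow> (y - x) mod int p \<in> U"
begin

lemma finite_connection_set: "finite U"
  by (rule finite_subset[OF U]) simp

text \<open>\<open>\<pi>\<close> carries the translate of \<open>U\<close> by x onto its translate
  by \<open>\<pi> x\<close>, so for fixed x the differences \<open>\<pi> (x + u) - \<pi> x\<close>
  run through \<open>U\<close> again: convolution with the indicator of \<open>U\<close> commutes
  with composition with \<open>\<pi>\<close>.\<close>

lemma sum_over_connection_set_commute:
  assumes g: "\<And>x y. [x = y] (mod int p) \<Longrightarrow> [g x = g y] (mod int p)"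
  shows "[(\<Sum>u\<in>U. g (\<pi> (x + u))) = (\<Sum>u\<in>U. g (\<pi> x + u) :: int)] (mod int p)"
proof -
  let ?t = "\<lambda>u. (\<pi> (x + u) - \<pi> x) mod int p"
  have small: "u mod int p = u" if "u \<in> U" for u
    using U that by auto
  have "inj_on ?t U"
  proof (rule inj_onI)
    fix u v assume uv: "u \<in> U" "v \<in> U" "?t u = ?t v"
    then have "[\<pi> (x + u) - \<pi> x + \<pi> x = \<pi> (x + v) - \<pi> x + \<pi> x] (mod int p)"
      by (intro cong_add cong_refl) (simp add: cong_def)
    then have "[x + u = x + v] (mod int p)" using inj by simp
    then have "[u = v] (mod int p)" by (simp add: cong_add_lcancel)
    then show "u = v" using uv small by (simp add: cong_def)
  qed
  moreover have "?t ` U \<subseteq> U"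
    using pres[where x = x] small by auto
  ultimately have "bij_betw ?t U U"
    by (simp add: bij_betw_def endo_inj_surj finite_connection_set)
  then have "(\<Sum>u\<in>U. g (\<pi> x + ?t u)) = (\<Sum>u\<in>U. g (\<pi> x + u))"
    by (rule sum.reindex_bij_betw)
  moreover have "[(\<Sum>u\<in>U. g (\<pi> (x + u))) = (\<Sum>u\<in>U. g (\<pi> x + ?t u))] (mod int p)"
    by (intro cong_sum g) (simp add: cong_def mod_add_right_eq)
  ultimately show ?thesis by simp
qed

text \<open>The sum over \<open>U\<close> is moved from the function of \<open>\<pi>\<close> to the
  monomial: after substituting x - u for x, each (x - u)^i is expanded, and the vanishing power sums
  over \<open>U\<close> leave only the term l = 0, which is card U times x^i.\<close>

lemma moment_shift_invariant:
  assumes g: "\<And>x y. [x = y] (mod int p) \<Longrightarrow> [g x = g y] (mod int p)"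
    and zero: "\<And>l. 1 \<le> l \<Longrightarrow> l \<le> i \<Longrightarrow> [(\<Sum>u\<in>U. u ^ l) = 0] (mod int p)"
  shows "[(\<Sum>x\<in>{0..<int p}. (\<Sum>u\<in>U. g (\<pi> x + u)) * x ^ i) =
    int (card U) * (\<Sum>x\<in>{0..<int p}. g (\<pi> x) * x ^ i)] (mod int p)"
proof -
  have "[(\<Sum>x\<in>{0..<int p}. (\<Sum>u\<in>U. g (\<pi> x + u)) * x ^ i) =
      (\<Sum>x\<in>{0..<int p}. (\<Sum>u\<in>U. g (\<pi> (x + u))) * x ^ i)] (mod int p)"
    by (intro cong_sum cong_mult cong_refl cong_sym[OF sum_over_connection_set_commute] g)
  also have "(\<Sum>x\<in>{0..<int p}. (\<Sum>u\<in>U. g (\<pi> (x + u))) * x ^ i) =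
      (\<Sum>u\<in>U. \<Sum>x\<in>{0..<int p}. g (\<pi> (x + u)) * ((x + u) - u) ^ i)"
    by (simp add: sum_distrib_right sum.swap[of _ U])
  also have "[\<dots> = (\<Sum>u\<in>U. \<Sum>x\<in>{0..<int p}. g (\<pi> x) * (x - u) ^ i)] (mod int p)"
  proof (rule cong_sum)
    fix u assume "u \<in> U"
    show "[(\<Sum>x\<in>{0..<int p}. g (\<pi> (x + u)) * ((x + u) - u) ^ i) =
        (\<Sum>x\<in>{0..<int p}. g (\<pi> x) * (x - u) ^ i)] (mod int p)"
    proof (rule rsum_reindex[where \<sigma> = "\<lambda>x. x + u"])
      show "int p > 0" using prime prime_gt_0_nat by simp
      show "[g (\<pi> x) * (x - u) ^ i = g (\<pi> y) * (y - u) ^ i] (mod int p)"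
        if "[x = y] (mod int p)" for x y
        using that inj by (intro cong_mult cong_pow cong_diff g) auto
    qed (simp add: cong_add_rcancel)
  qed
  also have "(\<Sum>u\<in>U. \<Sum>x\<in>{0..<int p}. g (\<pi> x) * (x - u) ^ i) =
      (\<Sum>x\<in>{0..<int p}. g (\<pi> x) * (\<Sum>u\<in>U. (x - u) ^ i))"
    unfolding sum_distrib_left by (rule sum.swap)
  also have "[\<dots> = (\<Sum>x\<in>{0..<int p}. g (\<pi> x) * (int (card U) * x ^ i))] (mod int p)"
  proof (intro cong_sum cong_mult cong_refl)
    fix x
    have "(\<Sum>u\<in>U. (x - u) ^ i) = (\<Sum>u\<in>U. \<Sum>l\<le>i. of_nat (i choose l) * (- u) ^ l * x ^ (i - l))"
      using binomial_ring[of "- _" x i] by (simp add: algebra_simps)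
    also have "\<dots> = (\<Sum>l\<le>i. \<Sum>u\<in>U. of_nat (i choose l) * (- u) ^ l * x ^ (i - l))"
      by (rule sum.swap)
    also have "\<dots> = (\<Sum>l\<le>i. of_nat (i choose l) * (- 1) ^ l * x ^ (i - l) * (\<Sum>u\<in>U. u ^ l))"
      unfolding sum_distrib_left
    proof (intro sum.cong refl)
      fix l u
      show "of_nat (i choose l) * (- u) ^ l * x ^ (i - l) = of_nat (i choose l) * (- 1) ^ l * x ^ (i - l) * u ^ l"
        by (subst power_minus) simp
    qed
    also have "\<dots> = int (card U) * x ^ i + (\<Sum>l\<in>{1..i}. of_nat (i choose l) * (- 1) ^ l * x ^ (i - l) * (\<Sum>u\<in>U. u ^ l))"
    proof -
      have "{..i} = insert 0 {1..i}" by auto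
      then show ?thesis by simp
    qed
    also have "[\<dots> = int (card U) * x ^ i + (\<Sum>l\<in>{1..i}. of_nat (i choose l) * (- 1) ^ l * x ^ (i - l) * 0)] (mod int p)"
    proof (intro cong_add cong_refl cong_sum cong_mult)
      fix l assume "l \<in> {1..i}"
      then show "[(\<Sum>u\<in>U. u ^ l) = 0] (mod int p)" using zero by simp
    qed
    finally show "[(\<Sum>u\<in>U. (x - u) ^ i) = int (card U) * x ^ i] (mod int p)" by simp
  qed
  also have "(\<Sum>x\<in>{0..<int p}. g (\<pi> x) * (int (card U) * x ^ i)) =
      int (card U) * (\<Sum>x\<in>{0..<int p}. g (\<pi> x) * x ^ i)"
    by (simp add: sum_distrib_left mult.left_commute)
  finally show ?thesis .
qed

text \<open>In \<open>moment_shift_invariant\<close> for the n-th power, n = j + r, the term l = 0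
  of the binomial expansion cancels against the right-hand side, the terms with 0 < l < r vanish,
  and those with l > r contain moments with a smaller power of \<open>\<pi>\<close>, known by
  induction. The term l = r remains: n choose r, times a nonzero power sum, times the moment in
  question. The binomial coefficient is a unit since n < p.\<close>

lemma mixed_moments_vanish:
  assumes zero: "\<And>l. 1 \<le> l \<Longrightarrow> l < r \<Longrightarrow> [(\<Sum>u\<in>U. u ^ l) = 0] (mod int p)"
    and nonzero: "\<not> int p dvd (\<Sum>u\<in>U. u ^ r)"
    and r: "1 \<le> r"
    and "i < r" "j + r < p"
  shows "[(\<Sum>x\<in>{0..<int p}. \<pi> x ^ j * x ^ i) = 0] (mod int p)"
  using \<open>j + r < p\<close>
proof (induction j rule: less_induct)
  case (less j)
  define n where "n = j + r"
  define B where "B k = (\<Sum>x\<in>{0..<int p}. \<pi> x ^ k * x ^ i)" for k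
  let ?S = "\<lambda>l. \<Sum>u\<in>U. u ^ l"
  have "[(\<Sum>x\<in>{0..<int p}. (\<Sum>u\<in>U. (\<pi> x + u) ^ n) * x ^ i) = int (card U) * B n] (mod int p)"
    unfolding B_def using zero \<open>i < r\<close> by (intro moment_shift_invariant cong_pow) auto
  moreover have "(\<Sum>x\<in>{0..<int p}. (\<Sum>u\<in>U. (\<pi> x + u) ^ n) * x ^ i) = (\<Sum>l\<le>n. of_nat (n choose l) * ?S l * B (n - l))"
  proof -
    have "(\<Sum>u\<in>U. (\<pi> x + u) ^ n) = (\<Sum>l\<le>n. of_nat (n choose l) * ?S l * \<pi> x ^ (n - l))" for x
    proof -
      have "(\<Sum>u\<in>U. (\<pi> x + u) ^ n) = (\<Sum>u\<in>U. \<Sum>l\<le>n. of_nat (n choose l) * u ^ l * \<pi> x ^ (n - l))"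
        by (simp add: binomial_ring[of _ "\<pi> x" n, folded add.commute[of "\<pi> x"]])
      also have "\<dots> = (\<Sum>l\<le>n. \<Sum>u\<in>U. of_nat (n choose l) * u ^ l * \<pi> x ^ (n - l))"
        by (rule sum.swap)
      finally show ?thesis by (simp add: sum_distrib_left sum_distrib_right)
    qed
    then have "(\<Sum>x\<in>{0..<int p}. (\<Sum>u\<in>U. (\<pi> x + u) ^ n) * x ^ i) =
        (\<Sum>x\<in>{0..<int p}. \<Sum>l\<le>n. of_nat (n choose l) * ?S l * (\<pi> x ^ (n - l) * x ^ i))"
      by (simp add: sum_distrib_right mult.assoc)
    also have "\<dots> = (\<Sum>l\<le>n. \<Sum>x\<in>{0..<int p}. of_nat (n choose l) * ?S l * (\<pi> x ^ (n - l) * x ^ i))"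
      by (rule sum.swap)
    finally show ?thesis by (simp add: B_def sum_distrib_left)
  qed
  moreover have "(\<Sum>l\<le>n. of_nat (n choose l) * ?S l * B (n - l)) =
      int (card U) * B n + of_nat (n choose r) * ?S r * B j + (\<Sum>l\<in>{..n} - {0, r}. of_nat (n choose l) * ?S l * B (n - l))"
  proof -
    have "{..n} = insert 0 (insert r ({..n} - {0, r}))" using r by (auto simp: n_def)
    then have "(\<Sum>l\<le>n. of_nat (n choose l) * ?S l * B (n - l)) =
      (\<Sum>l\<in>insert 0 (insert r ({..n} - {0, r})). of_nat (n choose l) * ?S l * B (n - l))" by simp
    also have "\<dots> = int (card U) * B n + of_nat (n choose r) * ?S r * B j + (\<Sum>l\<in>{..n} - {0, r}. of_nat (n choose l) * ?S l * B (n - l))"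
      using r by (subst sum.insert; simp)+ (simp add: n_def)
    finally show ?thesis .
  qed
  moreover have "[(\<Sum>l\<in>{..n} - {0, r}. of_nat (n choose l) * ?S l * B (n - l)) = (\<Sum>l\<in>{..n} - {0, r}. 0)] (mod int p)"
  proof (rule cong_sum)
    fix l assume l: "l \<in> {..n} - {0, r}"
    show "[of_nat (n choose l) * ?S l * B (n - l) = 0] (mod int p)"
    proof (cases "l < r")
      case True
      then have "[of_nat (n choose l) * ?S l * B (n - l) = of_nat (n choose l) * 0 * B (n - l)] (mod int p)"
        using l by (intro cong_mult cong_refl zero) auto
      then show ?thesis by simp
    next
      case False
      then have "n - l < j" using l r by (auto simp: n_def)
      then have "[B (n - l) = 0] (mod int p)"
        unfolding B_def using less by simp
      then show ?thesis by (simp add: cong_0_iff)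
    qed
  qed
  ultimately have "[int (card U) * B n + of_nat (n choose r) * ?S r * B j +
      (\<Sum>l\<in>{..n} - {0, r}. of_nat (n choose l) * ?S l * B (n - l)) = int (card U) * B n] (mod int p)"
    and "int p dvd (\<Sum>l\<in>{..n} - {0, r}. of_nat (n choose l) * ?S l * B (n - l))"
    by (simp_all add: cong_0_iff)
  then have "int p dvd of_nat (n choose r) * ?S r * B j"
    by (simp add: cong_iff_dvd_diff dvd_add_left_iff)
  moreover have "\<not> int p dvd of_nat (n choose r)"
  proof -
    have "n choose r dvd fact n"
      using binomial_fact_lemma[of r n] by (metis dvd_triv_right n_def le_add2)
    moreover have "\<not> p dvd fact n"
      using prime less.prems by (simp add: prime_dvd_fact_iff n_def)
    ultimately show ?thesis by auto
  qed
  ultimately have "int p dvd B j"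
    using nonzero prime by (simp add: prime_dvd_mult_iff)
  then show ?case by (simp add: B_def cong_0_iff)
qed

end

text \<open>Let n be the degree of \<open>\<pi>\<close>. If d < n j \<le> p - 1, then the j-th power
  of \<open>\<pi>\<close> times x^(p-1-nj) has degree p - 1, so its sum is a unit, against the
  hypothesis. Thus n j \<le> p - 1 improves to n j \<le> d for j \<le> d. Since 2 d < p, the bound n
  j \<le> d passes to j + 1, and at j = d it excludes n \<ge> 2.\<close>

lemma moments_vanish_imp_affine:
  fixes \<pi> :: "int \<Rightarrow> int"
  assumes prime: "Factorial_Ring.prime p"
    and inj: "\<And>x y. [\<pi> x = \<pi> y] (mod int p) \<longleftrightarrow> [x = y] (mod int p)"
    and d: "1 \<le> d" "2 * d < p"
    and zero: "\<And>i j. j \<le> d \<Longrightarrow> i + d + 1 < p \<Longrightarrow>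
      [(\<Sum>x\<in>{0..<int p}. \<pi> x ^ j * x ^ i) = 0] (mod int p)"
  shows "\<exists>a b. \<forall>x. [\<pi> x = a * x + b] (mod int p)"
proof -
  obtain q :: "int poly" where q: "degree q \<le> p - 1" "\<And>x. [poly q x = \<pi> x] (mod int p)"
    "q = 0 \<or> \<not> int p dvd lead_coeff q"
    using interpolation_mod_prime[OF prime, of \<pi>] inj by auto
  have p1: "p > 1" using prime by (rule prime_gt_1_nat)
  have nonconst: "degree q \<noteq> 0"
  proof
    assume "degree q = 0"
    then have "poly q 0 = poly q 1" by (auto elim: degree_eq_zeroE)
    then have "[\<pi> 0 = \<pi> 1] (mod int p)" using q(2) cong_sym cong_trans by metis
    then show False using inj p1 by (auto simp: cong_def)
  qed
  define n where "n = degree q"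
  have lead: "\<not> int p dvd lead_coeff q" and "q \<noteq> 0" using q(3) nonconst by auto
  have step: "n * j \<le> d" if j: "j \<le> d" "n * j \<le> p - 1" for j
  proof (rule ccontr)
    assume "\<not> n * j \<le> d"
    define i where "i = p - 1 - n * j"
    define Q where "Q = q ^ j * monom 1 i"
    have "degree Q = p - 1"
      using \<open>q \<noteq> 0\<close> j by (simp add: Q_def degree_mult_eq degree_power_eq degree_monom_eq i_def n_def mult.commute)
    moreover have "lead_coeff Q = lead_coeff q ^ j"
      by (simp add: Q_def lead_coeff_mult lead_coeff_power degree_monom_eq)
    ultimately have "[(\<Sum>x\<in>{0..<int p}. poly Q x) = - (lead_coeff q ^ j)] (mod int p)"
      using sum_poly_mod_prime[OF prime, of Q] by simp
    moreover have "[(\<Sum>x\<in>{0..<int p}. poly Q x) = (\<Sum>x\<in>{0..<int p}. \<pi> x ^ j * x ^ i)] (mod int p)"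
      unfolding Q_def poly_mult poly_power poly_monom mult_1
      by (intro cong_sum cong_mult cong_pow cong_refl q)
    moreover have "[(\<Sum>x\<in>{0..<int p}. \<pi> x ^ j * x ^ i) = 0] (mod int p)"
      using j \<open>\<not> n * j \<le> d\<close> by (intro zero) (auto simp: i_def)
    ultimately have "[- (lead_coeff q ^ j) = 0] (mod int p)"
      using cong_sym cong_trans by blast
    then have "int p dvd lead_coeff q ^ j" by (simp add: cong_0_iff)
    then show False using lead prime prime_dvd_power by (metis prime_nat_int_transfer)
  qed
  have "n = 1"
  proof (rule ccontr)
    assume "n \<noteq> 1"
    then have n2: "n \<ge> 2" using nonconst by (simp add: n_def)
    have "n * j \<le> d" if "1 \<le> j" "j \<le> d" for j
      using that
    proof (induction j rule: dec_induct)
      case base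
      then show ?case using step[of 1] q(1) by (simp add: n_def)
    next
      case (step j)
      have "n \<le> n * j" using step by simp
      moreover have *: "n * j \<le> d" using step by simp
      ultimately have "n \<le> d" by (rule order.trans)
      then have "n * Suc j \<le> p - 1" using d * by simp
      then show ?case using \<open>Suc j \<le> d\<close> \<open>\<And>j. j \<le> d \<Longrightarrow> n * j \<le> p - 1 \<Longrightarrow> n * j \<le> d\<close> by blast
    qed
    from this[of d] have "n * d \<le> d" using d by simp
    then show False using n2 d by simp
  qed
  then have "poly q x = coeff q 1 * x + coeff q 0" for x
    using n_def by (simp add: poly_altdef)
  then have "[\<pi> x = coeff q 1 * x + coeff q 0] (mod int p)" for x
    using cong_sym[OF q(2)[of x]] by simp
  then show ?thesis by blast
qed

text \<open>The indicator of \<open>U\<close> at a nonzero c is the sum of 1 - (u - c)^(p-1) over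
  \<open>U\<close>. If the power sums of exponents 1 to p - 2 all vanished, only the two end terms
  of the expansion would survive, each equal to card U, and the indicator would take the constant
  value - card U on the nonzero residues.\<close>

lemma exists_nonvanishing_power_sum:
  assumes prime: "Factorial_Ring.prime p" and U: "U \<subseteq> {1..<int p}" "U \<noteq> {}" "U \<noteq> {1..<int p}"
  shows "\<exists>r\<ge>1. r \<le> p - 2 \<and> \<not> int p dvd (\<Sum>u\<in>U. u ^ r)"
proof (rule ccontr)
  assume "\<not> ?thesis"
  then have zero: "int p dvd (\<Sum>u\<in>U. u ^ l)" if "1 \<le> l" "l \<le> p - 2" for l
    using that by blast
  have p1: "p > 1" using prime by (rule prime_gt_1_nat)
  have fin: "finite U" by (rule finite_subset[OF U(1)]) simp
  have ndvd: "\<not> int p dvd u" if "u \<in> {1..<int p}" for u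
    using that by (auto dest: zdvd_imp_le)
  have key: "[(if c \<in> U then 1 else 0) = - int (card U)] (mod int p)" if c: "c \<in> {1..<int p}" for c
  proof -
    have "(if c \<in> U then 1 else 0) = (\<Sum>u\<in>U. if u = c then 1 else 0 :: int)"
      using fin by simp
    also have "[\<dots> = (\<Sum>u\<in>U. 1 - (u + - c) ^ (p - 1))] (mod int p)"
    proof (rule cong_sum)
      fix u assume "u \<in> U"
      then have u: "u \<in> {1..<int p}" using U by auto
      show "[(if u = c then 1 else 0) = 1 - (u + - c) ^ (p - 1)] (mod int p)"
      proof (cases "u = c")
        case True then show ?thesis using p1 by (simp add: zero_power)
      next
        case False
        then have "\<not> int p dvd u + - c"
          using u c by (auto dest!: zdvd_imp_le[rotated] simp: cong_iff_dvd_diff[symmetric] cong_def)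
        then have "[1 - 1 = 1 - (u + - c) ^ (p - 1)] (mod int p)"
          by (intro cong_diff cong_refl cong_sym[OF fermat_int] prime)
        then show ?thesis using False by simp
      qed
    qed
    also have "(\<Sum>u\<in>U. 1 - (u + - c) ^ (p - 1)) =
      int (card U) - (\<Sum>l\<le>p - 1. of_nat ((p - 1) choose l) * (- c) ^ (p - 1 - l) * (\<Sum>u\<in>U. u ^ l))"
    proof -
      have "(\<Sum>u\<in>U. (u + - c) ^ (p - 1)) = (\<Sum>u\<in>U. \<Sum>l\<le>p - 1. of_nat ((p - 1) choose l) * u ^ l * (- c) ^ (p - 1 - l))"
        by (simp only: binomial_ring)
      also have "\<dots> = (\<Sum>l\<le>p - 1. \<Sum>u\<in>U. of_nat ((p - 1) choose l) * u ^ l * (- c) ^ (p - 1 - l))"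
        by (rule sum.swap)
      finally show ?thesis
        unfolding sum_distrib_left sum_subtractf by (simp add: ac_simps)
    qed
    also have "(\<Sum>l\<le>p - 1. of_nat ((p - 1) choose l) * (- c) ^ (p - 1 - l) * (\<Sum>u\<in>U. u ^ l)) =
      (- c) ^ (p - 1) * int (card U) + (\<Sum>u\<in>U. u ^ (p - 1)) +
      (\<Sum>l\<in>{1..p - 2}. of_nat ((p - 1) choose l) * (- c) ^ (p - 1 - l) * (\<Sum>u\<in>U. u ^ l))"
    proof -
      have "{..p - 1} = insert 0 (insert (p - 1) {1..p - 2})" using p1 by auto
      moreover have "0 \<notin> insert (p - 1) {1..p - 2}" "p - 1 \<notin> {1..p - 2}" using p1 by auto
      ultimately show ?thesis by (simp del: One_nat_def)
    qed
    also have "[int (card U) - ((- c) ^ (p - 1) * int (card U) + (\<Sum>u\<in>U. u ^ (p - 1)) +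
      (\<Sum>l\<in>{1..p - 2}. of_nat ((p - 1) choose l) * (- c) ^ (p - 1 - l) * (\<Sum>u\<in>U. u ^ l))) =
      int (card U) - (1 * int (card U) + (\<Sum>u\<in>U. 1) + 0)] (mod int p)"
      using zero ndvd c U
      by (intro cong_add cong_diff cong_mult cong_refl fermat_int prime cong_sum)
        (auto simp: cong_0_iff intro!: dvd_sum)
    finally show ?thesis by simp
  qed
  obtain c c' where c: "c \<in> U" "c' \<in> {1..<int p}" "c' \<notin> U" using U by blast
  then have "c \<in> {1..<int p}" using U by blast
  from key[OF this] key[OF c(2)] c have "[1 = 0] (mod int p)"
    using cong_trans[OF _ cong_sym] by fastforce
  then show False using p1 by (simp add: cong_def)
qed

text \<open>
  P. Mueller's elementary form of Burnside's theorem on transitive groups of prime degree.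
  Convolution with the indicator of \<open>U\<close> commutes with \<open>\<pi>\<close>; if \<open>r\<close> is the least exponent with
  a nonzero power sum over \<open>U\<close>, then this operator minus a scalar lowers polynomial degrees by
  exactly \<open>r\<close>, so that composition with \<open>\<pi>\<close> preserves the polynomials of degree below \<open>r\<close> and
  those of degree below \<open>p - r\<close>. One of these spaces has degrees at most \<open>(p - 1) / 2\<close>; if \<open>\<pi>\<close> were
  not linear, the degrees of its successive powers would all stay below that bound.
\<close>

theorem connection_set_preserving_imp_affine:
  fixes \<pi> :: "int \<Rightarrow> int"
  assumes prime: "Factorial_Ring.prime p"
    and U: "U \<subseteq> {1..<int p}" "U \<noteq> {}" "U \<noteq> {1..<int p}"
    and sym: "\<And>u. u \<in> U \<Longrightarrow> int p - u \<in> U"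
    and inj: "\<And>x y. [\<pi> x = \<pi> y] (mod int p) \<longleftrightarrow> [x = y] (mod int p)"
    and pres: "\<And>x y. (\<pi> y - \<pi> x) mod int p \<in> U \<longleftrightarrow> (y - x) mod int p \<in> U"
  shows "\<exists>a b. \<forall>x. [\<pi> x = a * x + b] (mod int p)"
proof -
  have p0: "int p > 0" using prime prime_gt_0_nat by simp
  define P where "P r \<longleftrightarrow> 1 \<le> r \<and> r \<le> p - 2 \<and> \<not> int p dvd (\<Sum>u\<in>U. u ^ r)" for r
  obtain r where r: "P r" "\<And>l. l < r \<Longrightarrow> \<not> P l"
    using exists_nonvanishing_power_sum[OF prime U] exists_least_iff[of P] unfolding P_def by blast
  have zero: "[(\<Sum>u\<in>U. u ^ l) = 0] (mod int p)" if "1 \<le> l" "l < r" for l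
    using r(1) r(2)[OF that(2)] that unfolding P_def by (auto simp: cong_0_iff)
  \<comment> \<open>Pairing u with p - u makes twice the first power sum a multiple of p. Hence
    \<open>r\<close> is at least 2, so that the bound \<open>r - 1\<close> used below is a
    legitimate choice of d.\<close>
  have "r \<noteq> 1"
  proof
    assume "r = 1"
    have "(\<Sum>u\<in>U. int p - u) = (\<Sum>u\<in>U. u)"
      by (rule sum.reindex_bij_witness[where i = "\<lambda>u. int p - u" and j = "\<lambda>u. int p - u"]) (auto simp: sym)
    then have "2 * (\<Sum>u\<in>U. u) = int (card U) * int p"
      by (simp add: sum_subtractf)
    then have "int p dvd 2 * (\<Sum>u\<in>U. u)" by simp
    moreover have "\<not> int p dvd 2"
      using r(1) \<open>r = 1\<close> by (auto simp: P_def dest!: zdvd_imp_le)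
    ultimately have "int p dvd (\<Sum>u\<in>U. u)"
      using prime by (simp add: prime_dvd_mult_iff)
    then show False using r(1) \<open>r = 1\<close> by (simp add: P_def)
  qed
  then have r2: "2 \<le> r" "r \<le> p - 2" "3 < p" using r(1) by (auto simp: P_def)
  have orth: "[(\<Sum>x\<in>{0..<int p}. \<rho> x ^ j * x ^ i) = 0] (mod int p)"
    if "\<And>x y. [\<rho> x = \<rho> y] (mod int p) \<longleftrightarrow> [x = y] (mod int p)"
      and "\<And>x y. (\<rho> y - \<rho> x) mod int p \<in> U \<longleftrightarrow> (y - x) mod int p \<in> U"
      and "i < r" "j + r < p" for \<rho> :: "int \<Rightarrow> int" and i j
    using r(1) that zero by (intro mixed_moments_vanish[OF prime U(1), where r = r]) (auto simp: P_def)
  show ?thesis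
  proof (cases "2 * (p - 1 - r) < p")
    case True
    show ?thesis
    proof (rule moments_vanish_imp_affine[OF prime inj _ True])
      show "1 \<le> p - 1 - r" using r2 by simp
      show "[(\<Sum>x\<in>{0..<int p}. \<pi> x ^ j * x ^ i) = 0] (mod int p)"
        if "j \<le> p - 1 - r" "i + (p - 1 - r) + 1 < p" for i j
        using r2 that by (intro orth inj pres) auto
    qed
  next
    case False
    have inj_mod: "inj_on (\<lambda>x. \<pi> x mod int p) {0..<int p}"
      using inj by (auto intro!: inj_onI simp: cong_def)
    then have "(\<lambda>x. \<pi> x mod int p) ` {0..<int p} = {0..<int p}"
      using p0 by (intro endo_inj_surj) auto
    then have "\<forall>y. \<exists>x. [\<pi> x = y] (mod int p)"
      using p0 by (metis (no_types, lifting) atLeastLessThan_iff cong_def imageE mod_mod_trivial pos_mod_bound pos_mod_sign)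
    \<comment> \<open>For small r the moments at hand involve only low powers of x, and the roles of
      x and \<open>\<pi>\<close> must be exchanged. The inverse \<open>\<sigma>\<close> also
      preserves \<open>U\<close>, and reindexing turns its moments into those of
      \<open>\<pi>\<close>.\<close>
    then obtain \<sigma> where \<sigma>: "\<And>y. [\<pi> (\<sigma> y) = y] (mod int p)" by metis
    have inj': "[\<sigma> x = \<sigma> y] (mod int p) \<longleftrightarrow> [x = y] (mod int p)" for x y
      using inj[of "\<sigma> x" "\<sigma> y"] \<sigma> by (meson cong_sym cong_trans)
    have pres': "(\<sigma> y - \<sigma> x) mod int p \<in> U \<longleftrightarrow> (y - x) mod int p \<in> U" for x y
    proof -
      have "(\<pi> (\<sigma> y) - \<pi> (\<sigma> x)) mod int p = (y - x) mod int p"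
        using cong_diff[OF \<sigma> \<sigma>] by (simp add: cong_def)
      then show ?thesis using pres[of "\<sigma> y" "\<sigma> x"] by simp
    qed
    show ?thesis
    proof (rule moments_vanish_imp_affine[OF prime inj, where d = "r - 1"])
      show "1 \<le> r - 1" "2 * (r - 1) < p" using r2 False by auto
      fix i j assume ij: "j \<le> r - 1" "i + (r - 1) + 1 < p"
      have "[(\<Sum>x\<in>{0..<int p}. \<pi> x ^ j * x ^ i) = (\<Sum>x\<in>{0..<int p}. \<pi> (\<sigma> x) ^ j * \<sigma> x ^ i)] (mod int p)"
        by (rule cong_sym[OF rsum_reindex]) (use p0 inj inj' in \<open>auto intro!: cong_mult cong_pow\<close>)
      also have "[(\<Sum>x\<in>{0..<int p}. \<pi> (\<sigma> x) ^ j * \<sigma> x ^ i) = (\<Sum>x\<in>{0..<int p}. x ^ j * \<sigma> x ^ i)] (mod int p)"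
        by (intro cong_sum cong_mult cong_pow cong_refl \<sigma>)
      also have "(\<Sum>x\<in>{0..<int p}. x ^ j * \<sigma> x ^ i) = (\<Sum>x\<in>{0..<int p}. \<sigma> x ^ i * x ^ j)"
        by (simp add: mult.commute)
      also have "[(\<Sum>x\<in>{0..<int p}. \<sigma> x ^ i * x ^ j) = 0] (mod int p)"
        using r2 ij by (intro orth inj' pres') auto
      finally show "[(\<Sum>x\<in>{0..<int p}. \<pi> x ^ j * x ^ i) = 0] (mod int p)" .
    qed
  qed
qed

section \<open>The Legendre symbol\<close>

lemma cong_small_diff_imp_eq:
  fixes a b m :: int
  assumes "[a = b] (mod m)" "\<bar>a - b\<bar> < m"
  shows "a = b"
  using assms dvd_imp_le_int[of "a - b" m] by (auto simp: cong_iff_dvd_diff)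

context
  fixes p :: nat
  assumes prime: "Factorial_Ring.prime p" and odd: "2 < p"
begin

abbreviation (input) \<chi> :: "int \<Rightarrow> int" where "\<chi> x \<equiv> Legendre x (int p)"

lemma Legendre_cong: "[x = y] (mod int p) \<Longrightarrow> \<chi> x = \<chi> y"
  by (simp only: Legendre_def QuadRes_def cong_def)

lemma Legendre_eq_0_iff: "\<chi> x = 0 \<longleftrightarrow> int p dvd x"
  by (simp add: Legendre_def cong_0_iff)

lemma Legendre_values: "\<chi> x = 0 \<or> \<chi> x = 1 \<or> \<chi> x = - 1"
  by (simp add: Legendre_def)

lemma Legendre_eqI:
  assumes "[\<chi> x = k] (mod int p)" "k = 0 \<or> k = 1 \<or> k = - 1"
  shows "\<chi> x = k"
  by (rule cong_small_diff_imp_eq[OF assms(1)]) (use Legendre_values[of x] assms(2) odd in auto)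

lemma Legendre_cong_power: "[\<chi> x = x ^ ((p - 1) div 2)] (mod int p)"
  using euler_criterion[OF prime odd] .

lemma Legendre_mult: "\<chi> (x * y) = \<chi> x * \<chi> y"
proof (rule Legendre_eqI)
  have "[\<chi> (x * y) = x ^ ((p - 1) div 2) * y ^ ((p - 1) div 2)] (mod int p)"
    using Legendre_cong_power[of "x * y"] by (simp add: power_mult_distrib)
  then show "[\<chi> (x * y) = \<chi> x * \<chi> y] (mod int p)"
    using cong_mult[OF Legendre_cong_power Legendre_cong_power, of x y] cong_sym cong_trans by blast
  show "\<chi> x * \<chi> y = 0 \<or> \<chi> x * \<chi> y = 1 \<or> \<chi> x * \<chi> y = - 1"
    using Legendre_values[of x] Legendre_values[of y] by auto
qed

lemma Legendre_eq_1_iff: "\<chi> x = 1 \<longleftrightarrow> \<not> int p dvd x \<and> (\<exists>y. [x = y ^ 2] (mod int p))"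
proof -
  have "QuadRes (int p) x \<longleftrightarrow> (\<exists>y. [x = y ^ 2] (mod int p))"
    unfolding QuadRes_def by (rule arg_cong[where f = Ex], rule ext, rule cong_sym_eq)
  then show ?thesis by (simp add: Legendre_def cong_0_iff)
qed

lemma Legendre_1: "\<chi> 1 = 1"
proof -
  have "\<not> int p dvd 1" using odd by simp
  moreover have "[1 = 1 ^ 2] (mod int p)" by simp
  ultimately show ?thesis unfolding Legendre_eq_1_iff by blast
qed

lemma Legendre_inverse:
  assumes "[x * y = 1] (mod int p)"
  shows "\<chi> y = \<chi> x"
proof -
  have "\<chi> x * \<chi> y = 1" using Legendre_cong[OF assms] by (simp add: Legendre_mult Legendre_1)
  then show ?thesis using Legendre_values[of x] Legendre_values[of y] by auto
qed

section \<open>Character sums and cyclotomic numbers of order two\<close>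

lemma sum_bound_except_zeros:
  fixes f :: "int \<Rightarrow> int"
  assumes "Z \<subseteq> {0..<int p}" "\<And>x. x \<in> Z \<Longrightarrow> f x = 0" "\<And>x. \<bar>f x\<bar> \<le> 1"
  shows "\<bar>\<Sum>x\<in>{0..<int p}. f x\<bar> \<le> int p - int (card Z)"
proof -
  have fin: "finite Z" by (rule finite_subset[OF assms(1)]) simp
  have "(\<Sum>x\<in>{0..<int p}. f x) = (\<Sum>x\<in>{0..<int p} - Z. f x)"
    by (rule sum.mono_neutral_right) (use assms in auto)
  moreover have "\<bar>\<Sum>x\<in>{0..<int p} - Z. f x\<bar> \<le> (\<Sum>x\<in>{0..<int p} - Z. 1)"
    by (rule order.trans[OF sum_abs sum_mono]) (rule assms)
  moreover have "card Z \<le> p" using card_mono[OF _ assms(1)] by simp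
  ultimately show ?thesis using fin assms(1) by (simp add: card_Diff_subset of_nat_diff)
qed

lemma Legendre_root: "\<chi> (d mod int p - d) = 0"
  unfolding Legendre_eq_0_iff mod_eq_dvd_iff[symmetric] by simp

text \<open>Euler's criterion turns the sum into a power sum of exponent (p - 1) / 2, which is 0
  modulo p. Of the p terms, all of size at most 1, one is 0; the sum is smaller than p in absolute
  value and the congruence is an equality.\<close>

lemma sum_Legendre_shift: "(\<Sum>x\<in>{0..<int p}. \<chi> (x - d)) = 0"
proof (rule cong_small_diff_imp_eq)
  have "[(\<Sum>x\<in>{0..<int p}. \<chi> (x - d)) = (\<Sum>x\<in>{0..<int p}. \<chi> x)] (mod int p)"
  proof (rule rsum_reindex)
    show "[x = y] (mod int p)" if "[x - d = y - d] (mod int p)" for x y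
      using that by (simp add: cong_iff_dvd_diff)
  qed (use odd in \<open>auto simp: Legendre_cong\<close>)
  also have "[(\<Sum>x\<in>{0..<int p}. \<chi> x) = (\<Sum>x\<in>{0..<int p}. x ^ ((p - 1) div 2))] (mod int p)"
    by (intro cong_sum Legendre_cong_power)
  also have "[(\<Sum>x\<in>{0..<int p}. x ^ ((p - 1) div 2)) = 0] (mod int p)"
    using odd by (intro sum_powers_mod_prime prime) auto
  finally show "[(\<Sum>x\<in>{0..<int p}. \<chi> (x - d)) = 0] (mod int p)" .
  show "\<bar>(\<Sum>x\<in>{0..<int p}. \<chi> (x - d)) - 0\<bar> < int p"
    using sum_bound_except_zeros[of "{d mod int p}" "\<lambda>x. \<chi> (x - d)"] odd
    by (simp add: Legendre_root) (simp add: Legendre_def)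
qed

lemma sum_Legendre: "(\<Sum>x\<in>{0..<int p}. \<chi> x) = 0"
  using sum_Legendre_shift[of 0] by simp

text \<open>Modulo p the summand is the monic polynomial x^e (x - d)^e of degree p - 1 with e = (p -
  1) / 2, so the sum is -1 modulo p. The two zeros 0 and d bound it by p - 2, which leaves no other
  value.\<close>

lemma sum_Legendre_product:
  assumes "\<not> int p dvd d"
  shows "(\<Sum>x\<in>{0..<int p}. \<chi> x * \<chi> (x - d)) = - 1"
proof (rule cong_small_diff_imp_eq)
  define e where "e = (p - 1) div 2"
  have "odd p" using prime odd prime_odd_nat by simp
  then have pe: "p - 1 = e + e" unfolding e_def by (auto elim!: oddE)
  define Q where "Q = monom 1 e * [:- d, 1 :: int:] ^ e"
  have "degree Q = p - 1"
    unfolding pe by (simp add: Q_def degree_mult_eq degree_power_eq degree_monom_eq)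
  moreover have "lead_coeff Q = 1"
    by (simp add: Q_def lead_coeff_mult lead_coeff_power degree_monom_eq)
  ultimately have "[(\<Sum>x\<in>{0..<int p}. poly Q x) = - 1] (mod int p)"
    using sum_poly_mod_prime[OF prime, of Q] by simp
  moreover have "[(\<Sum>x\<in>{0..<int p}. \<chi> x * \<chi> (x - d)) = (\<Sum>x\<in>{0..<int p}. poly Q x)] (mod int p)"
  proof (rule cong_sum)
    fix x
    show "[\<chi> x * \<chi> (x - d) = poly Q x] (mod int p)"
      using cong_mult[OF Legendre_cong_power[of x] Legendre_cong_power[of "x - d"]]
      by (simp add: Q_def poly_monom e_def)
  qed
  ultimately show "[(\<Sum>x\<in>{0..<int p}. \<chi> x * \<chi> (x - d)) = - 1] (mod int p)"
    by (rule cong_trans[rotated])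
  have "d mod int p \<noteq> 0" using assms by (simp add: dvd_eq_mod_eq_0)
  then have "card {0, d mod int p} = 2" by simp
  moreover have "\<bar>\<chi> x * \<chi> (x - d)\<bar> \<le> 1" for x
    using Legendre_values[of x] Legendre_values[of "x - d"] by auto
  ultimately have "\<bar>\<Sum>x\<in>{0..<int p}. \<chi> x * \<chi> (x - d)\<bar> \<le> int p - 2"
    using sum_bound_except_zeros[of "{0, d mod int p}" "\<lambda>x. \<chi> x * \<chi> (x - d)"] odd
    using Legendre_root[of d] Legendre_eq_0_iff[of 0] by fastforce
  then show "\<bar>(\<Sum>x\<in>{0..<int p}. \<chi> x * \<chi> (x - d)) - - 1\<bar> < int p" by linarith
qed

text \<open>The square of \<open>\<chi> (x - d)\<close> is the weight that deletes the residue of d;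
  the counts below account in this way for the zeros of the symbol.\<close>

lemma sum_except_root:
  fixes f :: "int \<Rightarrow> int"
  assumes f: "\<And>x y. [x = y] (mod int p) \<Longrightarrow> f x = f y"
  shows "(\<Sum>x\<in>{0..<int p}. f x * \<chi> (x - d) ^ 2) = (\<Sum>x\<in>{0..<int p}. f x) - f d"
proof -
  have d: "d mod int p \<in> {0..<int p}" using odd by simp
  have z: "\<chi> (x - d) ^ 2 = (if x = d mod int p then 0 else 1)" if "x \<in> {0..<int p}" for x
  proof -
    have "\<chi> (x - d) = 0 \<longleftrightarrow> x = d mod int p"
      using that by (simp add: Legendre_eq_0_iff mod_eq_dvd_iff[symmetric])
    then show ?thesis using Legendre_values[of "x - d"] by auto
  qed
  have "(\<Sum>x\<in>{0..<int p}. f x * \<chi> (x - d) ^ 2) = (\<Sum>x\<in>{0..<int p} - {d mod int p}. f x)"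
    using d by (simp add: z sum.remove)
  then have "(\<Sum>x\<in>{0..<int p}. f x * \<chi> (x - d) ^ 2) = (\<Sum>x\<in>{0..<int p}. f x) - f (d mod int p)"
    using d by (simp add: sum.remove)
  moreover have "f (d mod int p) = f d" by (rule f) (simp add: cong_def)
  ultimately show ?thesis by simp
qed

lemma card_Legendre_eq:
  assumes "s = 1 \<or> s = - 1"
  shows "2 * card {x \<in> {0..<int p}. \<chi> x = s} = p - 1"
proof -
  have "(\<Sum>x\<in>{0..<int p}. \<chi> x ^ 2 + s * \<chi> x) = (\<Sum>x\<in>{0..<int p}. if \<chi> x = s then 2 else 0)"
    using assms by (intro sum.cong refl) (auto simp: Legendre_def)
  also have "\<dots> = 2 * int (card {x \<in> {0..<int p}. \<chi> x = s})"
    by (simp add: sum.inter_filter[symmetric])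
  finally have "2 * int (card {x \<in> {0..<int p}. \<chi> x = s}) = (\<Sum>x\<in>{0..<int p}. \<chi> x ^ 2)"
    by (simp add: sum.distrib sum_distrib_left[symmetric] sum_Legendre)
  also have "\<dots> = int p - 1"
    using sum_except_root[of "\<lambda>_. 1" 0] by simp
  finally show ?thesis using odd by linarith
qed

text \<open>The product of \<open>\<chi> x ^ 2 + s * \<chi> x\<close> with its analogue at x - d is
  4 on the set counted and 0 elsewhere; multiplied out, it becomes four known character sums. For s
  = t = 1 these are the Paley parameters: (p - 5) / 4 common neighbours of adjacent points, (p - 1)
  / 4 of nonadjacent ones.\<close>

lemma card_Legendre_pair:
  assumes st: "s = 1 \<or> s = - 1" "t = 1 \<or> t = - 1" and d: "\<not> int p dvd d" and m1: "\<chi> (- 1) = 1"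
  shows "4 * int (card {x \<in> {0..<int p}. \<chi> x = s \<and> \<chi> (x - d) = t}) = int p - 2 - (s + t) * \<chi> d - s * t"
proof -
  let ?R = "{0..<int p}"
  have "4 * int (card {x \<in> ?R. \<chi> x = s \<and> \<chi> (x - d) = t}) = (\<Sum>x\<in>?R. if \<chi> x = s \<and> \<chi> (x - d) = t then 4 else 0)"
    by (simp add: sum.inter_filter[symmetric])
  also have "\<dots> = (\<Sum>x\<in>?R. (\<chi> x ^ 2 + s * \<chi> x) * (\<chi> (x - d) ^ 2 + t * \<chi> (x - d)))"
  proof (intro sum.cong refl)
    fix x
    show "(if \<chi> x = s \<and> \<chi> (x - d) = t then 4 else 0) = (\<chi> x ^ 2 + s * \<chi> x) * (\<chi> (x - d) ^ 2 + t * \<chi> (x - d))"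
      using Legendre_values[of x] Legendre_values[of "x - d"] st by auto
  qed
  also have "\<dots> = (\<Sum>x\<in>?R. \<chi> x ^ 2 * \<chi> (x - d) ^ 2) + s * (\<Sum>x\<in>?R. \<chi> x * \<chi> (x - d) ^ 2) +
      t * (\<Sum>x\<in>?R. \<chi> (x - d) * \<chi> (x - 0) ^ 2) + s * t * (\<Sum>x\<in>?R. \<chi> x * \<chi> (x - d))"
    by (simp add: sum_distrib_left sum.distrib algebra_simps)
  also have "(\<Sum>x\<in>?R. \<chi> x ^ 2 * \<chi> (x - d) ^ 2) = (\<Sum>x\<in>?R. \<chi> x ^ 2) - \<chi> d ^ 2"
    by (rule sum_except_root) (simp add: Legendre_cong)
  also have "(\<Sum>x\<in>?R. \<chi> x ^ 2) = int p - 1"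
    using sum_except_root[of "\<lambda>_. 1" 0] by simp
  also have "\<chi> d ^ 2 = 1" using d Legendre_values[of d] Legendre_eq_0_iff[of d] by auto
  also have "(\<Sum>x\<in>?R. \<chi> x * \<chi> (x - d) ^ 2) = (\<Sum>x\<in>?R. \<chi> x) - \<chi> d"
    by (rule sum_except_root) (simp add: Legendre_cong)
  also have "(\<Sum>x\<in>?R. \<chi> (x - d) * \<chi> (x - 0) ^ 2) = (\<Sum>x\<in>?R. \<chi> (x - d)) - \<chi> (0 - d)"
    by (rule sum_except_root) (simp add: Legendre_cong cong_diff)
  also have "\<chi> (0 - d) = \<chi> d" using Legendre_mult[of "- 1" d] m1 by simp
  finally show ?thesis
    by (simp add: sum_Legendre sum_Legendre_shift sum_Legendre_product[OF d] algebra_simps)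
qed

lemma Legendre_minus:
  assumes "\<chi> (- 1) = 1"
  shows "\<chi> (- x) = \<chi> x"
  using Legendre_mult[of "- 1" x] assms by simp

lemma exists_nonresidue: "\<exists>x. \<chi> x = - 1"
proof -
  have "card {x \<in> {0..<int p}. \<chi> x = - 1} \<noteq> 0"
    using card_Legendre_eq[of "- 1"] odd by linarith
  then show ?thesis using card_eq_0_iff by fastforce
qed

text \<open>For a nonresidue e, the number of x with x and x - e both residues is (p - 1) / 4, and
  it is an integer.\<close>

lemma Legendre_minus_one_imp_cong_1_mod_4:
  assumes "\<chi> (- 1) = 1"
  shows "[p = 1] (mod 4)"
proof -
  from exists_nonresidue obtain e where e: "\<chi> e = - 1" ..
  have nd: "\<not> int p dvd e" using e Legendre_eq_0_iff[of e] by auto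
  have "int p - 1 = 4 * int (card {x \<in> {0..<int p}. \<chi> x = 1 \<and> \<chi> (x - e) = 1})"
    using card_Legendre_pair[of 1 1 e, OF _ _ nd assms] e by simp
  then have "int 4 dvd int (p - 1)" using odd by (simp add: of_nat_diff)
  then have "4 dvd p - 1" by (simp only: int_dvd_int_iff)
  then show ?thesis using odd by (simp add: cong_altdef_nat)
qed

end

text \<open>If a nonzero shift preserved the nonresidues, the pair count would be (p - 1) / 2, and
  comparison with its formula would give p + 1 = 2 or -2. The lemma lets a vertex be recovered from
  its pattern of adjacencies to a neighbourhood.\<close>

lemma Legendre_class_determines_shift:
  assumes p: "Factorial_Ring.prime p" "2 < p" and m1: "Legendre (- 1) (int p) = 1"
    and eq: "\<And>i. Legendre (i - e) (int p) = - 1 \<longleftrightarrow> Legendre i (int p) = - 1"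
  shows "int p dvd e"
proof (rule ccontr)
  assume "\<not> int p dvd e"
  then have "4 * int (card {y \<in> {0..<int p}. Legendre y (int p) = - 1 \<and> Legendre (y - e) (int p) = - 1}) =
      int p - 2 + 2 * Legendre e (int p) - 1"
    using card_Legendre_pair[OF p _ _ _ m1, of "- 1" "- 1" e] by simp
  moreover have "{y \<in> {0..<int p}. Legendre y (int p) = - 1 \<and> Legendre (y - e) (int p) = - 1} =
      {y \<in> {0..<int p}. Legendre y (int p) = - 1}"
    using eq by auto
  moreover have "2 * int (card {y \<in> {0..<int p}. Legendre y (int p) = - 1}) = int p - 1"
    using card_Legendre_eq[OF p, of "- 1"] p by simp
  ultimately have "int p + 1 = 2 * Legendre e (int p)" by simp
  then show False using p(2) Legendre_values[OF p, of e] by auto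
qed

section \<open>Automorphisms and cyclic labellings of neighbourhoods\<close>

lemma funpow_fixed_mult: "(f ^^ k) v = v \<Longrightarrow> (f ^^ (k * n)) v = v"
  by (induction n) (auto simp: funpow_add)

text \<open>If v returned after k steps with k prime to p, then some multiple of k would exceed a
  multiple of p by one; since v returns after both numbers of steps, f would fix v.\<close>

lemma funpow_eq_iff_cong_prime:
  assumes prime: "Factorial_Ring.prime p" and inj: "inj_on f N" and closed: "f ` N \<subseteq> N" and v: "v \<in> N"
    and period: "(f ^^ p) v = v" and moved: "f v \<noteq> v"
  shows "(f ^^ i) v = (f ^^ j) v \<longleftrightarrow> [i = j] (mod p)"
proof -
  have dvd: "p dvd k" if k: "(f ^^ k) v = v" for k
  proof (rule ccontr)
    assume "\<not> p dvd k"
    then have "coprime k p" using prime by (metis coprime_commute prime_imp_coprime)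
    then obtain x where "[k * x = 1] (mod p)" using cong_solve_coprime_nat by auto
    then have "k * x mod p = 1" using prime_gt_1_nat[OF prime] by (simp add: cong_def)
    then obtain q where "k * x = Suc (p * q)" by (metis mod_mult_div_eq plus_1_eq_Suc)
    then have "v = f ((f ^^ (p * q)) v)"
      using funpow_fixed_mult[OF k, of x] by simp
    then show False using moved funpow_fixed_mult[OF period] by simp
  qed
  have mem: "(f ^^ k) x \<in> N" if "x \<in> N" for k x
    using that closed by (induction k) auto
  have cancel: "x = y" if "(f ^^ k) x = (f ^^ k) y" "x \<in> N" "y \<in> N" for k x y
    using that(1)
  proof (induction k)
    case (Suc k)
    then have "f ((f ^^ k) x) = f ((f ^^ k) y)" by simp
    then have "(f ^^ k) x = (f ^^ k) y" using inj mem that(2,3) by (meson inj_onD)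
    then show ?case by (rule Suc.IH)
  qed simp
  have le: "(f ^^ i) v = (f ^^ j) v \<longleftrightarrow> [i = j] (mod p)" if "i \<le> j" for i j
  proof -
    have "(f ^^ j) v = (f ^^ i) ((f ^^ (j - i)) v)"
      using that by (simp add: funpow_add[symmetric, THEN fun_cong, unfolded o_def])
    then have "(f ^^ i) v = (f ^^ j) v \<longleftrightarrow> (f ^^ (j - i)) v = v"
      using cancel[of i v "(f ^^ (j - i)) v"] mem v by auto
    also have "\<dots> \<longleftrightarrow> p dvd j - i"
      using dvd funpow_fixed_mult[OF period] by (auto elim!: dvdE)
    also have "\<dots> \<longleftrightarrow> [i = j] (mod p)"
      using that by (metis cong_altdef_nat cong_sym_eq)
    finally show ?thesis .
  qed
  show ?thesis using le[of i j] le[of j i] by (metis cong_sym_eq linear)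
qed

lemma BijGroup_mult_apply:
  "f \<in> Bij S \<Longrightarrow> g \<in> Bij S \<Longrightarrow> v \<in> S \<Longrightarrow> (f \<otimes>\<^bsub>BijGroup S\<^esub> g) v = f (g v)"
  by (simp add: BijGroup_def compose_def)

text \<open>By orbit counting p divides the order of \<open>K\<close>, so Sylow's theorem yields a
  subgroup of order p. A nontrivial element of it moves some point, and that point then has p
  distinct iterates. Iterates of the function are used instead of group powers because they become
  the labels.\<close>

lemma transitive_of_prime_degree_has_cycle:
  assumes prime: "Factorial_Ring.prime p" and card: "card N = p" and K: "subgroup K (BijGroup N)"
    and trans: "\<And>x y. x \<in> N \<Longrightarrow> y \<in> N \<Longrightarrow> \<exists>f \<in> K. f x = y"
  shows "\<exists>f \<in> K. \<exists>v \<in> N. \<forall>i j. (f ^^ i) v = (f ^^ j) v \<longleftrightarrow> [i = j] (mod p)"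
proof -
  have p1: "p > 1" using prime by (rule prime_gt_1_nat)
  then have finN: "finite N" using card by (intro card_ge_0_finite) simp
  interpret B: group "BijGroup N" by (rule group_BijGroup)
  let ?G = "BijGroup N\<lparr>carrier := K\<rparr>"
  have KB: "K \<subseteq> Bij N" using subgroup.subset[OF K] by (simp add: BijGroup_def)
  interpret G: group ?G using K by (rule subgroup.subgroup_is_group) (rule group_BijGroup)
  interpret A: group_action ?G N id
    by (rule group_action.intro) (use B.canonical_inj_is_hom[OF K] in simp)
  have finK: "finite K"
  proof (rule finite_subset)
    show "K \<subseteq> N \<rightarrow>\<^sub>E N" using KB by (auto simp: Bij_def PiE_def bij_betw_def)
  qed (use finN in \<open>auto intro: finite_PiE\<close>)
  obtain v0 where v0: "v0 \<in> N" using card p1 by fastforce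
  have "f v0 \<in> N" if "f \<in> K" for f
    using that KB v0 by (auto simp: Bij_def bij_betw_def)
  then have "orbit ?G id v0 = N"
    using trans[OF v0] by (auto simp: orbit_def)
  then have "Coset.order ?G = p ^ 1 * card (stabilizer ?G id v0)"
    using A.orbit_stabilizer_theorem[OF v0] card by simp
  then obtain H where H: "subgroup H ?G" "card H = p"
    using sylow_thm[OF prime G.is_group, of 1 "card (stabilizer ?G id v0)"] finK by auto
  have HK: "H \<subseteq> K" using subgroup.subset[OF H(1)] by simp
  interpret H: group "?G\<lparr>carrier := H\<rparr>" using H(1) by (rule subgroup.subgroup_is_group) (rule G.is_group)
  obtain f where f: "f \<in> H" "f \<noteq> (\<lambda>x\<in>N. x)"
  proof -
    have "\<not> H \<subseteq> {\<lambda>x\<in>N. x}"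
    proof
      assume "H \<subseteq> {\<lambda>x\<in>N. x}"
      then have "card H \<le> 1" using card_mono[of "{\<lambda>x\<in>N. x}" H] by simp
      then show False using H(2) p1 by simp
    qed
    then show ?thesis using that by blast
  qed
  have fB: "f \<in> Bij N" using f HK KB by auto
  \<comment> \<open>Products in \<open>BijGroup\<close> are composites restricted to
    \<open>N\<close>, so group powers and iterates are compared on \<open>N\<close> only.\<close>
  have pow: "(f [^]\<^bsub>?G\<lparr>carrier := H\<rparr>\<^esub> n) v = (f ^^ n) v" if "v \<in> N" for n :: nat and v
    using that
  proof (induction n arbitrary: v)
    case 0
    then show ?case by (simp add: BijGroup_def nat_pow_def)
  next
    case (Suc n)
    have "f [^]\<^bsub>?G\<lparr>carrier := H\<rparr>\<^esub> n \<in> Bij N"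
      using H.nat_pow_closed[of f n] f HK KB by auto
    then have "(f [^]\<^bsub>?G\<lparr>carrier := H\<rparr>\<^esub> Suc n) v = (f [^]\<^bsub>?G\<lparr>carrier := H\<rparr>\<^esub> n) (f v)"
      using BijGroup_mult_apply[OF _ fB Suc.prems] by simp
    moreover have "f v \<in> N" using fB Suc.prems by (auto simp: Bij_def bij_betw_def)
    ultimately show ?case using Suc.IH by (simp only: funpow_Suc_right o_apply)
  qed
  have "Coset.order (?G\<lparr>carrier := H\<rparr>) = p" using H(2) by (simp add: Coset.order_def)
  then have "f [^]\<^bsub>?G\<lparr>carrier := H\<rparr>\<^esub> p = \<one>\<^bsub>BijGroup N\<^esub>"
    using H.pow_order_eq_1[of f] f(1) by simp
  then have period: "(f ^^ p) v = v" if "v \<in> N" for v using pow[OF that, of p] that by (simp add: BijGroup_def)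
  obtain v where v: "v \<in> N" "f v \<noteq> v"
  proof -
    have "\<exists>v\<in>N. f v \<noteq> v"
    proof (rule ccontr)
      assume "\<not> ?thesis"
      then have "f = (\<lambda>x\<in>N. x)" using fB by (auto simp: Bij_def extensional_def fun_eq_iff)
      then show False using f by simp
    qed
    then show ?thesis using that by blast
  qed
  have "inj_on f N" "f ` N \<subseteq> N" using fB by (auto simp: Bij_def bij_betw_def)
  then have "\<forall>i j. (f ^^ i) v = (f ^^ j) v \<longleftrightarrow> [i = j] (mod p)"
    using funpow_eq_iff_cong_prime[OF prime _ _ v(1) period[OF v(1)] v(2)] by blast
  then show ?thesis using f HK v by blast
qed

text \<open>Values outside \<open>V\<close> are left free, in contrast to the extensional functions
  of the automorphism group, so that composites, \<open>id\<close> and \<open>inv_into\<close>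
  qualify without being restricted.\<close>

definition graph_aut :: "'a set \<Rightarrow> ('a \<Rightarrow> 'a \<Rightarrow> bool) \<Rightarrow> ('a \<Rightarrow> 'a) \<Rightarrow> bool" where
  "graph_aut V E g \<longleftrightarrow> bij_betw g V V \<and> (\<forall>u\<in>V. \<forall>v\<in>V. E (g u) (g v) \<longleftrightarrow> E u v)"

section \<open>Finite simple graphs given by an adjacency predicate\<close>

locale simple_graph =
  fixes V :: "'a set" and E :: "'a \<Rightarrow> 'a \<Rightarrow> bool"
  assumes finite_V: "finite V"
    and E_dom: "E u v \<Longrightarrow> u \<in> V \<and> v \<in> V"
    and E_sym: "E u v \<Longrightarrow> E v u"
    and E_irrefl: "\<not> E u u"
begin

abbreviation aut where "aut \<equiv> graph_aut V E"

lemma E_commute: "E u v \<longleftrightarrow> E v u"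
  using E_sym by blast

lemma aut_in: "aut g \<Longrightarrow> x \<in> V \<Longrightarrow> g x \<in> V"
  by (auto simp: graph_aut_def bij_betw_def)

lemma aut_E: "aut g \<Longrightarrow> u \<in> V \<Longrightarrow> v \<in> V \<Longrightarrow> E (g u) (g v) \<longleftrightarrow> E u v"
  by (simp add: graph_aut_def)

lemma aut_eq: "aut g \<Longrightarrow> u \<in> V \<Longrightarrow> v \<in> V \<Longrightarrow> g u = g v \<longleftrightarrow> u = v"
  by (auto simp: graph_aut_def bij_betw_def inj_on_def)

lemma aut_surj: "aut g \<Longrightarrow> y \<in> V \<Longrightarrow> \<exists>x\<in>V. g x = y"
proof -
  assume "aut g" "y \<in> V"
  then have "y \<in> g ` V" by (simp add: graph_aut_def bij_betw_def)
  then show ?thesis by auto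
qed

lemma aut_comp: "aut g \<Longrightarrow> aut h \<Longrightarrow> aut (g \<circ> h)"
  using aut_in by (auto simp: graph_aut_def intro: bij_betw_trans)

lemma aut_id: "aut id"
  by (simp add: graph_aut_def)

lemma aut_inv:
  assumes g: "aut g"
  shows "aut (inv_into V g)"
proof -
  have b: "bij_betw (inv_into V g) V V" using g by (simp add: graph_aut_def bij_betw_inv_into)
  moreover have "E (inv_into V g u) (inv_into V g v) \<longleftrightarrow> E u v" if "u \<in> V" "v \<in> V" for u v
  proof -
    have "g (inv_into V g u) = u" "g (inv_into V g v) = v"
      using g that by (auto simp: graph_aut_def bij_betw_def f_inv_into_f)
    then show ?thesis
      using aut_E[OF g, of "inv_into V g u" "inv_into V g v"] b that by (auto simp: bij_betw_def)
  qed
  ultimately show ?thesis by (simp add: graph_aut_def)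
qed

lemma aut_inv_left: "aut g \<Longrightarrow> x \<in> V \<Longrightarrow> inv_into V g (g x) = x"
  by (simp add: graph_aut_def bij_betw_def)

lemma aut_card:
  assumes g: "aut g" and PQ: "\<And>x. x \<in> V \<Longrightarrow> Q (g x) \<longleftrightarrow> P x"
  shows "card {x \<in> V. Q x} = card {x \<in> V. P x}"
proof -
  have "{x \<in> V. Q x} = g ` {x \<in> V. P x}"
  proof (intro subset_antisym subsetI)
    fix y assume "y \<in> {x \<in> V. Q x}"
    then show "y \<in> g ` {x \<in> V. P x}" using aut_surj[OF g, of y] PQ by auto
  qed (use PQ aut_in[OF g] in auto)
  moreover have "inj_on g {x \<in> V. P x}"
    using g by (auto simp: graph_aut_def bij_betw_def inj_on_def)
  ultimately show ?thesis by (simp add: card_image)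
qed

text \<open>Labels run through all integers and are read modulo p, so that label arithmetic is plain
  integer arithmetic. The last clause, that an automorphism of the whole graph induces the shift by
  one, is what makes the neighbourhood a circulant.\<close>

definition cyclic_labelling :: "nat \<Rightarrow> 'a \<Rightarrow> (int \<Rightarrow> 'a) \<Rightarrow> bool" where
  "cyclic_labelling p u \<phi> \<longleftrightarrow> (\<forall>i j. \<phi> i = \<phi> j \<longleftrightarrow> [i = j] (mod int p)) \<and> range \<phi> = {v. E u v} \<and>
     (\<exists>h. aut h \<and> h u = u \<and> (\<forall>i. h (\<phi> i) = \<phi> (i + 1)))"

text \<open>The stabiliser of \<open>u\<close> induces on the p neighbours a transitive group of
  prime degree. This group contains a p-cycle, and the iterates of a point under it are the
  labels.\<close>

lemma exists_cyclic_labelling: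
  assumes prime: "Factorial_Ring.prime p" and u: "u \<in> V" and val: "card {v. E u v} = p"
    and trans: "\<And>v w. E u v \<Longrightarrow> E u w \<Longrightarrow> \<exists>g. aut g \<and> g u = u \<and> g v = w"
  shows "\<exists>\<phi>. cyclic_labelling p u \<phi>"
proof -
  define N where "N = {v. E u v}"
  have NV: "N \<subseteq> V" using E_dom by (auto simp: N_def)
  have map_N: "bij_betw h N N" if h: "aut h" "h u = u" for h
  proof -
    have "h ` N = N"
    proof (intro subset_antisym subsetI)
      fix y assume y: "y \<in> N"
      then obtain x where x: "x \<in> V" "h x = y" using aut_surj[OF h(1)] NV by blast
      then have "x \<in> N" using aut_E[OF h(1) u x(1)] h(2) y by (simp add: N_def)
      then show "y \<in> h ` N" using x by blast
    next
      fix y assume "y \<in> h ` N"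
      then show "y \<in> N" using aut_E[OF h(1) u] h(2) NV by (auto simp: N_def)
    qed
    moreover have "inj_on h N"
      using h(1) NV by (auto simp: graph_aut_def bij_betw_def intro: inj_on_subset)
    ultimately show ?thesis by (simp add: bij_betw_def)
  qed
  \<comment> \<open>Each induced permutation comes with an automorphism of the whole graph as
    witness; for the p-cycle this witness is the shift demanded of a labelling.\<close>
  define K where "K = {f \<in> Bij N. \<exists>h. aut h \<and> h u = u \<and> (\<forall>x\<in>N. h x = f x)}"
  have "subgroup K (BijGroup N)"
  proof (rule subgroup.intro)
    show "K \<subseteq> carrier (BijGroup N)" by (auto simp: K_def BijGroup_def)
    show "\<one>\<^bsub>BijGroup N\<^esub> \<in> K"
      unfolding K_def using aut_id by (auto simp: BijGroup_def id_Bij intro!: exI[of _ id])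
  next
    fix f g assume "f \<in> K" "g \<in> K"
    then obtain h k where *: "f \<in> Bij N" "g \<in> Bij N" "aut h" "h u = u" "\<forall>x\<in>N. h x = f x"
      "aut k" "k u = u" "\<forall>x\<in>N. k x = g x" unfolding K_def by blast
    have "\<forall>x\<in>N. (h \<circ> k) x = compose N f g x"
      using * by (auto simp: compose_def Bij_def bij_betw_def)
    then show "f \<otimes>\<^bsub>BijGroup N\<^esub> g \<in> K"
      unfolding K_def using * aut_comp[of h k] by (auto simp: BijGroup_def compose_Bij intro!: exI[of _ "h \<circ> k"])
  next
    fix f assume "f \<in> K"
    then obtain h where *: "f \<in> Bij N" "aut h" "h u = u" "\<forall>x\<in>N. h x = f x" unfolding K_def by blast
    have "inv_into V h x = inv_into N f x" if x: "x \<in> N" for x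
    proof -
      have "f (inv_into N f x) = x" "inv_into N f x \<in> N"
        using *(1) x by (auto simp: Bij_def bij_betw_def f_inv_into_f inv_into_into)
      then show ?thesis using * aut_inv_left[OF *(2), of "inv_into N f x"] NV by auto
    qed
    then show "inv\<^bsub>BijGroup N\<^esub> f \<in> K"
      unfolding K_def using * aut_inv[OF *(2)] aut_inv_left[OF *(2) u]
      by (auto simp: inv_BijGroup restrict_inv_into_Bij intro!: exI[of _ "inv_into V h"])
  qed
  moreover have "\<exists>f\<in>K. f x = y" if xy: "x \<in> N" "y \<in> N" for x y
  proof -
    obtain g where g: "aut g" "g u = u" "g x = y" using trans xy by (auto simp: N_def)
    have "restrict g N \<in> Bij N" using map_N[OF g(1,2)] by (auto simp: Bij_def bij_betw_def)
    then have "restrict g N \<in> K" unfolding K_def using g by auto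
    then show ?thesis using g xy by (intro bexI[of _ "restrict g N"]) auto
  qed
  ultimately obtain f v where fv: "f \<in> K" "v \<in> N"
    and eq: "\<And>i j. (f ^^ i) v = (f ^^ j) v \<longleftrightarrow> [i = j] (mod p)"
    using transitive_of_prime_degree_has_cycle[OF prime val[folded N_def], of K] by blast
  obtain h where h: "aut h" "h u = u" "\<forall>x\<in>N. h x = f x" and fB: "f \<in> Bij N"
    using fv unfolding K_def by blast
  have p0: "p > 0" using prime by (rule prime_gt_0_nat)
  define \<phi> where "\<phi> i = (f ^^ nat (i mod int p)) v" for i
  have mem: "(f ^^ k) v \<in> N" for k
    using fv fB by (induction k) (auto simp: Bij_def bij_betw_def)
  have inj: "\<phi> i = \<phi> j \<longleftrightarrow> [i = j] (mod int p)" for i j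
  proof -
    have "\<phi> i = \<phi> j \<longleftrightarrow> [int (nat (i mod int p)) = int (nat (j mod int p))] (mod int p)"
      by (simp only: \<phi>_def eq cong_int_iff)
    then show ?thesis using p0 by (simp add: cong_def)
  qed
  have "range \<phi> = N"
  proof (rule card_subset_eq)
    show "finite N" using finite_subset[OF NV finite_V] .
    show "range \<phi> \<subseteq> N" using mem by (auto simp: \<phi>_def)
    then have "finite (range \<phi>)" using \<open>finite N\<close> finite_subset by blast
    moreover have "inj_on \<phi> {0..<int p}" by (auto intro!: inj_onI simp: inj cong_def)
    ultimately have "p \<le> card (range \<phi>)"
      using card_mono[of "range \<phi>" "\<phi> ` {0..<int p}"] by (simp add: card_image image_mono)
    moreover have "card (range \<phi>) \<le> card N" using card_mono[OF \<open>finite N\<close> \<open>range \<phi> \<subseteq> N\<close>] .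
    ultimately show "card (range \<phi>) = card N" using val by (simp add: N_def)
  qed
  moreover have "h (\<phi> i) = \<phi> (i + 1)" for i
  proof -
    have "h (\<phi> i) = (f ^^ Suc (nat (i mod int p))) v" using h(3) mem by (simp add: \<phi>_def)
    also have "\<dots> = (f ^^ nat ((i + 1) mod int p)) v"
    proof -
      have "[int (Suc (nat (i mod int p))) = int (nat ((i + 1) mod int p))] (mod int p)"
        using p0 by (simp add: cong_def mod_add_left_eq add.commute[of 1])
      then show ?thesis unfolding eq by (simp only: cong_int_iff)
    qed
    finally show ?thesis by (simp add: \<phi>_def)
  qed
  ultimately show ?thesis unfolding cyclic_labelling_def using inj h by (auto simp: N_def)
qed

end

section \<open>Neighbourhoods are Paley graphs\<close>

text \<open>\<open>has_triangle\<close> is what the failure of 2-arc transitivity leaves behind: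
  without triangles each 2-arc would be a 2-geodesic. \<open>has_geodesic\<close> expresses that the
  diameter is at least 2.\<close>

locale prime_geodesic_graph = simple_graph +
  fixes p :: nat
  assumes prime: "Factorial_Ring.prime p"
    and valency: "u \<in> V \<Longrightarrow> card {v. E u v} = p"
    and arc_transitive: "E u v \<Longrightarrow> E u' v' \<Longrightarrow> \<exists>g. aut g \<and> g u = u' \<and> g v = v'"
    and geodesic_transitive: "E u v \<Longrightarrow> E v w \<Longrightarrow> u \<noteq> w \<Longrightarrow> \<not> E u w \<Longrightarrow>
      E u' v' \<Longrightarrow> E v' w' \<Longrightarrow> u' \<noteq> w' \<Longrightarrow> \<not> E u' w' \<Longrightarrow>
      \<exists>g. aut g \<and> g u = u' \<and> g v = v' \<and> g w = w'"
    and has_triangle: "\<exists>u v w. E u v \<and> E v w \<and> E u w"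
    and has_geodesic: "\<exists>u v w. E u v \<and> E v w \<and> u \<noteq> w \<and> \<not> E u w"
begin

definition common :: "'a \<Rightarrow> 'a \<Rightarrow> nat" where
  "common u w = card {x \<in> V. E u x \<and> E w x}"

lemma common_aut: "aut g \<Longrightarrow> u \<in> V \<Longrightarrow> w \<in> V \<Longrightarrow> common (g u) (g w) = common u w"
  unfolding common_def by (rule aut_card[of g]) (simp_all add: aut_E[of g])

lemma common_geodesic:
  assumes "E u v" "E v w" "u \<noteq> w" "\<not> E u w" "E u' v'" "E v' w'" "u' \<noteq> w'" "\<not> E u' w'"
  shows "common u w = common u' w'"
proof -
  obtain g where "aut g" "g u = u'" "g w = w'"
    using geodesic_transitive[OF assms] by blast
  then show ?thesis using common_aut[of g u w] E_dom[OF assms(1)] E_dom[OF assms(2)] by simp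
qed

lemma p_pos: "0 < int p" "1 < int p" "1 < p" "0 < p"
  using prime_gt_1_nat[OF prime] by auto

lemma prime_int: "Factorial_Ring.prime (int p)"
  using prime by simp

end

locale labelled_geodesic_graph = prime_geodesic_graph +
  fixes r :: 'a and \<phi> :: "int \<Rightarrow> 'a"
  assumes root: "r \<in> V" and labelling: "cyclic_labelling p r \<phi>"
begin

lemma label_eq: "\<phi> i = \<phi> j \<longleftrightarrow> [i = j] (mod int p)"
  using labelling by (simp add: cyclic_labelling_def)

lemma neighbour_iff: "E r x \<longleftrightarrow> x \<in> range \<phi>"
  using labelling by (simp add: cyclic_labelling_def)

lemma E_root: "E r (\<phi> i)" "E (\<phi> i) r"
  using neighbour_iff E_sym by auto

lemma label_in: "\<phi> i \<in> V"
  using E_root E_dom by blast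

lemma card_neighbours: "card {x \<in> V. E r x \<and> P x} = card {i \<in> {0..<int p}. P (\<phi> i)}"
proof -
  have "{x \<in> V. E r x \<and> P x} = \<phi> ` {i \<in> {0..<int p}. P (\<phi> i)}"
  proof (intro subset_antisym subsetI)
    fix x assume "x \<in> {x \<in> V. E r x \<and> P x}"
    then obtain i where "x = \<phi> i" "P x" using neighbour_iff by auto
    moreover have "\<phi> i = \<phi> (i mod int p)" by (simp add: label_eq cong_def)
    ultimately show "x \<in> \<phi> ` {i \<in> {0..<int p}. P (\<phi> i)}" using p_pos by auto
  qed (use E_root label_in in auto)
  moreover have "inj_on \<phi> {i \<in> {0..<int p}. P (\<phi> i)}"
    by (auto intro!: inj_onI simp: label_eq cong_def)
  ultimately show ?thesis by (simp add: card_image)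
qed

lemma translation: "\<exists>h. aut h \<and> h r = r \<and> (\<forall>i. h (\<phi> i) = \<phi> (i + k))"
proof -
  obtain h where h: "aut h" "h r = r" "\<And>i. h (\<phi> i) = \<phi> (i + 1)"
    using labelling unfolding cyclic_labelling_def by auto
  have "\<exists>h. aut h \<and> h r = r \<and> (\<forall>i. h (\<phi> i) = \<phi> (i + int n))" for n
  proof (induction n)
    case 0
    then show ?case using aut_id[unfolded id_def] by (intro exI[of _ "\<lambda>x. x"]) simp
  next
    case (Suc n)
    then obtain h' where "aut h'" "h' r = r" "\<forall>i. h' (\<phi> i) = \<phi> (i + int n)" by blast
    then show ?case using h aut_comp[of h' h, unfolded comp_def] by (intro exI[of _ "\<lambda>x. h' (h x)"]) (simp add: algebra_simps)
  qed
  from this[of "nat (k mod int p)"] obtain h where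
    "aut h" "h r = r" "\<forall>i. h (\<phi> i) = \<phi> (i + k mod int p)" using p_pos by auto
  moreover have "\<phi> (i + k mod int p) = \<phi> (i + k)" for i by (simp add: label_eq cong_def mod_add_right_eq)
  ultimately show ?thesis by auto
qed

text \<open>By translation the graph induced on the neighbourhood is a circulant; \<open>adj\<close>
  is its connection set, extended periodically to the integers.\<close>

definition adj :: "int \<Rightarrow> bool" where "adj d \<longleftrightarrow> E (\<phi> 0) (\<phi> d)"

lemma E_label: "E (\<phi> i) (\<phi> j) \<longleftrightarrow> adj (j - i)"
proof -
  obtain h where h: "aut h" "\<And>x. h (\<phi> x) = \<phi> (x + - i)" using translation[of "- i"] by blast
  have "E (\<phi> i) (\<phi> j) \<longleftrightarrow> E (h (\<phi> i)) (h (\<phi> j))" using aut_E[OF h(1)] label_in by blast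
  also have "\<dots> \<longleftrightarrow> adj (j - i)" by (simp add: h(2) adj_def)
  finally show ?thesis .
qed

lemma adj_cong: "[x = y] (mod int p) \<Longrightarrow> adj x \<longleftrightarrow> adj y"
  using label_eq[of x y] by (simp add: adj_def)

lemma adj_0: "int p dvd x \<Longrightarrow> \<not> adj x"
  using adj_cong[of x 0] E_irrefl by (simp add: adj_def cong_0_iff)

lemma adj_minus: "adj (- x) \<longleftrightarrow> adj x"
  using E_label[of x 0] E_label[of 0 x] E_commute[of "\<phi> x" "\<phi> 0"] by simp

lemma adj_mod: "adj (x mod int p) \<longleftrightarrow> adj x"
  by (rule adj_cong) simp

text \<open>Arc transitivity moves a triangle to one through the root and \<open>\<phi> 0\<close>.
  With its counterpart for a 2-geodesic this makes the connection set nonempty and proper, as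
  Burnside's theorem demands.\<close>

lemma exists_adj: "\<exists>d. adj d"
proof -
  obtain u v w where uvw: "E u v" "E v w" "E u w" using has_triangle by blast
  obtain g where g: "aut g" "g v = r" "g u = \<phi> 0"
    using arc_transitive[OF E_sym[OF uvw(1)] E_root(1)] by blast
  have "E r (g w)" "E (\<phi> 0) (g w)"
    using aut_E[OF g(1), of v w] aut_E[OF g(1), of u w] uvw g E_dom[OF uvw(2)] E_dom[OF uvw(3)] by auto
  then show ?thesis using neighbour_iff unfolding adj_def by auto
qed

lemma exists_nonadj: "\<exists>d. \<not> int p dvd d \<and> \<not> adj d"
proof -
  obtain u v w where uvw: "E u v" "E v w" "u \<noteq> w" "\<not> E u w" using has_geodesic by blast
  obtain g where g: "aut g" "g v = r" "g u = \<phi> 0"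
    using arc_transitive[OF E_sym[OF uvw(1)] E_root(1)] by blast
  have "E r (g w)" "\<not> E (\<phi> 0) (g w)" "\<phi> 0 \<noteq> g w"
    using aut_E[OF g(1), of v w] aut_E[OF g(1), of u w] aut_eq[OF g(1), of u w] uvw g
      E_dom[OF uvw(1)] E_dom[OF uvw(2)] by auto
  then obtain d where "g w = \<phi> d" "\<not> adj d" "\<phi> 0 \<noteq> \<phi> d" using neighbour_iff unfolding adj_def by auto
  then show ?thesis using label_eq[of d 0] by (auto simp: cong_0_iff)
qed

lemma not_dvd_mod_iff: "\<not> int p dvd x \<longleftrightarrow> x mod int p \<in> {1..<int p}"
proof -
  define y where "y = x mod int p"
  have "0 \<le> y" "y < int p" using p_pos by (auto simp: y_def)
  then show ?thesis unfolding dvd_eq_mod_eq_0 y_def[symmetric] by auto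
qed

text \<open>For p = 2 there is a single nonzero residue, which cannot be both adjacent and
  nonadjacent to 0.\<close>

lemma p_gt_2: "2 < p"
proof (rule ccontr)
  assume "\<not> 2 < p"
  then have "p = 2" using p_pos by simp
  obtain d e where "adj d" "\<not> adj e" "\<not> int p dvd e" using exists_adj exists_nonadj by blast
  moreover then have "\<not> int p dvd d" using adj_0 by blast
  ultimately have "[d = e] (mod int p)" using \<open>p = 2\<close> by (auto simp: cong_def odd_iff_mod_2_eq_one)
  then show False using adj_cong \<open>adj d\<close> \<open>\<not> adj e\<close> by blast
qed

text \<open>An automorphism fixing the root permutes the labels and preserves the circulant, so
  Burnside's theorem applies to the permutation of labels.\<close>

lemma root_stabilizer_affine:
  assumes g: "aut g" "g r = r"
  obtains a b where "\<not> int p dvd a" "\<And>x. g (\<phi> x) = \<phi> (a * x + b)"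
proof -
  have "\<forall>x. \<exists>y. g (\<phi> x) = \<phi> y"
    using aut_E[OF g(1), of r] g(2) label_in E_root root neighbour_iff by (metis rangeE)
  then obtain \<pi> where \<pi>: "\<And>x. g (\<phi> x) = \<phi> (\<pi> x)" by metis
  define U where "U = {d \<in> {1..<int p}. adj d}"
  have U_iff: "d mod int p \<in> U \<longleftrightarrow> adj d" for d
    using adj_0[of d] not_dvd_mod_iff[of d] by (auto simp: U_def adj_mod)
  have "\<exists>a b. \<forall>x. [\<pi> x = a * x + b] (mod int p)"
  proof (rule connection_set_preserving_imp_affine[OF prime])
    show "U \<subseteq> {1..<int p}" by (auto simp: U_def)
    show "U \<noteq> {}" using exists_adj U_iff by blast
    show "U \<noteq> {1..<int p}" using exists_nonadj U_iff not_dvd_mod_iff by blast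
    show "int p - u \<in> U" if "u \<in> U" for u
    proof -
      have "adj (int p - u) \<longleftrightarrow> adj u"
        using adj_cong[of "int p - u" "- u"] adj_minus[of u] by (simp add: cong_iff_dvd_diff)
      then show ?thesis using that by (auto simp: U_def)
    qed
    show "[\<pi> x = \<pi> y] (mod int p) \<longleftrightarrow> [x = y] (mod int p)" for x y
      using aut_eq[OF g(1) label_in label_in, of x y] by (simp add: \<pi> label_eq)
    show "(\<pi> y - \<pi> x) mod int p \<in> U \<longleftrightarrow> (y - x) mod int p \<in> U" for x y
      using aut_E[OF g(1) label_in label_in, of x y] by (simp add: U_iff \<pi> E_label)
  qed
  then obtain a b where "\<forall>x. [\<pi> x = a * x + b] (mod int p)" by blast
  then have ab: "g (\<phi> x) = \<phi> (a * x + b)" for x using \<pi> label_eq by simp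
  have "\<not> int p dvd a"
  proof
    assume "int p dvd a"
    then have "g (\<phi> 1) = g (\<phi> 0)" by (simp add: ab label_eq cong_iff_dvd_diff)
    then have "[1 = 0] (mod int p)" using aut_eq[OF g(1) label_in label_in] label_eq by blast
    then show False using p_pos by (simp add: cong_def)
  qed
  then show ?thesis using that ab by blast
qed

text \<open>The stabiliser of the label 0 in the affine group induced on the labels, written as a
  subgroup of the units modulo p.\<close>

definition Mult :: "int \<Rightarrow> bool" where
  "Mult a \<longleftrightarrow> \<not> int p dvd a \<and> (\<exists>g. aut g \<and> g r = r \<and> (\<forall>x. g (\<phi> x) = \<phi> (a * x)))"

lemma Mult_not_dvd: "Mult a \<Longrightarrow> \<not> int p dvd a"
  by (simp add: Mult_def)

lemma Mult_adj:
  assumes "Mult a"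
  shows "adj (a * d) \<longleftrightarrow> adj d"
proof -
  obtain g where g: "aut g" "\<And>x. g (\<phi> x) = \<phi> (a * x)" using assms unfolding Mult_def by blast
  then show ?thesis using aut_E[OF g(1) label_in label_in, of 0 d] by (simp add: adj_def)
qed

lemma Mult_cong:
  assumes "[a = b] (mod int p)" "Mult a"
  shows "Mult b"
proof -
  have "\<phi> (a * x) = \<phi> (b * x)" for x using assms(1) by (simp add: label_eq cong_mult)
  then show ?thesis using assms cong_dvd_iff[OF assms(1)] unfolding Mult_def cong_def
    by (metis dvd_eq_mod_eq_0)
qed

lemma Mult_mult:
  assumes "Mult a" "Mult b"
  shows "Mult (a * b)"
proof -
  obtain g h where "aut g" "g r = r" "\<And>x. g (\<phi> x) = \<phi> (a * x)" "aut h" "h r = r" "\<And>x. h (\<phi> x) = \<phi> (b * x)"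
    using assms unfolding Mult_def by blast
  then have "aut (\<lambda>x. g (h x)) \<and> g (h r) = r \<and> (\<forall>x. g (h (\<phi> x)) = \<phi> (a * b * x))"
    using aut_comp[of g h, unfolded comp_def] by (simp add: mult.assoc)
  then show ?thesis using assms prime_int unfolding Mult_def by (auto simp: prime_dvd_mult_iff)
qed

lemma exists_inverse: "\<not> int p dvd a \<Longrightarrow> \<exists>b. [a * b = 1] (mod int p)"
  by (rule exists_inverse_mod_prime[OF prime])

lemma Mult_inverse:
  assumes "Mult a" "[a * b = 1] (mod int p)"
  shows "Mult b"
proof -
  obtain g where g: "aut g" "g r = r" "\<And>x. g (\<phi> x) = \<phi> (a * x)" using assms unfolding Mult_def by blast
  have "inv_into V g (\<phi> x) = \<phi> (b * x)" for x
  proof -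
    have "g (\<phi> (b * x)) = \<phi> x"
      using cong_mult[OF assms(2) cong_refl[of x]] by (simp add: g(3) label_eq mult.assoc)
    then show ?thesis using aut_inv_left[OF g(1) label_in, of "b * x"] by simp
  qed
  moreover have "inv_into V g r = r" using aut_inv_left[OF g(1) root] g(2) by simp
  moreover have "\<not> int p dvd b"
  proof
    assume "int p dvd b"
    then have "int p dvd a * b" by simp
    then have "int p dvd 1" using assms(2) cong_dvd_iff by blast
    then show False using p_pos by simp
  qed
  ultimately show ?thesis unfolding Mult_def using aut_inv[OF g(1)] by blast
qed

text \<open>The paths from \<open>\<phi> 0\<close> through the root to \<open>\<phi> c\<close> and
  to \<open>\<phi> c'\<close> are 2-geodesics. An automorphism taking one to the other fixes the
  root and the label 0, hence is affine without constant term.\<close>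

lemma Mult_transitive_nonadj:
  assumes "\<not> int p dvd c" "\<not> adj c" "\<not> int p dvd c'" "\<not> adj c'"
  shows "\<exists>a. Mult a \<and> [a * c = c'] (mod int p)"
proof -
  have "\<phi> 0 \<noteq> \<phi> x" if "\<not> int p dvd x" for x
    using that label_eq[of x 0] by (auto simp: cong_0_iff)
  then obtain g where g: "aut g" "g (\<phi> 0) = \<phi> 0" "g r = r" "g (\<phi> c) = \<phi> c'"
    using geodesic_transitive[OF E_root(2) E_root(1) _ _ E_root(2) E_root(1), of 0 c 0 c'] assms
    unfolding adj_def by auto
  obtain a b where ab: "\<not> int p dvd a" "\<And>x. g (\<phi> x) = \<phi> (a * x + b)"
    using root_stabilizer_affine[OF g(1,3)] by blast
  have "[b = 0] (mod int p)" using g(2) ab(2)[of 0] label_eq by auto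
  then have "g (\<phi> x) = \<phi> (a * x)" for x
    by (simp add: ab(2) label_eq cong_iff_dvd_diff)
  then show ?thesis using g ab(1) unfolding Mult_def by (metis label_eq)
qed

lemma card_mult_image:
  assumes "\<not> int p dvd n" "S \<subseteq> {0..<int p}"
  shows "card ((\<lambda>a. a * n mod int p) ` S) = card S"
proof (rule card_image, rule inj_onI)
  fix x y assume "x \<in> S" "y \<in> S" "x * n mod int p = y * n mod int p"
  then have "[x * n = y * n] (mod int p)" by (simp add: cong_def)
  then have "[x = y] (mod int p)"
    using assms(1) prime_int by (simp add: cong_iff_dvd_diff left_diff_distrib[symmetric] prime_dvd_mult_iff)
  then show "x = y" using assms(2) \<open>x \<in> S\<close> \<open>y \<in> S\<close> by (auto simp: cong_def subset_iff)
qed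

abbreviation "mults \<equiv> {a \<in> {1..<int p}. Mult a}"
abbreviation "nonadjs \<equiv> {a \<in> {1..<int p}. \<not> adj a}"
abbreviation "adjs \<equiv> {a \<in> {1..<int p}. adj a}"

lemma card_adjs_nonadjs: "card adjs + card nonadjs = p - 1"
proof -
  have "card (adjs \<union> nonadjs) = card adjs + card nonadjs" by (intro card_Un_disjoint finite_Collect_conjI) auto
  moreover have "adjs \<union> nonadjs = {1..<int p}" by auto
  ultimately show ?thesis by (simp add: nat_diff_distrib)
qed

text \<open>Multiplication by units is free, so the single orbit formed by the nonadjacent residues
  has as many elements as there are multipliers.\<close>

lemma card_mults: "card mults = card nonadjs"
proof -
  obtain c where c: "\<not> int p dvd c" "\<not> adj c" using exists_nonadj by blast
  have "(\<lambda>a. a * c mod int p) ` mults = nonadjs"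
  proof (intro subset_antisym subsetI)
    fix y assume "y \<in> (\<lambda>a. a * c mod int p) ` mults"
    then obtain a where a: "Mult a" "y = a * c mod int p" by auto
    then have "\<not> int p dvd a * c" using c(1) prime_int Mult_not_dvd by (simp add: prime_dvd_mult_iff)
    then show "y \<in> nonadjs" using a c Mult_adj[OF a(1), of c] not_dvd_mod_iff[of "a * c"] by (simp add: adj_mod)
  next
    fix y assume y: "y \<in> nonadjs"
    then have "\<not> int p dvd y" using not_dvd_mod_iff[of y] by simp
    then obtain a where a: "Mult a" "[a * c = y] (mod int p)"
      using Mult_transitive_nonadj[OF c] y by auto
    have "a mod int p \<in> mults"
      using a(1) Mult_cong[of a "a mod int p"] Mult_not_dvd not_dvd_mod_iff[of a] by simp
    moreover have "(a mod int p) * c mod int p = y"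
      using a(2) y by (simp add: cong_def mod_mult_left_eq)
    ultimately show "y \<in> (\<lambda>a. a * c mod int p) ` mults" by (metis (no_types, lifting) image_eqI)
  qed
  then show ?thesis using card_mult_image[OF c(1), of mults] by force
qed

text \<open>Multipliers fix the label 0 and preserve adjacency, so the connection set is a union of
  their cosets.\<close>

lemma mult_coset_subset_adjs:
  assumes "adj n"
  shows "(\<lambda>a. a * n mod int p) ` mults \<subseteq> adjs"
proof
  fix y assume "y \<in> (\<lambda>a. a * n mod int p) ` mults"
  then obtain a where a: "Mult a" "y = a * n mod int p" by auto
  have "adj (a * n)" using Mult_adj[OF a(1)] assms by simp
  then show "y \<in> adjs" using a(2) not_dvd_mod_iff[of "a * n"] adj_0 by (auto simp: adj_mod)
qed

lemma card_mult_coset: "adj n \<Longrightarrow> card ((\<lambda>a. a * n mod int p) ` mults) = card mults"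
  by (rule card_mult_image) (use adj_0 in auto)

end

lemma finite_int_interval_filter [simp]: "finite {x :: int. a \<le> x \<and> x < b \<and> P x}"
  by (rule finite_subset[of _ "{a..<b}"]) auto

section \<open>Counting around a neighbourhood and its second sphere\<close>

context labelled_geodesic_graph
begin

lemma card_residues_shift:
  assumes "\<And>x y. [x = y] (mod int p) \<Longrightarrow> Q x \<longleftrightarrow> Q y"
  shows "card {y \<in> {0..<int p}. Q (y - i)} = card {y \<in> {0..<int p}. Q y}"
proof (rule bij_betw_same_card[where f = "\<lambda>y. (y - i) mod int p"],
    rule bij_betw_byWitness[where f' = "\<lambda>y. (y + i) mod int p"])
  show "(\<lambda>y. (y - i) mod int p) ` {y \<in> {0..<int p}. Q (y - i)} \<subseteq> {y \<in> {0..<int p}. Q y}"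
    using p_pos assms[of "(y - i) mod int p" "y - i" for y] by (auto simp: cong_def)
  show "(\<lambda>y. (y + i) mod int p) ` {y \<in> {0..<int p}. Q y} \<subseteq> {y \<in> {0..<int p}. Q (y - i)}"
    using p_pos assms[of "(y + i) mod int p - i" "y" for y] by (auto simp: cong_def mod_diff_left_eq)
qed (auto simp: mod_simps)

text \<open>The summand 1 is the residue of \<open>i\<close> itself, no vertex being adjacent to
  itself.\<close>

lemma card_nonadj_shift: "card {y \<in> {0..<int p}. \<not> adj (y - i)} = card nonadjs + 1"
proof -
  have "card {y \<in> {0..<int p}. \<not> adj (y - i)} = card {y \<in> {0..<int p}. \<not> adj y}"
    by (rule card_residues_shift[where Q = "\<lambda>y. \<not> adj y"]) (simp add: adj_cong)
  also have "{y \<in> {0..<int p}. \<not> adj y} = insert 0 nonadjs"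
    using adj_0[of 0] p_pos by auto
  finally show ?thesis by (simp add: card_insert_if)
qed

text \<open>Inclusion and exclusion on the two complements. Each has \<open>card nonadjs + 1\<close>
  elements, and since i and j are nonadjacent both complements contain the two residues of i and j,
  so the union is smaller by at least two.\<close>

lemma adj_pair_lower_bound:
  assumes "\<not> int p dvd j - i" "\<not> adj (j - i)"
  shows "p \<le> card {y \<in> {0..<int p}. adj (y - i) \<and> adj (y - j)} + 2 * card nonadjs"
proof -
  define S where "S = {y \<in> {0..<int p}. adj (y - i) \<and> adj (y - j)}"
  define A where "A k = {y \<in> {0..<int p}. \<not> adj (y - k)}" for k
  have fin: "finite (A k)" for k by (simp add: A_def)
  have cA: "card (A k) = card nonadjs + 1" for k
    unfolding A_def by (rule card_nonadj_shift)
  have "p = card {0..<int p}" by simp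
  also have "{0..<int p} = S \<union> (A i \<union> A j)" by (auto simp: S_def A_def)
  also have "card \<dots> \<le> card S + card (A i \<union> A j)" by (rule card_Un_le)
  finally have 1: "p \<le> card S + card (A i \<union> A j)" .
  have 2: "card (A i \<union> A j) + card (A i \<inter> A j) = 2 * (card nonadjs + 1)"
    using card_Un_Int[OF fin fin, of i j] by (simp only: cA mult_2)
  have "{i mod int p, j mod int p} \<subseteq> A i \<inter> A j"
  proof -
    have *: "adj (x mod int p - y) \<longleftrightarrow> adj (x - y)" for x y
      by (rule adj_cong) (simp add: cong_def mod_diff_left_eq)
    have "\<not> adj (i - j)" using assms(2) adj_minus[of "j - i"] by simp
    then show ?thesis using assms(2) adj_0[of 0] p_pos by (auto simp: A_def *)
  qed
  then have "card {i mod int p, j mod int p} \<le> card (A i \<inter> A j)"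
    using fin by (intro card_mono) auto
  moreover have "i mod int p \<noteq> j mod int p" using assms(1) mod_eq_dvd_iff[of j "int p" i] by auto
  ultimately show ?thesis using 1 2 unfolding S_def by simp
qed

text \<open>The extra 1 is the root.\<close>

lemma common_label: "common (\<phi> i) (\<phi> j) \<ge> 1 + card {y \<in> {0..<int p}. adj (y - i) \<and> adj (y - j)}"
proof -
  have "card {x \<in> V. E r x \<and> E (\<phi> i) x \<and> E (\<phi> j) x} = card {y \<in> {0..<int p}. adj (y - i) \<and> adj (y - j)}"
    using card_neighbours[of "\<lambda>x. E (\<phi> i) x \<and> E (\<phi> j) x"] by (simp add: E_label)
  moreover have "card (insert r {x \<in> V. E r x \<and> E (\<phi> i) x \<and> E (\<phi> j) x}) =
      1 + card {x \<in> V. E r x \<and> E (\<phi> i) x \<and> E (\<phi> j) x}"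
    using finite_V E_irrefl by (subst card_insert_disjoint) auto
  moreover have "card (insert r {x \<in> V. E r x \<and> E (\<phi> i) x \<and> E (\<phi> j) x}) \<le> common (\<phi> i) (\<phi> j)"
    unfolding common_def using root E_root finite_V by (intro card_mono) auto
  ultimately show ?thesis by simp
qed

text \<open>If two neighbours of the root had the same neighbourhood, the connection set would be
  closed under subtracting j - i. Repeated subtraction reaches every residue, so 0 would belong to
  it.\<close>

lemma common_label_less:
  assumes "\<not> int p dvd j - i"
  shows "common (\<phi> i) (\<phi> j) < p"
proof (rule ccontr)
  assume all: "\<not> ?thesis"
  have "{x \<in> V. E (\<phi> i) x \<and> E (\<phi> j) x} = {x. E (\<phi> i) x}"
  proof (rule card_seteq)
    show "finite {x. E (\<phi> i) x}" using finite_V E_dom by (auto intro: finite_subset[of _ V])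
    show "card {x. E (\<phi> i) x} \<le> card {x \<in> V. E (\<phi> i) x \<and> E (\<phi> j) x}"
      using all valency[OF label_in] by (simp add: common_def)
  qed auto
  then have step: "adj (y - (j - i))" if "adj y" for y
    using that E_label[of i "y + i"] E_label[of j "y + i"] by (auto simp: algebra_simps)
  have iter: "adj (y - int n * (j - i))" if "adj y" for y n
    using that
  proof (induction n)
    case (Suc n)
    then have "adj (y - int n * (j - i) - (j - i))" by (intro step) simp
    then show ?case by (simp add: algebra_simps)
  qed simp
  obtain d where d: "adj d" using exists_adj by blast
  obtain b where b: "[(j - i) * b = 1] (mod int p)" using exists_inverse[OF assms] by blast
  define n where "n = nat ((b * d) mod int p)"
  have "[int n * (j - i) = b * d * (j - i)] (mod int p)"
    using p_pos by (intro cong_mult cong_refl) (simp add: n_def)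
  also have "b * d * (j - i) = (j - i) * b * d" by (simp add: ac_simps)
  also have "[(j - i) * b * d = 1 * d] (mod int p)" by (intro cong_mult cong_refl b)
  finally have "int p dvd d - int n * (j - i)"
    by (simp add: cong_iff_dvd_diff dvd_diff_commute)
  then show False using iter[OF d, of n] adj_0 by blast
qed

definition sphere2 :: "'a set" where
  "sphere2 = {w \<in> V. w \<noteq> r \<and> \<not> E r w \<and> (\<exists>v. E r v \<and> E v w)}"

lemma sphere2E:
  assumes "w \<in> sphere2"
  obtains i where "w \<in> V" "w \<noteq> r" "\<not> E r w" "E (\<phi> i) w"
  using assms neighbour_iff unfolding sphere2_def by auto

lemma sphere2I: "w \<noteq> r \<Longrightarrow> \<not> E r w \<Longrightarrow> E (\<phi> i) w \<Longrightarrow> w \<in> sphere2"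
  using E_root E_dom unfolding sphere2_def by blast

lemma finite_sphere2: "finite sphere2"
  using finite_V by (simp add: sphere2_def)

lemma common_sphere2:
  assumes "w \<in> sphere2" "\<not> int p dvd d" "\<not> adj d"
  shows "common r w = common (\<phi> 0) (\<phi> d)"
proof -
  obtain i where i: "w \<noteq> r" "\<not> E r w" "E (\<phi> i) w" using assms(1) by (rule sphere2E)
  have "\<phi> 0 \<noteq> \<phi> d" using assms(2) label_eq[of d 0] by (auto simp: cong_0_iff)
  then show ?thesis
    using common_geodesic[OF E_root(1) i(3) _ i(2) E_root(2) E_root(1)] i(1) assms(3) unfolding adj_def by auto
qed

text \<open>An automorphism taking the root to \<open>\<phi> i\<close> and \<open>\<phi> 0\<close>
  to the root maps the neighbours of the root that are neither equal nor adjacent to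
  \<open>\<phi> 0\<close> onto the neighbours of \<open>\<phi> i\<close> in the second
  sphere.\<close>

lemma card_sphere2_neighbours: "card {w \<in> sphere2. E (\<phi> i) w} = card nonadjs"
proof -
  obtain g where g: "aut g" "g r = \<phi> i" "g (\<phi> 0) = r"
    using arc_transitive[OF E_root(1) E_root(2)] by blast
  have "{w \<in> sphere2. E (\<phi> i) w} = {w \<in> V. E (\<phi> i) w \<and> w \<noteq> r \<and> \<not> E r w}"
    using E_root by (auto simp: sphere2_def)
  also have "card \<dots> = card {x \<in> V. E r x \<and> x \<noteq> \<phi> 0 \<and> \<not> E (\<phi> 0) x}"
  proof (rule aut_card[OF g(1)])
    fix x assume x: "x \<in> V"
    show "(E (\<phi> i) (g x) \<and> g x \<noteq> r \<and> \<not> E r (g x)) \<longleftrightarrow> (E r x \<and> x \<noteq> \<phi> 0 \<and> \<not> E (\<phi> 0) x)"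
      using aut_E[OF g(1) root x] aut_E[OF g(1) label_in x, of 0] aut_eq[OF g(1) x label_in, of 0] g(2,3) by simp
  qed
  also have "\<dots> = card {y \<in> {0..<int p}. \<phi> y \<noteq> \<phi> 0 \<and> \<not> adj y}"
    using card_neighbours[of "\<lambda>x. x \<noteq> \<phi> 0 \<and> \<not> E (\<phi> 0) x"] by (simp add: adj_def)
  also have "{y \<in> {0..<int p}. \<phi> y \<noteq> \<phi> 0 \<and> \<not> adj y} = nonadjs"
    using p_pos not_dvd_mod_iff by (auto simp: label_eq cong_0_iff[symmetric] cong_def)
  finally show ?thesis .
qed

lemma edges_to_sphere2:
  assumes "\<not> int p dvd d" "\<not> adj d"
  shows "p * card nonadjs = card sphere2 * common (\<phi> 0) (\<phi> d)"
proof -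
  have "(\<Sum>i\<in>{0..<int p}. card {w \<in> sphere2. E (\<phi> i) w}) = common (\<phi> 0) (\<phi> d) * card sphere2"
  proof (rule sum_multicount)
    show "\<forall>w\<in>sphere2. card {i \<in> {0..<int p}. E (\<phi> i) w} = common (\<phi> 0) (\<phi> d)"
    proof
      fix w assume "w \<in> sphere2"
      have "card {i \<in> {0..<int p}. E (\<phi> i) w} = common r w"
        using card_neighbours[of "\<lambda>x. E x w"] by (simp add: common_def E_commute[of w])
      then show "card {i \<in> {0..<int p}. E (\<phi> i) w} = common (\<phi> 0) (\<phi> d)"
        using common_sphere2[OF \<open>w \<in> sphere2\<close> assms] by simp
    qed
  qed (simp_all add: finite_sphere2)
  then show ?thesis by (simp add: card_sphere2_neighbours mult.commute)
qed

lemma nonadjs_pos: "0 < card nonadjs"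
proof -
  obtain c where "\<not> int p dvd c" "\<not> adj c" using exists_nonadj by blast
  then have "c mod int p \<in> nonadjs" using not_dvd_mod_iff[of c] by (simp add: adj_mod)
  then show ?thesis by (intro card_gt_0_iff[THEN iffD2]) auto
qed

text \<open>The edge count equates p times \<open>card nonadjs\<close> with a multiple of the number
  of common neighbours. That number is positive and below p, hence prime to p. Here the primality of
  the valency turns counting into divisibility.\<close>

lemma common_dvd_nonadjs:
  assumes "\<not> int p dvd d" "\<not> adj d"
  shows "common (\<phi> 0) (\<phi> d) dvd card nonadjs"
proof -
  have "0 < common (\<phi> 0) (\<phi> d)" using common_label[of 0 d] by simp
  moreover have "common (\<phi> 0) (\<phi> d) < p" using common_label_less[of d 0] assms by simp
  ultimately have "\<not> p dvd common (\<phi> 0) (\<phi> d)" by (auto dest: dvd_imp_le)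
  then have "coprime (common (\<phi> 0) (\<phi> d)) p"
    using prime by (simp add: coprime_commute prime_imp_coprime)
  moreover have "common (\<phi> 0) (\<phi> d) dvd p * card nonadjs"
    using edges_to_sphere2[OF assms] by simp
  ultimately show ?thesis by (simp add: coprime_dvd_mult_right_iff)
qed

text \<open>With c the number of common neighbours and m = \<open>card nonadjs\<close>, divisibility
  gives c \<le> m, while c \<ge> p - 2 m + 1. So 3 m \<ge> p + 1, and the connection set has p - 1 -
  m < 2 m elements. Being a union of cosets of the m multipliers, it is a single coset.\<close>

lemma adjs_eq_coset:
  assumes n: "adj n"
  shows "(\<lambda>a. a * n mod int p) ` mults = adjs" and "2 * card nonadjs = p - 1"
proof -
  let ?f = "\<lambda>n a. a * n mod int p"
  obtain d where d: "\<not> int p dvd d" "\<not> adj d" using exists_nonadj by blast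
  have "common (\<phi> 0) (\<phi> d) \<le> card nonadjs"
    using common_dvd_nonadjs[OF d] nonadjs_pos by (rule dvd_imp_le)
  then have few: "p + 1 \<le> 3 * card nonadjs"
    using common_label[of 0 d] adj_pair_lower_bound[of d 0] d by simp
  show eq: "?f n ` mults = adjs"
  proof (rule ccontr)
    assume "?f n ` mults \<noteq> adjs"
    then obtain n' where n': "n' \<in> adjs" "n' \<notin> ?f n ` mults"
      using mult_coset_subset_adjs[OF n] by blast
    have disj: "?f n ` mults \<inter> ?f n' ` mults = {}"
    proof (rule ccontr)
      assume "\<not> ?thesis"
      then obtain a b where ab: "a \<in> mults" "b \<in> mults" "[a * n = b * n'] (mod int p)"
        by (auto simp: cong_def)
      have "\<not> int p dvd b" using ab(2) Mult_not_dvd by simp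
      then obtain c where c: "[b * c = 1] (mod int p)" using exists_inverse by blast
      have "Mult (c * a)" using ab c Mult_inverse[of b c] by (simp add: Mult_mult)
      have "[c * a * n = c * (b * n')] (mod int p)" using cong_mult[OF cong_refl[of c] ab(3)] by (simp add: mult.assoc)
      also have "c * (b * n') = b * c * n'" by (simp add: ac_simps)
      also have "[b * c * n' = 1 * n'] (mod int p)" by (intro cong_mult cong_refl c)
      finally have "(c * a mod int p) * n mod int p = n'"
        using n' by (simp add: cong_def mod_mult_left_eq)
      moreover have "c * a mod int p \<in> mults"
        using \<open>Mult (c * a)\<close> Mult_cong[of "c * a" "c * a mod int p"] Mult_not_dvd not_dvd_mod_iff[of "c * a"] by simp
      ultimately have "n' \<in> ?f n ` mults" by (metis (no_types, lifting) image_eqI)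
      then show False using n' by simp
    qed
    have fin: "finite mults" "finite adjs" by simp_all
    have "card (?f n ` mults \<union> ?f n' ` mults) = 2 * card nonadjs"
      using disj fin n n' card_mult_coset[of n] card_mult_coset[of n'] card_mults
      by (subst card_Un_disjoint) auto
    moreover have "card (?f n ` mults \<union> ?f n' ` mults) \<le> card adjs"
      using mult_coset_subset_adjs[OF n] mult_coset_subset_adjs[of n'] n' fin by (intro card_mono) auto
    ultimately show False using card_adjs_nonadjs few by linarith
  qed
  have "card adjs = card mults" using card_mult_coset[OF n] unfolding eq .
  then show "2 * card nonadjs = p - 1" using card_adjs_nonadjs card_mults by simp
qed

lemma card_nonadjs: "2 * card nonadjs = p - 1"
  using exists_adj adjs_eq_coset(2) by blast

text \<open>The multipliers have index two, so for a non-multiplier \<open>a\<close> the coset of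
  \<open>a\<close> is the whole complement. If \<open>a * a\<close> lay in it, cancelling
  \<open>a\<close> would make \<open>a\<close> a multiplier.\<close>

lemma Mult_square:
  assumes "\<not> int p dvd a"
  shows "Mult (a * a)"
proof (cases "Mult a")
  case False
  let ?S = "(\<lambda>b. b * a mod int p) ` mults"
  have disj: "?S \<inter> mults = {}"
  proof (rule ccontr)
    assume "\<not> ?thesis"
    then obtain b where b: "Mult b" "Mult (b * a mod int p)" by auto
    obtain c where c: "[b * c = 1] (mod int p)" using exists_inverse[OF Mult_not_dvd[OF b(1)]] by blast
    have "Mult (c * (b * a mod int p))" using Mult_mult Mult_inverse[OF b(1) c] b(2) by blast
    moreover have "[c * (b * a mod int p) = c * (b * a)] (mod int p)" by (intro cong_mult cong_refl) simp
    moreover have "[c * (b * a) = 1 * a] (mod int p)"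
      using cong_mult[OF c cong_refl[of a]] by (simp add: ac_simps)
    ultimately have "Mult a" using Mult_cong cong_trans by fastforce
    then show False using False by simp
  qed
  have sub: "?S \<union> mults \<subseteq> {1..<int p}"
  proof -
    have "b * a mod int p \<in> {1..<int p}" if "Mult b" for b
      using assms Mult_not_dvd[OF that] not_dvd_mod_iff[of "b * a"] prime_int by (simp add: prime_dvd_mult_iff)
    then show ?thesis by auto
  qed
  have "card (?S \<union> mults) = card ?S + card mults" using disj by (intro card_Un_disjoint) auto
  also have "card ?S = card mults" by (rule card_mult_image[OF assms]) auto
  finally have "card (?S \<union> mults) = card {1..<int p}" using card_mults card_nonadjs by (simp add: nat_diff_distrib)
  then have all: "?S \<union> mults = {1..<int p}" using sub by (intro card_subset_eq) auto
  show ?thesis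
  proof (rule ccontr)
    assume "\<not> Mult (a * a)"
    then have "a * a mod int p \<notin> mults" using Mult_cong[of "a * a mod int p" "a * a"] by auto
    moreover have "a * a mod int p \<in> {1..<int p}"
      using assms not_dvd_mod_iff[of "a * a"] prime_int by (simp add: prime_dvd_mult_iff)
    ultimately have "a * a mod int p \<in> ?S" using all by blast
    then obtain b where b: "Mult b" "[b * a = a * a] (mod int p)" by (auto simp: cong_def)
    then have "[b = a] (mod int p)"
      using assms prime_int by (simp add: cong_iff_dvd_diff left_diff_distrib[symmetric] prime_dvd_mult_iff)
    then show False using b(1) False Mult_cong by blast
  qed
qed (simp add: Mult_mult)

section \<open>Multipliers are the squares, and neighbourhoods are Paley graphs\<close>

abbreviation \<chi> :: "int \<Rightarrow> int" where "\<chi> x \<equiv> Legendre x (int p)"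

text \<open>Squares are multipliers by the index-two argument. A nonresidue among the multipliers
  would, times the squares, reach all nonresidues and make every unit a multiplier, against the
  count (p - 1) / 2.\<close>

lemma Mult_iff_Legendre: "Mult a \<longleftrightarrow> \<chi> a = 1"
proof -
  have sq: "Mult a" if "\<chi> a = 1" for a
  proof -
    obtain y where y: "[a = y ^ 2] (mod int p)" "\<not> int p dvd a"
      using \<open>\<chi> a = 1\<close> Legendre_eq_1_iff[OF prime p_gt_2] by blast
    then have "\<not> int p dvd y" using cong_dvd_iff[OF y(1)] by (auto simp: power2_eq_square)
    then have "Mult (y ^ 2)" using Mult_square by (simp add: power2_eq_square)
    then show ?thesis using Mult_cong cong_sym[OF y(1)] by blast
  qed
  moreover have "\<chi> a = 1" if "Mult a"
  proof (rule ccontr)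
    assume "\<chi> a \<noteq> 1"
    then have a: "\<chi> a = - 1"
      using Legendre_values[OF prime p_gt_2, of a] Legendre_eq_0_iff[OF prime p_gt_2, of a] Mult_not_dvd[OF that] by auto
    obtain c where c: "[a * c = 1] (mod int p)" using exists_inverse[of a] Mult_not_dvd \<open>Mult a\<close> by blast
    have "Mult x" if "x \<in> {1..<int p}" for x
    proof (cases "\<chi> x = 1")
      case False
      have "\<not> int p dvd x" using \<open>x \<in> {1..<int p}\<close> not_dvd_mod_iff[of x] by simp
      then have "\<chi> x = - 1"
        using False Legendre_values[OF prime p_gt_2, of x] Legendre_eq_0_iff[OF prime p_gt_2, of x] by auto
      then have "\<chi> (c * x) = 1"
        using Legendre_inverse[OF prime p_gt_2 c] a by (simp add: Legendre_mult[OF prime p_gt_2])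
      then have "Mult (a * (c * x))" using sq Mult_mult \<open>Mult a\<close> by blast
      moreover have "[a * (c * x) = 1 * x] (mod int p)"
        using cong_mult[OF c cong_refl[of x]] by (simp add: mult.assoc)
      ultimately show ?thesis using Mult_cong by simp
    qed (rule sq)
    then have "mults = {1..<int p}" by auto
    then have "card mults = p - 1" by (simp add: nat_diff_distrib)
    then show False using card_mults card_nonadjs p_gt_2 by linarith
  qed
  ultimately show ?thesis by blast
qed

lemma adj_coset_iff_Legendre:
  assumes n: "adj n"
  shows "adj (n * d) \<longleftrightarrow> \<chi> d = 1"
proof (cases "int p dvd d")
  case True
  then show ?thesis using adj_0[of "n * d"] Legendre_eq_0_iff[OF prime p_gt_2, of d] by auto
next
  case False
  have nn: "\<not> int p dvd n" using n adj_0 by blast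
  then have "n * d mod int p \<in> {1..<int p}"
    using False not_dvd_mod_iff[of "n * d"] prime_int by (simp add: prime_dvd_mult_iff)
  then have "adj (n * d) \<longleftrightarrow> n * d mod int p \<in> adjs" by (simp add: adj_mod)
  also have "\<dots> \<longleftrightarrow> (\<exists>a\<in>mults. [a * n = n * d] (mod int p))"
    unfolding adjs_eq_coset(1)[OF n, symmetric] image_iff cong_def by (rule bex_cong) auto
  also have "\<dots> \<longleftrightarrow> (\<exists>a\<in>mults. [a = d] (mod int p))"
    using nn prime_int
    by (simp add: cong_iff_dvd_diff mult.commute[of n] left_diff_distrib[symmetric] prime_dvd_mult_iff)
  also have "\<dots> \<longleftrightarrow> Mult d"
  proof
    assume "Mult d"
    then have "d mod int p \<in> mults"
      using Mult_cong[of d "d mod int p"] False not_dvd_mod_iff[of d] by simp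
    then show "\<exists>a\<in>mults. [a = d] (mod int p)" by (intro bexI[of _ "d mod int p"]) auto
  qed (use Mult_cong in auto)
  finally show ?thesis by (simp add: Mult_iff_Legendre)
qed

text \<open>The connection set is a coset of the squares. Dividing all labels by one of its members
  turns it into the squares themselves, and the translation by that member becomes the new shift by
  one.\<close>

lemma exists_Paley_labelling:
  "\<exists>\<psi>. cyclic_labelling p r \<psi> \<and> (\<forall>i j. E (\<psi> i) (\<psi> j) \<longleftrightarrow> \<chi> (j - i) = 1)"
proof -
  obtain n where n: "adj n" using exists_adj by blast
  then have nn: "\<not> int p dvd n" using adj_0 by blast
  obtain b where b: "[n * b = 1] (mod int p)" using exists_inverse[OF nn] by blast
  define \<psi> where "\<psi> i = \<phi> (n * i)" for i
  have "\<psi> i = \<psi> j \<longleftrightarrow> [i = j] (mod int p)" for i j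
    using nn prime_int
    by (simp add: \<psi>_def label_eq cong_iff_dvd_diff right_diff_distrib[symmetric] prime_dvd_mult_iff)
  moreover have "range \<psi> = {v. E r v}"
  proof -
    have "\<phi> x = \<psi> (b * x)" for x
      using cong_mult[OF b cong_refl[of x]] by (simp add: \<psi>_def label_eq mult.assoc cong_sym)
    then have "range \<psi> = range \<phi>" by (auto simp: \<psi>_def)
    then show ?thesis using neighbour_iff by auto
  qed
  moreover have "\<exists>h. aut h \<and> h r = r \<and> (\<forall>i. h (\<psi> i) = \<psi> (i + 1))"
    using translation[of n] by (auto simp: \<psi>_def algebra_simps)
  moreover have "E (\<psi> i) (\<psi> j) \<longleftrightarrow> \<chi> (j - i) = 1" for i j
    using adj_coset_iff_Legendre[OF n, of "j - i"] by (simp add: \<psi>_def E_label right_diff_distrib)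
  ultimately show ?thesis unfolding cyclic_labelling_def by blast
qed

end

section \<open>The second sphere and the antipode\<close>

text \<open>Connectedness is stated as a closure principle at the root, the form in which it shows
  that the vertices found explicitly are all of \<open>V\<close>.\<close>

locale paley_labelled_graph = labelled_geodesic_graph +
  assumes paley: "adj d \<longleftrightarrow> Legendre d (int p) = 1"
    and connected_from_root: "S \<subseteq> V \<Longrightarrow> r \<in> S \<Longrightarrow> (\<And>u v. u \<in> S \<Longrightarrow> E u v \<Longrightarrow> v \<in> S) \<Longrightarrow> S = V"
begin

lemmas Legendre_facts = Legendre_cong[OF prime p_gt_2] Legendre_eq_0_iff[OF prime p_gt_2]
  Legendre_values[OF prime p_gt_2] Legendre_mult[OF prime p_gt_2] Legendre_1[OF prime p_gt_2]

text \<open>Adjacency is symmetric, so the connection set contains -1 along with 1. This is the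
  source of p \<equiv> 1 modulo 4.\<close>

lemma Legendre_minus_one: "\<chi> (- 1) = 1"
  using paley[of "- 1"] paley[of 1] adj_minus[of 1] Legendre_facts(5) by simp

lemmas Legendre_neg = Legendre_minus[OF prime p_gt_2 Legendre_minus_one]

lemma Legendre_diff_commute: "\<chi> (x - y) = \<chi> (y - x)"
  using Legendre_neg[of "x - y"] by simp

lemmas card_pair = card_Legendre_pair[OF prime p_gt_2 _ _ _ Legendre_minus_one]

lemma Legendre_nonzero: "\<chi> d = 1 \<or> \<chi> d = - 1 \<Longrightarrow> \<not> int p dvd d"
  using Legendre_facts(2)[of d] by auto

lemma nonadj_iff: "\<not> int p dvd d \<and> \<not> adj d \<longleftrightarrow> \<chi> d = - 1"
  using Legendre_facts(2,3)[of d] paley[of d] by auto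

definition m :: nat where "m = card {x \<in> {0..<int p}. \<chi> x = - 1}"

lemma card_class: "s = 1 \<or> s = - 1 \<Longrightarrow> card {x \<in> {0..<int p}. \<chi> x = s} = m"
  using card_Legendre_eq[OF prime p_gt_2, of s] card_Legendre_eq[OF prime p_gt_2, of "- 1"]
  unfolding m_def by simp

lemma p_eq: "p = 2 * m + 1"
  using card_Legendre_eq[OF prime p_gt_2, of "- 1"] p_gt_2 unfolding m_def by simp

lemma int_p_eq: "int p = 2 * int m + 1"
  using p_eq by simp

lemma nonadjs_m: "card nonadjs = m"
  using card_nonadjs p_eq by simp

lemma obtain_nonresidue: obtains e where "\<chi> e = - 1"
  using exists_nonresidue[OF prime p_gt_2] by blast

text \<open>\<open>m\<close> is twice a Paley parameter, hence even, and it is positive since p >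
  2.\<close>

lemma m_ge_2: "2 \<le> m"
proof -
  obtain e where e: "\<chi> e = - 1" using obtain_nonresidue .
  have "4 * int (card {x \<in> {0..<int p}. \<chi> x = 1 \<and> \<chi> (x - e) = 1}) = int p - 1"
    using card_pair[of 1 1 e] e Legendre_nonzero[of e] by simp
  then have "2 * card {x \<in> {0..<int p}. \<chi> x = 1 \<and> \<chi> (x - e) = 1} = m"
    using int_p_eq by linarith
  then have "even m" by (metis dvd_triv_left)
  then show ?thesis using p_gt_2 p_eq by presburger
qed

lemma p_not_dvd_m: "\<not> int p dvd int m"
  using m_ge_2 p_eq by (auto dest!: dvd_imp_le)

text \<open>Inside the neighbourhood two nonadjacent vertices have m / 2 common neighbours, and the
  root is one more. A divisor of m that exceeds m / 2 is m.\<close>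

lemma common_nonadj:
  assumes "\<chi> d = - 1"
  shows "common (\<phi> 0) (\<phi> d) = m"
proof -
  have nd: "\<not> int p dvd d" "\<not> adj d" using assms nonadj_iff[of d] by auto
  have "4 * int (card {y \<in> {0..<int p}. \<chi> y = 1 \<and> \<chi> (y - d) = 1}) = int p - 1"
    using card_pair[of 1 1 d] nd assms by simp
  then have "2 * card {y \<in> {0..<int p}. \<chi> y = 1 \<and> \<chi> (y - d) = 1} = m"
    using int_p_eq by linarith
  moreover have "1 + card {y \<in> {0..<int p}. \<chi> y = 1 \<and> \<chi> (y - d) = 1} \<le> common (\<phi> 0) (\<phi> d)"
    using common_label[of 0 d] by (simp add: paley)
  ultimately have "m < 2 * common (\<phi> 0) (\<phi> d)" by linarith
  moreover obtain k where k: "m = common (\<phi> 0) (\<phi> d) * k"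
    using common_dvd_nonadjs[OF nd] nonadjs_m by (auto elim: dvdE)
  ultimately have "k < 2" by auto
  moreover have "k \<noteq> 0" using k m_ge_2 by (metis mult_0_right not_numeral_le_zero)
  ultimately show ?thesis using k by (cases k) auto
qed

lemma common_root_sphere2: "w \<in> sphere2 \<Longrightarrow> common r w = m"
proof -
  assume w: "w \<in> sphere2"
  obtain e where e: "\<chi> e = - 1" using obtain_nonresidue .
  then have "\<not> int p dvd e" "\<not> adj e" using nonadj_iff[of e] by auto
  then show ?thesis using common_sphere2[OF w, of e] common_nonadj[OF e] by simp
qed

lemma card_sphere2: "card sphere2 = p"
proof -
  obtain e where e: "\<chi> e = - 1" using obtain_nonresidue .
  then have "\<not> int p dvd e" "\<not> adj e" using nonadj_iff[of e] by auto
  then show ?thesis using edges_to_sphere2[of e] common_nonadj[OF e] nonadjs_m m_ge_2 by simp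
qed

lemma common_adjacent:
  assumes "E u v"
  shows "common u v = m"
proof -
  obtain g where g: "aut g" "g u = r" "g v = \<phi> 0" using arc_transitive[OF assms E_root(1)] by blast
  have "common u v = common r (\<phi> 0)" using common_aut[OF g(1), of u v] g(2,3) E_dom[OF assms] by simp
  also have "\<dots> = m" using card_neighbours[of "E (\<phi> 0)"] card_class[of 1] by (simp add: common_def E_label paley)
  finally show ?thesis .
qed

text \<open>With the middle vertex moved to the root, this is the number of common neighbours of two
  nonadjacent vertices of a Paley graph. It later decides between residues and nonresidues for the
  edges to the second sphere.\<close>

lemma common_geodesic_middle:
  assumes "E u v" "E v w" "u \<noteq> w" "\<not> E u w"
  shows "2 * card {x \<in> V. E v x \<and> E u x \<and> E w x} = m"
proof -
  obtain g where g: "aut g" "g v = r" "g u = \<phi> 0"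
    using arc_transitive[OF E_sym[OF assms(1)] E_root(1)] by blast
  have V: "u \<in> V" "v \<in> V" "w \<in> V" using E_dom[OF assms(1)] E_dom[OF assms(2)] by auto
  have "E r (g w)" using aut_E[OF g(1) V(2,3)] g(2) assms(2) by simp
  then obtain d where d: "g w = \<phi> d" using neighbour_iff by auto
  have "\<not> adj d" using aut_E[OF g(1) V(1,3)] g(3) d assms(4) by (simp add: adj_def)
  moreover have "\<not> int p dvd d" 
    using aut_eq[OF g(1) V(1,3)] g(3) d assms(3) label_eq[of 0 d] by (auto simp: cong_iff_dvd_diff)
  ultimately have d1: "\<chi> d = - 1" "\<not> int p dvd d" using nonadj_iff[of d] by auto
  have "card {x \<in> V. E r x \<and> E (\<phi> 0) x \<and> E (\<phi> d) x} = card {x \<in> V. E v x \<and> E u x \<and> E w x}"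
  proof (rule aut_card[OF g(1)])
    fix x assume "x \<in> V"
    then show "(E r (g x) \<and> E (\<phi> 0) (g x) \<and> E (\<phi> d) (g x)) \<longleftrightarrow> (E v x \<and> E u x \<and> E w x)"
      using aut_E[OF g(1), of _ x] V g(2,3) d by metis
  qed
  moreover have "card {x \<in> V. E r x \<and> E (\<phi> 0) x \<and> E (\<phi> d) x} = card {y \<in> {0..<int p}. \<chi> y = 1 \<and> \<chi> (y - d) = 1}"
    using card_neighbours[of "\<lambda>x. E (\<phi> 0) x \<and> E (\<phi> d) x"] by (simp add: E_label paley)
  moreover have "4 * int (card {y \<in> {0..<int p}. \<chi> y = 1 \<and> \<chi> (y - d) = 1}) = int p - 1"
    using card_pair[of 1 1 d] d1 by simp
  ultimately show ?thesis using int_p_eq by linarith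
qed

text \<open>Only the class modulo p matters. Translating a set adds a multiple of its size and
  scaling multiplies the sum, so that for a set of size m, a unit, the sum separates its p
  translates.\<close>

definition residue_sum :: "(int \<Rightarrow> bool) \<Rightarrow> int" where
  "residue_sum B = (\<Sum>i\<in>{0..<int p}. if B i then i else 0)"

lemma residue_sum_shift:
  assumes B: "\<And>x y. [x = y] (mod int p) \<Longrightarrow> B x \<longleftrightarrow> B y"
  shows "[residue_sum (\<lambda>i. B (i - k)) = residue_sum B + k * int (card {i \<in> {0..<int p}. B i})] (mod int p)"
proof -
  let ?f = "\<lambda>y. if B y then y + k else 0"
  have "[(\<Sum>x\<in>{0..<int p}. ?f (x - k)) = (\<Sum>x\<in>{0..<int p}. ?f x)] (mod int p)"
  proof (rule rsum_reindex[OF p_pos(1)])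
    show "[?f x = ?f y] (mod int p)" if "[x = y] (mod int p)" for x y
      using that B[OF that] by (simp add: cong_add)
    show "[x = y] (mod int p)" if "[x - k = y - k] (mod int p)" for x y
      using that by (simp add: cong_iff_dvd_diff)
  qed
  moreover have "(\<Sum>x\<in>{0..<int p}. ?f (x - k)) = residue_sum (\<lambda>i. B (i - k))"
    unfolding residue_sum_def by (intro sum.cong) auto
  moreover have "(\<Sum>x\<in>{0..<int p}. ?f x) = residue_sum B + (\<Sum>x\<in>{0..<int p}. if B x then k else 0)"
    unfolding residue_sum_def sum.distrib[symmetric] by (intro sum.cong) auto
  moreover have "(\<Sum>x\<in>{0..<int p}. if B x then k else 0) = k * int (card {i \<in> {0..<int p}. B i})"
    unfolding sum.inter_filter[OF finite_atLeastLessThan_int, symmetric] by simp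
  ultimately show ?thesis by simp
qed

lemma residue_sum_scale:
  assumes B: "\<And>x y. [x = y] (mod int p) \<Longrightarrow> B x \<longleftrightarrow> B y" and a: "\<not> int p dvd a"
  shows "[a * residue_sum (\<lambda>i. B (a * i)) = residue_sum B] (mod int p)"
proof -
  let ?f = "\<lambda>y. if B y then y else 0"
  have "[(\<Sum>x\<in>{0..<int p}. ?f (a * x)) = (\<Sum>x\<in>{0..<int p}. ?f x)] (mod int p)"
  proof (rule rsum_reindex[OF p_pos(1)])
    show "[?f x = ?f y] (mod int p)" if "[x = y] (mod int p)" for x y
      using that B[OF that] by simp
    show "[x = y] (mod int p)" if "[a * x = a * y] (mod int p)" for x y
      using that a prime_int by (simp add: cong_iff_dvd_diff right_diff_distrib[symmetric] prime_dvd_mult_iff)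
  qed
  moreover have "(\<Sum>x\<in>{0..<int p}. ?f (a * x)) = a * residue_sum (\<lambda>i. B (a * i))"
    unfolding residue_sum_def sum_distrib_left by (intro sum.cong) auto
  ultimately show ?thesis by (simp add: residue_sum_def)
qed

lemma cong_cancel_m:
  assumes "[k * int m = l * int m] (mod int p)"
  shows "[k = l] (mod int p)"
  using assms p_not_dvd_m prime_int
  by (simp add: cong_iff_dvd_diff left_diff_distrib[symmetric] prime_dvd_mult_iff)

lemma neighbour_pattern_cong: "[x = y] (mod int p) \<Longrightarrow> E (\<phi> x) w \<longleftrightarrow> E (\<phi> y) w"
  using label_eq[of x y] by simp

lemma card_neighbour_pattern: "w \<in> sphere2 \<Longrightarrow> card {i \<in> {0..<int p}. E (\<phi> i) w} = m"
  using card_neighbours[of "\<lambda>x. E x w"] common_root_sphere2[of w] by (simp add: common_def E_commute[of w])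

lemma aut_sphere2:
  assumes g: "aut g" "g r = r" and w: "w \<in> sphere2"
  shows "g w \<in> sphere2"
proof -
  obtain i where i: "w \<in> V" "w \<noteq> r" "\<not> E r w" "E (\<phi> i) w" using w by (rule sphere2E)
  have "E r (g (\<phi> i))" using aut_E[OF g(1) root label_in, of i] g(2) E_root by simp
  then obtain j where "g (\<phi> i) = \<phi> j" using neighbour_iff by auto
  then show ?thesis
    using aut_E[OF g(1) root i(1)] aut_E[OF g(1) label_in i(1), of i] aut_eq[OF g(1) i(1) root] i g(2)
    by (intro sphere2I[of _ j]) auto
qed

lemma translated_pattern:
  assumes "aut h" "\<And>i. h (\<phi> i) = \<phi> (i + k)" "w \<in> V"
  shows "E (\<phi> i) (h w) \<longleftrightarrow> E (\<phi> (i - k)) w"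
  using aut_E[OF assms(1) label_in assms(3), of "i - k"] assms(2)[of "i - k"] by simp

text \<open>
  A translation by \<open>k\<close> changes the sum of the labels of the neighbours of \<open>w\<close> by \<open>k m\<close>, and \<open>m\<close> is prime
  to \<open>p\<close>. So exactly one vertex of the second sphere has sum zero, and the multipliers must fix it.
\<close>

lemma exists_centred: "\<exists>w\<in>sphere2. [residue_sum (\<lambda>i. E (\<phi> i) w) = 0] (mod int p)"
proof -
  have "sphere2 \<noteq> {}" using card_sphere2 p_gt_2 by auto
  then obtain w where w: "w \<in> sphere2" by blast
  then have wV: "w \<in> V" by (simp add: sphere2_def)
  obtain b where b: "[int m * b = 1] (mod int p)" using exists_inverse[OF p_not_dvd_m] by blast
  define k where "k = - (b * residue_sum (\<lambda>i. E (\<phi> i) w))"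
  obtain h where h: "aut h" "h r = r" "\<And>i. h (\<phi> i) = \<phi> (i + k)" using translation[of k] by blast
  let ?s = "residue_sum (\<lambda>i. E (\<phi> i) w)"
  have "[residue_sum (\<lambda>i. E (\<phi> i) (h w)) = ?s + k * int m] (mod int p)"
    using residue_sum_shift[of "\<lambda>i. E (\<phi> i) w" k] neighbour_pattern_cong card_neighbour_pattern[OF w]
    by (simp add: translated_pattern[OF h(1,3) wV])
  also have "?s + k * int m = ?s - (int m * b) * ?s" by (simp add: k_def)
  also have "[?s - (int m * b) * ?s = ?s - 1 * ?s] (mod int p)"
    by (intro cong_diff cong_mult cong_refl b)
  finally show ?thesis using aut_sphere2[OF h(1,2) w] by (intro bexI[of _ "h w"]) auto
qed

text \<open>The translates of a centred vertex have distinct label sums and so exhaust the p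
  vertices of the second sphere. Its pattern is invariant under squares and has m members, hence is
  one of the two square classes; a count of common neighbours rules out the residues.\<close>

lemma exists_sphere2_labelling:
  "\<exists>\<psi>. (\<forall>k l. \<psi> k = \<psi> l \<longleftrightarrow> [k = l] (mod int p)) \<and> range \<psi> = sphere2 \<and>
    (\<forall>i k. E (\<phi> i) (\<psi> k) \<longleftrightarrow> \<chi> (i - k) = - 1)"
proof -
  obtain w where w: "w \<in> sphere2" and centred: "[residue_sum (\<lambda>i. E (\<phi> i) w) = 0] (mod int p)"
    using exists_centred by blast
  have wV: "w \<in> V" and wr: "r \<noteq> w" "\<not> E r w" using w by (auto simp: sphere2_def)
  define B where "B = (\<lambda>i. E (\<phi> i) w)"
  have Bc: "B x \<longleftrightarrow> B y" if "[x = y] (mod int p)" for x y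
    using neighbour_pattern_cong[OF that] by (simp add: B_def)
  have cardB: "card {i \<in> {0..<int p}. B i} = m" using card_neighbour_pattern[OF w] by (simp add: B_def)
  have B0: "[residue_sum B = 0] (mod int p)" using centred by (simp add: B_def)
  have shiftB: "[residue_sum (\<lambda>i. B (i - k)) = k * int m] (mod int p)" for k
    using residue_sum_shift[of B k, OF Bc] cong_add[OF B0 cong_refl[of "k * int m"]] cardB
    by (metis (no_types, lifting) add_0 cong_trans)
  have "\<exists>T. \<forall>k. aut (T k) \<and> T k r = r \<and> (\<forall>i. T k (\<phi> i) = \<phi> (i + k))"
    by (rule choice) (use translation in blast)
  then obtain T where T: "\<And>k. aut (T k)" "\<And>k. T k r = r" "\<And>k i. T k (\<phi> i) = \<phi> (i + k)" by blast
  \<comment> \<open>An automorphism inducing a given translation is merely chosen; reducing k before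
    the choice makes \<open>\<psi>\<close> depend on the residue alone.\<close>
  define \<psi> where "\<psi> k = T (k mod int p) w" for k
  have E\<psi>: "E (\<phi> i) (\<psi> k) \<longleftrightarrow> B (i - k)" for i k
  proof -
    have "E (\<phi> i) (\<psi> k) \<longleftrightarrow> B (i - k mod int p)"
      unfolding \<psi>_def B_def by (rule translated_pattern) (use T wV in auto)
    also have "\<dots> \<longleftrightarrow> B (i - k)" by (rule Bc) (simp add: cong_def mod_diff_right_eq)
    finally show ?thesis .
  qed
  have \<psi>_in: "\<psi> k \<in> sphere2" for k unfolding \<psi>_def by (rule aut_sphere2[OF T(1,2) w])
  have \<psi>_eq: "\<psi> k = \<psi> l \<longleftrightarrow> [k = l] (mod int p)" for k l
  proof
    assume "\<psi> k = \<psi> l"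
    then have "B (i - k) \<longleftrightarrow> B (i - l)" for i using E\<psi>[of i k] E\<psi>[of i l] by simp
    then have "[k * int m = l * int m] (mod int p)"
      using shiftB[of k] shiftB[of l] by (simp add: cong_def)
    then show "[k = l] (mod int p)" by (rule cong_cancel_m)
  qed (simp add: \<psi>_def cong_def)
  have "\<psi> ` {0..<int p} = sphere2"
  proof (rule card_subset_eq[OF finite_sphere2])
    have "inj_on \<psi> {0..<int p}" by (auto intro!: inj_onI simp: \<psi>_eq cong_def)
    then show "card (\<psi> ` {0..<int p}) = card sphere2" by (simp add: card_image card_sphere2)
  qed (use \<psi>_in in auto)
  then have range_\<psi>: "range \<psi> = sphere2" using \<psi>_in by blast
  \<comment> \<open>A multiplier sends \<open>w\<close> to some \<open>\<psi> k\<close>. Comparing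
    label sums, a multiple of 0 on one side and k m on the other, forces k to be 0 modulo p, so the
    pattern of \<open>w\<close> is invariant.\<close>
  have scaleB: "B (a * i) \<longleftrightarrow> B i" if a: "\<chi> a = 1" for a i
  proof -
    obtain g where g: "aut g" "g r = r" "\<And>x. g (\<phi> x) = \<phi> (a * x)"
      using a Mult_iff_Legendre[of a] unfolding Mult_def by blast
    obtain k where k: "g w = \<psi> k" using aut_sphere2[OF g(1,2) w] range_\<psi> by auto
    have *: "B (a * i - k) \<longleftrightarrow> B i" for i
      using aut_E[OF g(1) label_in wV, of i] g(3)[of i] k E\<psi>[of "a * i" k] by (simp add: B_def)
    have "[a * residue_sum (\<lambda>i. B (a * i - k)) = residue_sum (\<lambda>i. B (i - k))] (mod int p)"
      using a Legendre_nonzero[of a] by (intro residue_sum_scale[of "\<lambda>i. B (i - k)"]) (auto intro!: Bc cong_diff)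
    then have "[a * residue_sum B = residue_sum (\<lambda>i. B (i - k))] (mod int p)" by (simp add: *)
    then have "[a * 0 = k * int m] (mod int p)"
      using cong_mult[OF cong_refl[of a] B0] shiftB[of k] by (simp add: cong_def)
    then have "[k = 0] (mod int p)" using cong_cancel_m[of 0 k] by (simp add: cong_sym_eq)
    then have "[a * i - k = a * i] (mod int p)" by (simp add: cong_iff_dvd_diff)
    then show ?thesis using * Bc by blast
  qed
  have classB: "B j" if ij: "B i" "\<chi> i = \<chi> j" "\<not> int p dvd i" for i j
  proof -
    obtain b where b: "[i * b = 1] (mod int p)" using exists_inverse[OF ij(3)] by blast
    have "\<chi> (j * b) = \<chi> (i * b)" using that(2) by (simp add: Legendre_facts(4))
    also have "\<dots> = 1" using Legendre_facts(1)[OF b] Legendre_facts(5) by simp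
    finally have "B (j * b * i)" using scaleB that(1) by blast
    moreover have "[j * b * i = j] (mod int p)"
      using cong_mult[OF cong_refl[of j] b] by (simp add: ac_simps)
    ultimately show ?thesis using Bc by blast
  qed
  \<comment> \<open>The residue 0 is an orbit of its own under scaling. With m \<ge> 2 members the
    pattern cannot consist of it alone.\<close>
  have "\<exists>i. B i \<and> \<not> int p dvd i"
  proof (rule ccontr)
    assume none: "\<not> ?thesis"
    have "{i \<in> {0..<int p}. B i} \<subseteq> {0}"
    proof
      fix i assume "i \<in> {i \<in> {0..<int p}. B i}"
      then have "int p dvd i" "0 \<le> i" "i < int p" using none by auto
      then show "i \<in> {0}" by (auto dest: zdvd_imp_le)
    qed
    then have "card {i \<in> {0..<int p}. B i} \<le> card {0 :: int}" by (rule card_mono[rotated]) simp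
    then show False using cardB m_ge_2 by simp
  qed
  then obtain i where i: "B i" "\<not> int p dvd i" by blast
  define s where "s = \<chi> i"
  have s: "s = 1 \<or> s = - 1" using Legendre_facts(2,3)[of i] i by (auto simp: s_def)
  have "{j \<in> {0..<int p}. \<chi> j = s} = {j \<in> {0..<int p}. B j}"
    by (rule card_subset_eq) (use classB[OF i(1) _ i(2)] cardB card_class[OF s] in \<open>auto simp: s_def\<close>)
  moreover have "j mod int p \<in> {0..<int p}" for j using p_pos by simp
  ultimately have mod_s: "\<chi> (j mod int p) = s \<longleftrightarrow> B (j mod int p)" for j by blast
  have Bs: "B j \<longleftrightarrow> \<chi> j = s" for j
    using mod_s[of j] Bc[of "j mod int p" j] Legendre_facts(1)[of "j mod int p" j] by simp
  \<comment> \<open>The local structure at \<open>\<phi> i\<close> makes this count (p - 1) / 4. The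
    class of residues would give (p - 5) / 4, so the pattern is the class of nonresidues.\<close>
  have "2 * card {x \<in> V. E (\<phi> i) x \<and> E r x \<and> E w x} = m"
    using i E_root wr by (intro common_geodesic_middle) (auto simp: B_def)
  moreover have "card {x \<in> V. E (\<phi> i) x \<and> E r x \<and> E w x} = card {y \<in> {0..<int p}. B y \<and> adj (y - i)}"
    using card_neighbours[of "\<lambda>x. E (\<phi> i) x \<and> E w x"]
    by (simp add: E_label B_def E_commute[of w] conj_commute conj_left_commute)
  moreover have "4 * int (card {y \<in> {0..<int p}. \<chi> y = s \<and> \<chi> (y - i) = 1}) = int p - 2 - (s + 1) * s - s"
    using card_pair[OF s _ i(2), of 1] by (simp add: s_def)
  ultimately have "2 * int m = int p - 2 - (s + 1) * s - s" by (simp add: Bs paley)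
  then have "s = - 1" using s int_p_eq by auto
  then have "\<forall>i k. E (\<phi> i) (\<psi> k) \<longleftrightarrow> \<chi> (i - k) = - 1" using E\<psi> Bs by simp
  then show ?thesis using \<psi>_eq range_\<psi> by blast
qed

end

section \<open>Edges inside and beyond the second sphere\<close>

context paley_labelled_graph
begin

context
  fixes \<psi> :: "int \<Rightarrow> 'a"
  assumes \<psi>_eq: "\<And>k l. \<psi> k = \<psi> l \<longleftrightarrow> [k = l] (mod int p)"
    and range_\<psi>: "range \<psi> = sphere2"
    and \<phi>\<psi>: "\<And>i k. E (\<phi> i) (\<psi> k) \<longleftrightarrow> \<chi> (i - k) = - 1"
begin

lemma \<psi>_sphere2: "\<psi> k \<in> sphere2"
  using range_\<psi> by auto

lemma \<psi>_in: "\<psi> k \<in> V" "\<psi> k \<noteq> r" "\<not> E r (\<psi> k)" "\<psi> k \<noteq> \<phi> i"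
  using \<psi>_sphere2[of k] E_root[of i] by (auto simp: sphere2_def)

text \<open>A vertex of the second sphere is determined by the translate of the nonresidues that it
  sees among the labels, so the action on the first sphere dictates its image. The discrepancy
  \<open>e\<close> is a shift preserving the nonresidues, hence 0.\<close>

lemma root_aut_on_\<psi>:
  assumes g: "aut g" "g r = r" "\<And>x. g (\<phi> x) = \<phi> (a * x + b)" and a: "\<chi> a = 1"
  shows "g (\<psi> l) = \<psi> (a * l + b)"
proof -
  obtain k where k: "g (\<psi> l) = \<psi> k" using aut_sphere2[OF g(1,2) \<psi>_sphere2] range_\<psi> by (metis rangeE)
  define e where "e = k - (a * l + b)"
  have *: "\<chi> (a * (i - l) - e) = - 1 \<longleftrightarrow> \<chi> (i - l) = - 1" for i
  proof -
    have "a * (i - l) - e = a * i + b - k" by (simp add: e_def algebra_simps)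
    then show ?thesis
      using aut_E[OF g(1) label_in \<psi>_in(1), of i l] g(3)[of i] k \<phi>\<psi>[of "a * i + b" k] \<phi>\<psi>[of i l] by simp
  qed
  obtain c where c: "[a * c = 1] (mod int p)" using exists_inverse Legendre_nonzero a by blast
  have "\<chi> (y - e) = - 1 \<longleftrightarrow> \<chi> y = - 1" for y
  proof -
    have y: "[a * (c * y) = y] (mod int p)"
      using cong_mult[OF c cong_refl[of y]] by (simp add: mult.assoc)
    have "\<chi> (a * (c * y) - e) = - 1 \<longleftrightarrow> \<chi> (c * y) = - 1"
      using *[of "c * y + l"] by simp
    moreover have "\<chi> (c * y) = \<chi> y"
      using Legendre_inverse[OF prime p_gt_2 c] a by (simp add: Legendre_facts(4))
    moreover have "\<chi> (a * (c * y) - e) = \<chi> (y - e)"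
      by (intro Legendre_facts(1) cong_diff y cong_refl)
    ultimately show ?thesis by simp
  qed
  then have "int p dvd e" by (rule Legendre_class_determines_shift[OF prime p_gt_2 Legendre_minus_one])
  then show ?thesis unfolding k \<psi>_eq by (simp add: e_def cong_iff_dvd_diff)
qed

definition F :: "int \<Rightarrow> bool" where "F d \<longleftrightarrow> E (\<psi> 0) (\<psi> d)"

lemma E_\<psi>: "E (\<psi> k) (\<psi> l) \<longleftrightarrow> F (l - k)"
proof -
  obtain h where h: "aut h" "h r = r" "\<And>i. h (\<phi> i) = \<phi> (i + - k)" using translation[of "- k"] by blast
  have "h (\<psi> x) = \<psi> (1 * x + - k)" for x
    by (rule root_aut_on_\<psi>[OF h(1,2)]) (simp_all add: h(3) Legendre_facts(5))
  then show ?thesis using aut_E[OF h(1) \<psi>_in(1) \<psi>_in(1), of k l] by (simp add: F_def)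
qed

lemma F_scale:
  assumes "\<chi> a = 1"
  shows "F (a * d) \<longleftrightarrow> F d"
proof -
  obtain g where g: "aut g" "g r = r" "\<And>x. g (\<phi> x) = \<phi> (a * x)"
    using assms Mult_iff_Legendre[of a] unfolding Mult_def by blast
  have "g (\<psi> x) = \<psi> (a * x + 0)" for x
    by (rule root_aut_on_\<psi>[OF g(1,2)]) (simp_all add: g(3) assms)
  then show ?thesis using aut_E[OF g(1) \<psi>_in(1) \<psi>_in(1), of 0 d] by (simp add: F_def)
qed

lemma F_cong: "[x = y] (mod int p) \<Longrightarrow> F x \<longleftrightarrow> F y"
  using \<psi>_eq[of x y] by (simp add: F_def)

lemma F_0: "int p dvd x \<Longrightarrow> \<not> F x"
  using F_cong[of x 0] E_irrefl by (simp add: F_def cong_0_iff)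

lemma F_class:
  assumes "\<chi> x = \<chi> y" "\<not> int p dvd x"
  shows "F x \<longleftrightarrow> F y"
proof -
  obtain b where b: "[x * b = 1] (mod int p)" using exists_inverse[OF assms(2)] by blast
  have "\<chi> (y * b) = \<chi> (x * b)" using assms(1) by (simp add: Legendre_facts(4))
  also have "\<dots> = 1" using Legendre_facts(1)[OF b] Legendre_facts(5) by simp
  finally have "F (y * b * x) \<longleftrightarrow> F x" by (rule F_scale)
  moreover have "[y * b * x = y] (mod int p)"
    using cong_mult[OF cong_refl[of y] b] by (simp add: ac_simps)
  ultimately show ?thesis using F_cong by blast
qed

lemma inj_labels: "inj_on \<phi> {i \<in> {0..<int p}. P i}" "inj_on \<psi> {i \<in> {0..<int p}. P i}"
  by (auto intro!: inj_onI simp: label_eq \<psi>_eq cong_def)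

lemma card_label_union:
  "card (\<phi> ` {i \<in> {0..<int p}. P i} \<union> \<psi> ` {i \<in> {0..<int p}. Q i}) =
    card {i \<in> {0..<int p}. P i} + card {i \<in> {0..<int p}. Q i}"
proof -
  have "\<phi> ` {i \<in> {0..<int p}. P i} \<inter> \<psi> ` {i \<in> {0..<int p}. Q i} = {}"
    by (auto simp: \<psi>_in(4)[THEN not_sym])
  then have "card (\<phi> ` {i \<in> {0..<int p}. P i} \<union> \<psi> ` {i \<in> {0..<int p}. Q i}) =
      card (\<phi> ` {i \<in> {0..<int p}. P i}) + card (\<psi> ` {i \<in> {0..<int p}. Q i})"
    by (intro card_Un_disjoint) simp_all
  then show ?thesis unfolding card_image[OF inj_labels(1)] card_image[OF inj_labels(2)] .
qed

lemma label_representative: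
  "\<exists>j\<in>{0..<int p}. \<phi> j = \<phi> i \<and> \<psi> j = \<psi> i \<and> [j = i] (mod int p)"
  using p_pos by (intro bexI[of _ "i mod int p"]) (auto simp: label_eq \<psi>_eq)

lemma neighbour_of_label:
  assumes "E (\<phi> i) x"
  shows "x = r \<or> x \<in> range \<phi> \<or> x \<in> range \<psi>"
  using assms sphere2I[of x i] neighbour_iff[of x] range_\<psi> by blast

text \<open>\<open>F\<close> is constant on each square class. An edge between the spheres has m
  common neighbours, half of them in the second sphere; if \<open>F\<close> held on nonresidues at
  most, only (p - 5) / 4 would be available there, so \<open>F\<close> holds on residues. Holding on
  both classes, it would give \<open>\<psi> 0\<close> at least m + p - 1 neighbours.\<close>

lemma F_iff: "F d \<longleftrightarrow> \<chi> d = 1"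
proof -
  obtain e where e: "\<chi> e = - 1" using obtain_nonresidue .
  have ne: "\<not> int p dvd e" "\<not> int p dvd 1" using Legendre_nonzero[of e] Legendre_nonzero[of 1] e Legendre_facts(5) by auto
  have count: "2 * card {y \<in> {0..<int p}. \<chi> y = - 1 \<and> F (y - e)} = m"
  proof -
    have adj: "E (\<phi> 0) (\<psi> e)" using \<phi>\<psi>[of 0 e] e Legendre_neg[of e] by simp
    have "{x \<in> V. E (\<phi> 0) x \<and> E (\<psi> e) x} =
      \<phi> ` {y \<in> {0..<int p}. \<chi> y = 1 \<and> \<chi> (y - e) = - 1} \<union> \<psi> ` {y \<in> {0..<int p}. \<chi> y = - 1 \<and> F (y - e)}"
      (is "?L = ?A \<union> ?B")
    proof (intro subset_antisym subsetI)
      fix x assume x: "x \<in> ?L"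
      then have "x \<noteq> r" using \<psi>_in(3) E_commute by blast
      then consider i where "x = \<phi> i" | i where "x = \<psi> i" using neighbour_of_label[of 0 x] x by auto
      then show "x \<in> ?A \<union> ?B"
      proof cases
        case 1
        obtain j where j: "j \<in> {0..<int p}" "\<phi> j = x" using label_representative[of i] 1 by auto
        then have "\<chi> j = 1 \<and> \<chi> (j - e) = - 1"
          using x E_label[of 0 j] \<phi>\<psi>[of j e] E_commute[of "\<psi> e"] by (auto simp: paley)
        then show ?thesis using j by blast
      next
        case 2
        obtain j where j: "j \<in> {0..<int p}" "\<psi> j = x" using label_representative[of i] 2 by auto
        then have "\<chi> j = - 1 \<and> F (j - e)"
          using x \<phi>\<psi>[of 0 j] E_\<psi>[of e j] Legendre_neg[of j] by auto
        then show ?thesis using j by blast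
      qed
    next
      fix x assume "x \<in> ?A \<union> ?B"
      then show "x \<in> ?L"
        using E_label[of 0] \<phi>\<psi> E_\<psi>[of e] E_commute[of "\<psi> e"] label_in \<psi>_in(1) Legendre_neg by (auto simp: paley)
    qed
    then have "m = card (?A \<union> ?B)" using common_adjacent[OF adj] by (simp add: common_def)
    also have "\<dots> = card {y \<in> {0..<int p}. \<chi> y = 1 \<and> \<chi> (y - e) = - 1} + card {y \<in> {0..<int p}. \<chi> y = - 1 \<and> F (y - e)}"
      by (rule card_label_union)
    finally have *: "m = \<dots>" .
    have "4 * int (card {y \<in> {0..<int p}. \<chi> y = 1 \<and> \<chi> (y - e) = - 1}) = int p - 1"
      using card_pair[of 1 "- 1" e] ne by simp
    then show ?thesis using * int_p_eq by linarith
  qed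
  have F1: "F 1"
  proof (rule ccontr)
    assume "\<not> F 1"
    then have F_imp: "\<chi> x = - 1" if "F x" for x
      using that F_0[of x] F_class[of 1 x] ne Legendre_facts(2,3)[of x] Legendre_facts(5) by auto
    have "card {y \<in> {0..<int p}. \<chi> y = - 1 \<and> F (y - e)} \<le> card {y \<in> {0..<int p}. \<chi> y = - 1 \<and> \<chi> (y - e) = - 1}"
      using F_imp by (intro card_mono) auto
    moreover have "4 * int (card {y \<in> {0..<int p}. \<chi> y = - 1 \<and> \<chi> (y - e) = - 1}) = int p - 5"
      using card_pair[of "- 1" "- 1" e] ne e by simp
    ultimately show False using count int_p_eq by linarith
  qed
  have Fe: "\<not> F e"
  proof
    assume "F e"
    then have F_all: "F x" if "\<not> int p dvd x" for x
      using that F1 F_class[of e x] F_class[of 1 x] ne e Legendre_facts(2,3)[of x] Legendre_facts(5) by auto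
    have "\<phi> ` {i \<in> {0..<int p}. \<chi> i = - 1} \<union> \<psi> ` {i \<in> {0..<int p}. F i} \<subseteq> {x. E (\<psi> 0) x}"
      using \<phi>\<psi>[of _ 0] E_\<psi>[of 0] E_commute[of "\<psi> 0"] by auto
    then have "card (\<phi> ` {i \<in> {0..<int p}. \<chi> i = - 1} \<union> \<psi> ` {i \<in> {0..<int p}. F i}) \<le> p"
      using valency[OF \<psi>_in(1), of 0] p_pos by (metis card_mono card_ge_0_finite)
    then have "m + card {i \<in> {0..<int p}. F i} \<le> p"
      unfolding card_label_union by (simp add: m_def)
    moreover have "{1..<int p} \<subseteq> {i \<in> {0..<int p}. F i}"
      using F_all not_dvd_mod_iff by auto
    then have "card {1..<int p} \<le> card {i \<in> {0..<int p}. F i}" by (rule card_mono[rotated]) simp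
    ultimately show False using m_ge_2 p_eq by (simp add: nat_diff_distrib)
  qed
  show ?thesis
    using F1 Fe F_0[of d] F_class[of 1 d] F_class[of e d] ne e Legendre_facts(2,3)[of d] Legendre_facts(5) by auto
qed

text \<open>A vertex of the second sphere has m neighbours in each of the two spheres, and the
  valency is 2 m + 1.\<close>

lemma \<psi>_outer_neighbour:
  obtains z where "E (\<psi> x) z" "z \<noteq> r" "z \<notin> range \<phi>" "z \<notin> range \<psi>"
    "\<And>y. E (\<psi> x) y \<Longrightarrow> y \<notin> range \<phi> \<Longrightarrow> y \<notin> range \<psi> \<Longrightarrow> y = z"
proof -
  define L where "L = \<phi> ` {i \<in> {0..<int p}. \<chi> (i - x) = - 1} \<union> \<psi> ` {i \<in> {0..<int p}. \<chi> (i - x) = 1}"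
  have "card L = card {i \<in> {0..<int p}. \<chi> (i - x) = - 1} + card {i \<in> {0..<int p}. \<chi> (i - x) = 1}"
    unfolding L_def by (rule card_label_union)
  also have "\<dots> = 2 * m"
    using card_residues_shift[of "\<lambda>i. \<chi> i = - 1" x] card_residues_shift[of "\<lambda>i. \<chi> i = 1" x]
      card_class[of 1] card_class[of "- 1"] Legendre_facts(1) by simp
  finally have cardL: "card L = 2 * m" .
  define N where "N = {y. E (\<psi> x) y}"
  have LN: "y \<in> L" if y: "y \<in> N" "y \<in> range \<phi> \<or> y \<in> range \<psi>" for y
  proof -
    obtain i where "y = \<phi> i \<or> y = \<psi> i" using y(2) by auto
    then obtain j where j: "j \<in> {0..<int p}" "y = \<phi> j \<or> y = \<psi> j" using label_representative[of i] by auto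
    then show ?thesis
      using y(1) \<phi>\<psi>[of j x] E_\<psi>[of x j] F_iff[of "j - x"] E_commute[of "\<psi> x"] unfolding L_def N_def by auto
  qed
  have "L \<subseteq> N"
    using \<phi>\<psi>[of _ x] E_\<psi>[of x] F_iff E_commute[of "\<psi> x"] unfolding L_def N_def by auto
  moreover have "card N = 2 * m + 1" using valency[OF \<psi>_in(1)] p_eq by (simp add: N_def)
  moreover have "finite L" by (simp add: L_def)
  ultimately have "card (N - L) = 1" using cardL by (simp add: card_Diff_subset)
  then obtain z where z: "N - L = {z}" by (auto simp: card_1_singleton_iff)
  show ?thesis
  proof (rule that[of z])
    show "E (\<psi> x) z" using z by (auto simp: N_def)
    then show "z \<noteq> r" using \<psi>_in(3) E_commute by blast
    show "z \<notin> range \<phi>" "z \<notin> range \<psi>" using z LN[of z] by auto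
    show "y = z" if "E (\<psi> x) y" "y \<notin> range \<phi>" "y \<notin> range \<psi>" for y
    proof -
      have "y \<notin> L" using that by (auto simp: L_def)
      then show ?thesis using that z by (auto simp: N_def)
    qed
  qed
qed

text \<open>\<open>\<psi> x\<close> and \<open>z\<close> have m common neighbours. None lies in the
  first sphere, and the only neighbour of \<open>\<psi> x\<close> outside both spheres is
  \<open>z\<close> itself, so they are all m neighbours of \<open>\<psi> x\<close> within the second
  sphere, among them \<open>\<psi> (x + 1)\<close>.\<close>

lemma outer_neighbour_propagates:
  assumes z: "E (\<psi> x) z" "z \<noteq> r" "z \<notin> range \<phi>" "z \<notin> range \<psi>"
  shows "E (\<psi> (x + 1)) z"
proof -
  have sub: "{y \<in> V. E (\<psi> x) y \<and> E z y} \<subseteq> \<psi> ` {i \<in> {0..<int p}. \<chi> (i - x) = 1}"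
  proof
    fix y assume y: "y \<in> {y \<in> V. E (\<psi> x) y \<and> E z y}"
    have "y \<notin> range \<phi>"
      using neighbour_of_label[of _ z] y z(2-4) E_commute[of z] by blast
    moreover have "y \<noteq> z" using y E_irrefl by blast
    ultimately have "y \<in> range \<psi>" using \<psi>_outer_neighbour[of x] z y by (metis (mono_tags, lifting) mem_Collect_eq)
    then obtain j where "j \<in> {0..<int p}" "y = \<psi> j" using label_representative by (metis rangeE)
    then show "y \<in> \<psi> ` {i \<in> {0..<int p}. \<chi> (i - x) = 1}" using y E_\<psi>[of x j] F_iff[of "j - x"] by auto
  qed
  have "card (\<psi> ` {i \<in> {0..<int p}. \<chi> (i - x) = 1}) = m"
    unfolding card_image[OF inj_labels(2)]
    using card_residues_shift[of "\<lambda>i. \<chi> i = 1" x] card_class[of 1] Legendre_facts(1) by simp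
  then have "{y \<in> V. E (\<psi> x) y \<and> E z y} = \<psi> ` {i \<in> {0..<int p}. \<chi> (i - x) = 1}"
    using common_adjacent[OF z(1)] by (intro card_subset_eq[OF _ sub]) (simp_all add: common_def)
  moreover obtain j where "j \<in> {0..<int p}" "\<psi> j = \<psi> (x + 1)" "[j = x + 1] (mod int p)" using label_representative by blast
  moreover then have "\<chi> (j - x) = 1"
    using Legendre_facts(1)[of "j - x" 1] cong_diff[of j "x + 1" "int p" x x] Legendre_facts(5) by simp
  ultimately have "\<psi> (x + 1) \<in> {y \<in> V. E (\<psi> x) y \<and> E z y}"
    by (metis (mono_tags, lifting) image_eqI mem_Collect_eq)
  then show ?thesis using E_commute by blast
qed

text \<open>By propagation the whole second sphere shares one outer neighbour, whose p neighbours
  are thereby used up. Connectedness leaves no room for a further vertex.\<close>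

lemma exists_antipode:
  "\<exists>z. V = {r, z} \<union> range \<phi> \<union> range \<psi> \<and> z \<noteq> r \<and> z \<notin> range \<phi> \<and> z \<notin> range \<psi> \<and>
    \<not> E r z \<and> (\<forall>i. \<not> E (\<phi> i) z) \<and> (\<forall>i. E (\<psi> i) z)"
proof -
  obtain z where z: "E (\<psi> 0) z" "z \<noteq> r" "z \<notin> range \<phi>" "z \<notin> range \<psi>"
    using \<psi>_outer_neighbour[of 0] .
  have "E (\<psi> (int n)) z" for n
  proof (induction n)
    case (Suc n)
    then show ?case using outer_neighbour_propagates[OF Suc z(2-4)] by (simp add: add.commute)
  qed (use z in simp)
  from this[of "nat (i mod int p)" for i] have "E (\<psi> (i mod int p)) z" for i using p_pos by simp
  moreover have "\<psi> (i mod int p) = \<psi> i" for i by (simp add: \<psi>_eq)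
  ultimately have \<psi>z: "E (\<psi> i) z" for i by simp
  have rz: "\<not> E r z" using z(3) neighbour_iff by simp
  have \<phi>z: "\<not> E (\<phi> i) z" for i using neighbour_of_label[of i z] z by blast
  have zV: "z \<in> V" using z E_dom by blast
  have "\<psi> ` {0..<int p} = {y. E z y}"
  proof (rule card_subset_eq)
    show "finite {y. E z y}" using valency[OF zV] p_pos by (intro card_ge_0_finite) simp
    have "inj_on \<psi> {0..<int p}" by (auto intro!: inj_onI simp: \<psi>_eq cong_def)
    then show "card (\<psi> ` {0..<int p}) = card {y. E z y}" by (simp add: card_image valency[OF zV])
  qed (use \<psi>z E_commute in auto)
  then have z_nbr: "y \<in> range \<psi>" if "E z y" for y using that by blast
  have "{r, z} \<union> range \<phi> \<union> range \<psi> = V"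
  proof (rule connected_from_root)
    show "{r, z} \<union> range \<phi> \<union> range \<psi> \<subseteq> V" using root zV label_in \<psi>_in(1) by auto
    fix u v assume u: "u \<in> {r, z} \<union> range \<phi> \<union> range \<psi>" and uv: "E u v"
    then consider "u = r" | "u = z" | i where "u = \<phi> i" | i where "u = \<psi> i" by blast
    then show "v \<in> {r, z} \<union> range \<phi> \<union> range \<psi>"
    proof cases
      case 4
      show ?thesis
      proof (rule ccontr)
        assume "\<not> ?thesis"
        moreover then have "v = z"
          using \<psi>_outer_neighbour[of i] uv \<psi>z[of i] z 4 by (metis UnI1 UnI2)
        ultimately show False by blast
      qed
    qed (use uv neighbour_iff z_nbr neighbour_of_label in blast)+
  qed blast
  then show ?thesis using z rz \<phi>z \<psi>z by (intro exI[of _ z]) auto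
qed

end

end

section \<open>Coordinates in the plane modulo squares\<close>

text \<open>\<open>\<theta> x y\<close> stands for the class of the vector (x, y) modulo nonzero
  squares. As a total function on pairs of integers it is unspecified where both entries vanish
  modulo p, hence the guards.\<close>

locale square_class_coordinates = simple_graph +
  fixes p :: nat and \<theta> :: "int \<Rightarrow> int \<Rightarrow> 'a"
  assumes prime: "Factorial_Ring.prime p" and p_gt_2: "2 < p"
    and Legendre_minus_one: "Legendre (- 1) (int p) = 1"
    and valency: "u \<in> V \<Longrightarrow> card {v. E u v} = p"
    and \<theta>_in: "\<not> (int p dvd x \<and> int p dvd y) \<Longrightarrow> \<theta> x y \<in> V"
    and \<theta>_surj: "v \<in> V \<Longrightarrow> \<exists>x y. \<not> (int p dvd x \<and> int p dvd y) \<and> v = \<theta> x y"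
    and \<theta>_E: "\<not> (int p dvd x \<and> int p dvd y) \<Longrightarrow> \<not> (int p dvd x' \<and> int p dvd y') \<Longrightarrow>
      E (\<theta> x y) (\<theta> x' y') \<longleftrightarrow> Legendre (x * y' - y * x') (int p) = 1"
    and \<theta>_eq: "\<not> (int p dvd x \<and> int p dvd y) \<Longrightarrow> \<not> (int p dvd x' \<and> int p dvd y') \<Longrightarrow>
      \<theta> x y = \<theta> x' y' \<longleftrightarrow>
      (\<exists>a. Legendre a (int p) = 1 \<and> [x' = a * x] (mod int p) \<and> [y' = a * y] (mod int p))"

context paley_labelled_graph
begin

text \<open>With a nonresidue e, the root and its antipode become (1, 0) and (e, 0), and the spheres
  become the vectors (i, 1) and (i e, e). The class of the second entry tells the sphere, the
  quotient of the entries is the label.\<close>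

lemma exists_square_class_coordinates: "\<exists>\<theta>. square_class_coordinates V E p \<theta>"
proof -
  obtain \<psi> where \<psi>_eq: "\<And>k l. \<psi> k = \<psi> l \<longleftrightarrow> [k = l] (mod int p)" and range_\<psi>: "range \<psi> = sphere2"
    and \<phi>\<psi>: "\<And>i k. E (\<phi> i) (\<psi> k) \<longleftrightarrow> \<chi> (i - k) = - 1"
    using exists_sphere2_labelling by blast
  note ctx = \<psi>_eq range_\<psi> \<phi>\<psi>
  obtain z where z: "V = {r, z} \<union> range \<phi> \<union> range \<psi>" "z \<noteq> r" "z \<notin> range \<phi>" "z \<notin> range \<psi>"
    "\<not> E r z" "\<And>i. \<not> E (\<phi> i) z" "\<And>i. E (\<psi> i) z"
    using exists_antipode[OF ctx] by blast
  have \<psi>\<psi>: "E (\<psi> k) (\<psi> l) \<longleftrightarrow> \<chi> (l - k) = 1" for k l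
    using E_\<psi>[OF ctx] F_iff[OF ctx] by blast
  have \<phi>\<phi>: "E (\<phi> k) (\<phi> l) \<longleftrightarrow> \<chi> (l - k) = 1" for k l
    using E_label paley by blast
  \<comment> \<open>The sign selects the sphere, and for \<open>\<Omega>\<close> the root or the
    antipode. With signs, the rules for edges within and between the spheres merge into
    \<open>s * t * \<chi> (i - j) = 1\<close>.\<close>
  define \<Phi> where "\<Phi> s i = (if s = 1 then \<phi> i else \<psi> i)" for s i :: int
  define \<Omega> where "\<Omega> s = (if s = 1 then r else z)" for s :: int
  have sign: "s = 1 \<or> s = - 1 \<Longrightarrow> t = 1 \<or> t = - 1 \<Longrightarrow> u \<in> {0, 1, - 1} \<Longrightarrow> s * t * u = 1 \<longleftrightarrow> (if s = t then u = 1 else u = - 1)"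
    for s t u :: int by auto
  have \<Phi>_E: "E (\<Phi> s i) (\<Phi> t j) \<longleftrightarrow> s * t * \<chi> (i - j) = 1" if st: "s = 1 \<or> s = - 1" "t = 1 \<or> t = - 1" for s t i j
    using sign[OF st, of "\<chi> (i - j)"] st Legendre_facts(3)[of "i - j"] \<phi>\<phi>[of i j] \<psi>\<psi>[of i j] \<phi>\<psi>[of i j] \<phi>\<psi>[of j i]
      E_commute[of "\<psi> i" "\<phi> j"] Legendre_diff_commute[of i j] by (auto simp: \<Phi>_def)
  have \<Omega>\<Phi>_E: "E (\<Omega> s) (\<Phi> t j) \<longleftrightarrow> s * t = 1" if "s = 1 \<or> s = - 1" "t = 1 \<or> t = - 1" for s t j
    using that z E_root \<psi>_in(3)[OF ctx] E_commute[of z] by (auto simp: \<Phi>_def \<Omega>_def)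
  have \<Omega>_E: "\<not> E (\<Omega> s) (\<Omega> t)" for s t
    using z E_irrefl E_commute[of z r] by (auto simp: \<Omega>_def)
  have \<Phi>_eq: "\<Phi> s i = \<Phi> t j \<longleftrightarrow> s = t \<and> [i = j] (mod int p)" if "s = 1 \<or> s = - 1" "t = 1 \<or> t = - 1" for s t i j
    using that \<psi>_in(4)[OF ctx] label_eq \<psi>_eq by (auto simp: \<Phi>_def) metis+
  have \<Omega>_eq: "\<Omega> s = \<Omega> t \<longleftrightarrow> s = t" if "s = 1 \<or> s = - 1" "t = 1 \<or> t = - 1" for s t
    using that z by (auto simp: \<Omega>_def)
  have \<Omega>\<Phi>_neq: "\<Omega> s \<noteq> \<Phi> t j" for s t j
    using z \<psi>_in(2)[OF ctx] E_root E_irrefl by (auto simp: \<Omega>_def \<Phi>_def) metis+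
  define iv where "iv y = (SOME b. [y * b = 1] (mod int p))" for y
  have iv: "[y * iv y = 1] (mod int p)" if "\<not> int p dvd y" for y
    unfolding iv_def using exists_inverse[OF that] by (rule someI_ex)
  have \<chi>_unit: "\<chi> x = 1 \<or> \<chi> x = - 1" if "\<not> int p dvd x" for x
    using that Legendre_facts(2,3)[of x] by blast
  have \<chi>_iv: "\<chi> (iv y) = \<chi> y" if "\<not> int p dvd y" for y
    by (rule Legendre_inverse[OF prime p_gt_2 iv[OF that]])
  define \<theta> where "\<theta> x y = (if int p dvd y then \<Omega> (\<chi> x) else \<Phi> (\<chi> y) (x * iv y))" for x y
  have "square_class_coordinates V E p \<theta>"
  proof unfold_locales
    show "2 < p" "Factorial_Ring.prime p" "\<chi> (- 1) = 1" by (fact p_gt_2 prime Legendre_minus_one)+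
    show "card {v. E u v} = p" if "u \<in> V" for u using valency[OF that] .
  next
    fix x y
    have "\<Omega> s \<in> V" "\<Phi> s i \<in> V" for s i using z(1) by (auto simp: \<Omega>_def \<Phi>_def)
    then show "\<theta> x y \<in> V" by (simp add: \<theta>_def)
  next
    fix v assume v: "v \<in> V"
    obtain e where e: "\<chi> e = - 1" using obtain_nonresidue .
    have ne: "\<not> int p dvd e" "\<not> int p dvd 1" using Legendre_nonzero[of e] Legendre_nonzero[of 1] e Legendre_facts(5) by auto
    consider "v = r" | "v = z" | i where "v = \<phi> i" | i where "v = \<psi> i" using v z(1) by blast
    then show "\<exists>x y. \<not> (int p dvd x \<and> int p dvd y) \<and> v = \<theta> x y"
    proof cases
      case 1
      then show ?thesis using ne by (intro exI[of _ 1] exI[of _ 0]) (simp add: \<theta>_def \<Omega>_def Legendre_facts(5))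
    next
      case 2
      then show ?thesis using ne e by (intro exI[of _ e] exI[of _ 0]) (simp add: \<theta>_def \<Omega>_def)
    next
      case 3
      have "[i * iv 1 = i] (mod int p)" using cong_mult[OF cong_refl[of i] iv[OF ne(2)]] by simp
      then show ?thesis using 3 ne
        by (intro exI[of _ i] exI[of _ 1]) (simp add: \<theta>_def \<Phi>_def Legendre_facts(5) label_eq cong_sym)
    next
      case 4
      have "[i * e * iv e = i] (mod int p)" using cong_mult[OF cong_refl[of i] iv[OF ne(1)]] by (simp add: mult.assoc)
      then show ?thesis using 4 ne e
        by (intro exI[of _ "i * e"] exI[of _ e]) (simp add: \<theta>_def \<Phi>_def \<psi>_eq cong_sym)
    qed
  next
    fix x y x' y'
    assume nz: "\<not> (int p dvd x \<and> int p dvd y)" "\<not> (int p dvd x' \<and> int p dvd y')"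
    show "E (\<theta> x y) (\<theta> x' y') \<longleftrightarrow> \<chi> (x * y' - y * x') = 1"
    proof (cases "int p dvd y"; cases "int p dvd y'")
      assume y: "int p dvd y" "int p dvd y'"
      then have "\<chi> (x * y' - y * x') = 0" using Legendre_facts(2) by simp
      then show ?thesis using y \<Omega>_E by (simp add: \<theta>_def)
    next
      assume y: "int p dvd y" "\<not> int p dvd y'"
      then have x: "\<not> int p dvd x" using nz by blast
      have "\<chi> (x * y' - y * x') = \<chi> (x * y')"
        using y by (intro Legendre_facts(1)) (simp add: cong_iff_dvd_diff)
      then show ?thesis using y \<Omega>\<Phi>_E[OF \<chi>_unit[OF x] \<chi>_unit[OF y(2)]] by (simp add: \<theta>_def Legendre_facts(4))
    next
      assume y: "\<not> int p dvd y" "int p dvd y'"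
      then have x: "\<not> int p dvd x'" using nz by blast
      have "\<chi> (x * y' - y * x') = \<chi> (- (x' * y))"
        using y by (intro Legendre_facts(1)) (simp add: cong_iff_dvd_diff mult.commute)
      then show ?thesis
        using y \<Omega>\<Phi>_E[OF \<chi>_unit[OF x] \<chi>_unit[OF y(1)]] E_commute[of "\<theta> x y" "\<theta> x' y'"]
        by (simp add: \<theta>_def Legendre_facts(4) Legendre_neg)
    next
      assume y: "\<not> int p dvd y" "\<not> int p dvd y'"
      \<comment> \<open>Inserting y times its inverse in one term and y' times its inverse in the
        other gives both the factor y y' and splits off the difference of the slopes.\<close>
      have "[x * y' - y * x' = (y * iv y) * (x * y') - (y' * iv y') * (y * x')] (mod int p)"
        using cong_diff[OF cong_mult[OF iv[OF y(1)] cong_refl[of "x * y'"]] cong_mult[OF iv[OF y(2)] cong_refl[of "y * x'"]]]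
        by (simp add: cong_sym)
      also have "(y * iv y) * (x * y') - (y' * iv y') * (y * x') = y * y' * (x * iv y - x' * iv y')"
        by (simp add: algebra_simps)
      finally have "\<chi> (x * y' - y * x') = \<chi> y * \<chi> y' * \<chi> (x * iv y - x' * iv y')"
        using Legendre_facts(1,4) by simp
      then show ?thesis using y \<Phi>_E[OF \<chi>_unit[OF y(1)] \<chi>_unit[OF y(2)]] by (simp add: \<theta>_def)
    qed
  next
    fix x y x' y'
    assume nz: "\<not> (int p dvd x \<and> int p dvd y)" "\<not> (int p dvd x' \<and> int p dvd y')"
    let ?R = "\<exists>a. \<chi> a = 1 \<and> [x' = a * x] (mod int p) \<and> [y' = a * y] (mod int p)"
    have R_dvd: "int p dvd y \<longleftrightarrow> int p dvd y'" if R: ?R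
    proof -
      obtain a where a: "\<chi> a = 1" "[y' = a * y] (mod int p)" using R by blast
      have "int p dvd y' \<longleftrightarrow> int p dvd a * y" using cong_dvd_iff[OF a(2)] .
      then show ?thesis using prime_int Legendre_nonzero[of a] a(1) by (simp add: prime_dvd_mult_iff)
    qed
    show "\<theta> x y = \<theta> x' y' \<longleftrightarrow> ?R"
    proof (cases "int p dvd y"; cases "int p dvd y'")
      assume y: "int p dvd y" "int p dvd y'"
      then have x: "\<not> int p dvd x" "\<not> int p dvd x'" using nz by auto
      have "\<chi> x = \<chi> x' \<longleftrightarrow> ?R"
      proof
        assume eq: "\<chi> x = \<chi> x'"
        have "\<chi> (x' * iv x) = 1" using \<chi>_iv[OF x(1)] \<chi>_unit[OF x(1)] eq by (auto simp: Legendre_facts(4))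
        moreover have "[x' * iv x * x = x' * 1] (mod int p)"
          using cong_mult[OF cong_refl[of x'] iv[OF x(1)]] by (simp add: ac_simps)
        moreover have "[y' = x' * iv x * y] (mod int p)" using y by (simp add: cong_iff_dvd_diff)
        ultimately show ?R by (intro exI[of _ "x' * iv x"]) (simp add: cong_sym_eq)
      next
        assume ?R
        then obtain a where "\<chi> a = 1" "[x' = a * x] (mod int p)" by blast
        then show "\<chi> x = \<chi> x'" using Legendre_facts(1)[of x' "a * x"] by (simp add: Legendre_facts(4))
      qed
      then show ?thesis using y \<Omega>_eq[OF \<chi>_unit[OF x(1)] \<chi>_unit[OF x(2)]] by (simp add: \<theta>_def)
    next
      assume y: "int p dvd y" "\<not> int p dvd y'"
      then show ?thesis using R_dvd \<Omega>\<Phi>_neq by (auto simp: \<theta>_def)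
    next
      assume y: "\<not> int p dvd y" "int p dvd y'"
      then show ?thesis using R_dvd \<Omega>\<Phi>_neq[THEN not_sym] by (auto simp: \<theta>_def)
    next
      assume y: "\<not> int p dvd y" "\<not> int p dvd y'"
      have "\<chi> y = \<chi> y' \<and> [x * iv y = x' * iv y'] (mod int p) \<longleftrightarrow> ?R"
      proof
        assume eq: "\<chi> y = \<chi> y' \<and> [x * iv y = x' * iv y'] (mod int p)"
        have "\<chi> (y' * iv y) = 1" using \<chi>_iv[OF y(1)] \<chi>_unit[OF y(1)] eq by (auto simp: Legendre_facts(4))
        moreover have "[y' * iv y * y = y' * 1] (mod int p)"
          using cong_mult[OF cong_refl[of y'] iv[OF y(1)]] by (simp add: ac_simps)
        moreover have "[y' * iv y * x = x'] (mod int p)"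
        proof -
          have "y' * iv y * x = y' * (x * iv y)" by simp
          also have "[y' * (x * iv y) = y' * (x' * iv y')] (mod int p)"
            by (rule cong_mult[OF cong_refl conjunct2[OF eq]])
          also have "y' * (x' * iv y') = x' * (y' * iv y')" by simp
          also have "[x' * (y' * iv y') = x' * 1] (mod int p)" by (intro cong_mult cong_refl iv y)
          finally show ?thesis by simp
        qed
        ultimately show ?R by (intro exI[of _ "y' * iv y"]) (simp add: cong_sym_eq)
      next
        assume ?R
        then obtain a where a: "\<chi> a = 1" "[x' = a * x] (mod int p)" "[y' = a * y] (mod int p)" by blast
        have "[x * iv y = (y' * iv y') * (x * iv y)] (mod int p)"
          using cong_mult[OF iv[OF y(2)] cong_refl[of "x * iv y"]] by (simp add: cong_sym)
        also have "[(y' * iv y') * (x * iv y) = ((a * y) * iv y') * (x * iv y)] (mod int p)"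
          by (intro cong_mult cong_refl a)
        also have "((a * y) * iv y') * (x * iv y) = (y * iv y) * ((a * x) * iv y')" by simp
        also have "[(y * iv y) * ((a * x) * iv y') = 1 * (x' * iv y')] (mod int p)"
          by (intro cong_mult cong_refl iv y cong_sym[OF a(2)])
        finally have "[x * iv y = x' * iv y'] (mod int p)" by simp
        moreover have "\<chi> y = \<chi> y'" using Legendre_facts(1)[OF a(3)] a(1) by (simp add: Legendre_facts(4))
        ultimately show "\<chi> y = \<chi> y' \<and> [x * iv y = x' * iv y'] (mod int p)" by simp
      qed
      then show ?thesis using y \<Phi>_eq[OF \<chi>_unit[OF y(1)] \<chi>_unit[OF y(2)]] by (simp add: \<theta>_def)
    qed
  qed
  then show ?thesis by blast
qed

end

theorem (in prime_geodesic_graph) exists_square_class_coordinates: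
  assumes r: "r \<in> V"
    and conn: "\<And>S. S \<subseteq> V \<Longrightarrow> r \<in> S \<Longrightarrow> (\<And>u v. u \<in> S \<Longrightarrow> E u v \<Longrightarrow> v \<in> S) \<Longrightarrow> S = V"
  shows "\<exists>\<theta>. square_class_coordinates V E p \<theta>"
proof -
  obtain \<phi>0 where "cyclic_labelling p r \<phi>0"
    using exists_cyclic_labelling[OF prime r valency[OF r]] arc_transitive by blast
  then interpret L: labelled_geodesic_graph V E p r \<phi>0
    by unfold_locales (use r in auto)
  obtain \<phi> where \<phi>: "cyclic_labelling p r \<phi>" "\<And>i j. E (\<phi> i) (\<phi> j) \<longleftrightarrow> Legendre (j - i) (int p) = 1"
    using L.exists_Paley_labelling by blast
  \<comment> \<open>The same graph with rescaled labels, for which the connection set is the set of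
    squares.\<close>
  interpret L': labelled_geodesic_graph V E p r \<phi>
    by unfold_locales (use r \<phi>(1) in auto)
  interpret P: paley_labelled_graph V E p r \<phi>
    by unfold_locales (use \<phi>(2)[of 0] conn in \<open>auto simp: L'.adj_def\<close>)
  show ?thesis by (rule P.exists_square_class_coordinates)
qed

section \<open>The automorphism group\<close>

text \<open>\<open>AutGraph\<close> written for an adjacency predicate, so that the coordinates can
  be treated apart from pair digraphs.\<close>

definition aut_group :: "'a set \<Rightarrow> ('a \<Rightarrow> 'a \<Rightarrow> bool) \<Rightarrow> ('a \<Rightarrow> 'a) monoid" where
  "aut_group V E = BijGroup V\<lparr>carrier := {g \<in> Bij V. \<forall>u\<in>V. \<forall>v\<in>V. E (g u) (g v) \<longleftrightarrow> E u v}\<rparr>"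

context simple_graph
begin

lemma carrier_aut_group: "g \<in> carrier (aut_group V E) \<longleftrightarrow> g \<in> extensional V \<and> aut g"
  by (auto simp: aut_group_def Bij_def graph_aut_def)

lemma mult_aut_group:
  "f \<in> carrier (aut_group V E) \<Longrightarrow> g \<in> carrier (aut_group V E) \<Longrightarrow> f \<otimes>\<^bsub>aut_group V E\<^esub> g = compose V f g"
  by (auto simp: aut_group_def BijGroup_def)

lemma one_aut_group: "\<one>\<^bsub>aut_group V E\<^esub> = (\<lambda>v\<in>V. v)"
  by (simp add: aut_group_def BijGroup_def)

lemma aut_restrict: "aut g \<Longrightarrow> aut (restrict g V)"
  by (auto simp: graph_aut_def cong: bij_betw_cong)

lemma group_aut_group: "group (aut_group V E)"
proof (rule groupI)
  fix f g assume fg: "f \<in> carrier (aut_group V E)" "g \<in> carrier (aut_group V E)"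
  then have "aut (compose V f g)"
    using aut_restrict[OF aut_comp[of f g]] by (simp add: carrier_aut_group compose_def comp_def)
  then show "f \<otimes>\<^bsub>aut_group V E\<^esub> g \<in> carrier (aut_group V E)"
    by (simp add: mult_aut_group[OF fg] carrier_aut_group)
next
  show one: "\<one>\<^bsub>aut_group V E\<^esub> \<in> carrier (aut_group V E)"
    using aut_restrict[OF aut_id] by (simp add: carrier_aut_group one_aut_group id_def)
  fix f assume f: "f \<in> carrier (aut_group V E)"
  then have fV: "f \<in> extensional V" "\<And>x. x \<in> V \<Longrightarrow> f x \<in> V" using aut_in by (auto simp: carrier_aut_group)
  show "\<one>\<^bsub>aut_group V E\<^esub> \<otimes>\<^bsub>aut_group V E\<^esub> f = f"
    unfolding mult_aut_group[OF one f] unfolding one_aut_group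
    using fV by (auto simp: compose_def extensional_def fun_eq_iff)
  have g: "restrict (inv_into V f) V \<in> carrier (aut_group V E)"
    using aut_restrict[OF aut_inv[of f]] f by (simp add: carrier_aut_group)
  have "restrict (inv_into V f) V \<otimes>\<^bsub>aut_group V E\<^esub> f = \<one>\<^bsub>aut_group V E\<^esub>"
    unfolding mult_aut_group[OF g f] one_aut_group
    using fV aut_inv_left[of f] f by (auto simp: carrier_aut_group compose_def fun_eq_iff)
  then show "\<exists>g\<in>carrier (aut_group V E). g \<otimes>\<^bsub>aut_group V E\<^esub> f = \<one>\<^bsub>aut_group V E\<^esub>" using g by blast
next
  fix f g h assume fgh: "f \<in> carrier (aut_group V E)" "g \<in> carrier (aut_group V E)" "h \<in> carrier (aut_group V E)"
  have closed: "compose V f g \<in> carrier (aut_group V E)" if "f \<in> carrier (aut_group V E)" "g \<in> carrier (aut_group V E)" for f g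
    using that aut_restrict[OF aut_comp[of f g]] by (simp add: carrier_aut_group compose_def comp_def)
  show "f \<otimes>\<^bsub>aut_group V E\<^esub> g \<otimes>\<^bsub>aut_group V E\<^esub> h = f \<otimes>\<^bsub>aut_group V E\<^esub> (g \<otimes>\<^bsub>aut_group V E\<^esub> h)"
    using fgh closed aut_in[of h] by (auto simp: mult_aut_group compose_def carrier_aut_group fun_eq_iff)
qed

end

section \<open>Matrices of determinant one over the residues\<close>

context
  fixes p :: nat
  assumes prime: "Factorial_Ring.prime p"
begin

abbreviation (input) SLp where "SLp \<equiv> SL2 (residue_ring (int p))"

lemma residues_p: "residues (int p)"
  using prime_gt_1_nat[OF prime] by unfold_locales simp

lemma carrier_SL2:
  "(a, b, c, d) \<in> carrier SLp \<longleftrightarrow> {a, b, c, d} \<subseteq> {0..<int p} \<and> [a * d - b * c = 1] (mod int p)"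
proof -
  interpret residues "int p" "residue_ring (int p)" by (rule residues_p) simp
  have p1: "1 < int p" using prime_gt_1_nat[OF prime] by simp
  have "x \<ominus>\<^bsub>residue_ring (int p)\<^esub> y = (x - y) mod int p" for x y
    by (simp add: a_minus_def res_neg_eq res_add_eq mod_simps)
  then have "(a \<otimes>\<^bsub>residue_ring (int p)\<^esub> d) \<ominus>\<^bsub>residue_ring (int p)\<^esub> (b \<otimes>\<^bsub>residue_ring (int p)\<^esub> c) = (a * d - b * c) mod int p"
    by (simp add: res_mult_eq mod_simps)
  then show ?thesis using p1 by (auto simp: SL2_def res_carrier_eq res_one_eq cong_def)
qed

lemma mult_SL2:
  "(a, b, c, d) \<otimes>\<^bsub>SLp\<^esub> (a', b', c', d') =
    ((a * a' + b * c') mod int p, (a * b' + b * d') mod int p, (c * a' + d * c') mod int p, (c * b' + d * d') mod int p)"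
  by (simp add: SL2_def residue_ring_def mod_simps)

lemma one_SL2: "\<one>\<^bsub>SLp\<^esub> = (1, 0, 0, 1)"
  by (simp add: SL2_def residue_ring_def)

lemma group_SL2: "group SLp"
proof (rule groupI)
  have p1: "1 < int p" using prime_gt_1_nat[OF prime] by simp
  show "\<one>\<^bsub>SLp\<^esub> \<in> carrier SLp" using p1 by (simp add: one_SL2 carrier_SL2)
  fix x assume "x \<in> carrier SLp"
  then obtain a b c d where x: "x = (a, b, c, d)" "{a, b, c, d} \<subseteq> {0..<int p}" "[a * d - b * c = 1] (mod int p)"
    by (metis carrier_SL2 prod_cases4)
  show "\<one>\<^bsub>SLp\<^esub> \<otimes>\<^bsub>SLp\<^esub> x = x" using x by (simp add: one_SL2 mult_SL2)
  \<comment> \<open>The adjugate matrix, reduced modulo p.\<close>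
  let ?y = "(d mod int p, (- b) mod int p, (- c) mod int p, a mod int p)"
  have "[d mod int p * (a mod int p) - (- b) mod int p * ((- c) mod int p) = d * a - (- b) * (- c)] (mod int p)"
    by (intro cong_diff cong_mult) simp_all
  also have "d * a - (- b) * (- c) = a * d - b * c" by simp
  finally have "?y \<in> carrier SLp" using x(3) p1 cong_trans by (auto simp: carrier_SL2)
  moreover have "?y \<otimes>\<^bsub>SLp\<^esub> x = \<one>\<^bsub>SLp\<^esub>"
  proof -
    have cong: "(u mod int p * x + v mod int p * y) mod int p = (u * x + v * y) mod int p" for u v x y
      unfolding cong_def[symmetric] by (intro cong_add cong_mult) simp_all
    have "(a * d - b * c) mod int p = 1" using x(3) p1 by (simp add: cong_def)
    then show ?thesis unfolding x(1) mult_SL2 one_SL2 cong by (simp add: algebra_simps)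
  qed
  ultimately show "\<exists>y\<in>carrier SLp. y \<otimes>\<^bsub>SLp\<^esub> x = \<one>\<^bsub>SLp\<^esub>" by blast
next
  fix x y assume "x \<in> carrier SLp" "y \<in> carrier SLp"
  then obtain a b c d a' b' c' d' where x: "x = (a, b, c, d)" "[a * d - b * c = 1] (mod int p)"
    and y: "y = (a', b', c', d')" "[a' * d' - b' * c' = 1] (mod int p)"
    by (metis carrier_SL2 prod_cases4)
  have "[(a * a' + b * c') mod int p * ((c * b' + d * d') mod int p) - (a * b' + b * d') mod int p * ((c * a' + d * c') mod int p)
    = (a * a' + b * c') * (c * b' + d * d') - (a * b' + b * d') * (c * a' + d * c')] (mod int p)"
    by (intro cong_diff cong_mult) simp_all
  also have "(a * a' + b * c') * (c * b' + d * d') - (a * b' + b * d') * (c * a' + d * c') = (a * d - b * c) * (a' * d' - b' * c')"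
    by (simp add: algebra_simps)
  also have "[(a * d - b * c) * (a' * d' - b' * c') = 1 * 1] (mod int p)" by (intro cong_mult x y)
  finally show "x \<otimes>\<^bsub>SLp\<^esub> y \<in> carrier SLp"
    unfolding x(1) y(1) mult_SL2 carrier_SL2 using prime_gt_0_nat[OF prime] by simp
next
  fix x y z :: "int \<times> int \<times> int \<times> int"
  obtain a b c d a' b' c' d' a'' b'' c'' d'' where
    "x = (a, b, c, d)" "y = (a', b', c', d')" "z = (a'', b'', c'', d'')" by (metis prod_cases4)
  moreover have "(u mod int p * s + v mod int p * t) mod int p = (u * s + v * t) mod int p"
    "(s * (u mod int p) + t * (v mod int p)) mod int p = (s * u + t * v) mod int p" for u v s t
    unfolding cong_def[symmetric] by (intro cong_add cong_mult; simp)+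
  ultimately show "x \<otimes>\<^bsub>SLp\<^esub> y \<otimes>\<^bsub>SLp\<^esub> z = x \<otimes>\<^bsub>SLp\<^esub> (y \<otimes>\<^bsub>SLp\<^esub> z)"
    by (simp only: mult_SL2) (simp add: algebra_simps)
qed

end

section \<open>The linear action on square classes\<close>

context square_class_coordinates
begin

abbreviation \<chi> :: "int \<Rightarrow> int" where "\<chi> x \<equiv> Legendre x (int p)"

lemmas Legendre_facts = Legendre_cong[OF prime p_gt_2] Legendre_eq_0_iff[OF prime p_gt_2]
  Legendre_values[OF prime p_gt_2] Legendre_mult[OF prime p_gt_2] Legendre_1[OF prime p_gt_2]

lemma prime_int: "Factorial_Ring.prime (int p)"
  using prime by simp

lemma Legendre_nonzero: "\<chi> d = 1 \<or> \<chi> d = - 1 \<Longrightarrow> \<not> int p dvd d"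
  using Legendre_facts(2)[of d] by auto

lemma not_dvd_1: "\<not> int p dvd 1"
  using Legendre_nonzero[of 1] Legendre_facts(5) by simp

lemma exists_inverse: "\<not> int p dvd a \<Longrightarrow> \<exists>b. [a * b = 1] (mod int p)"
  by (rule exists_inverse_mod_prime[OF prime])

definition nz :: "int \<Rightarrow> int \<Rightarrow> bool" where "nz x y \<longleftrightarrow> \<not> (int p dvd x \<and> int p dvd y)"

lemmas \<theta>_in' = \<theta>_in[folded nz_def]
lemmas \<theta>_surj' = \<theta>_surj[folded nz_def]
lemmas \<theta>_E' = \<theta>_E[folded nz_def]
lemmas \<theta>_eq' = \<theta>_eq[folded nz_def]

lemma nz_10: "nz 1 0" "nz 0 1" "nz x 1"
  using not_dvd_1 by (auto simp: nz_def)

lemma nz_cong: "[x = x'] (mod int p) \<Longrightarrow> [y = y'] (mod int p) \<Longrightarrow> nz x y \<longleftrightarrow> nz x' y'"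
  using cong_dvd_iff[of x x' "int p"] cong_dvd_iff[of y y' "int p"] by (simp add: nz_def)

lemma \<theta>_cong:
  assumes "nz x y" "[x = x'] (mod int p)" "[y = y'] (mod int p)"
  shows "\<theta> x y = \<theta> x' y'"
proof -
  have "nz x' y'" using nz_cong assms by blast
  then show ?thesis using \<theta>_eq'[OF assms(1)] assms(2,3) Legendre_facts(5)
    by (intro \<theta>_eq'[THEN iffD2] exI[of _ 1]) (auto simp: assms(1) cong_sym)
qed

lemma nz_scale: "\<not> int p dvd a \<Longrightarrow> nz (a * x) (a * y) \<longleftrightarrow> nz x y"
  using prime_int by (simp add: nz_def prime_dvd_mult_iff)

lemma \<theta>_scale:
  assumes "nz x y" "\<chi> a = 1"
  shows "\<theta> (a * x) (a * y) = \<theta> x y"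
proof -
  have "nz (a * x) (a * y)" using assms nz_scale[of a] Legendre_nonzero by simp
  then have "\<theta> x y = \<theta> (a * x) (a * y)" using \<theta>_eq'[OF assms(1)] assms(2) by auto
  then show ?thesis by simp
qed

definition coords :: "'a \<Rightarrow> int \<times> int" where
  "coords v = (SOME (x, y). nz x y \<and> v = \<theta> x y)"

text \<open>A matrix acts through an arbitrarily chosen representative; \<open>act_\<theta>\<close>
  removes the dependence on the choice. The condition imposed on matrices below is that the
  determinant be a nonzero square, which admits nonsquare scalars as well as
  \<open>SL(2,p)\<close>.\<close>

definition act :: "int \<Rightarrow> int \<Rightarrow> int \<Rightarrow> int \<Rightarrow> 'a \<Rightarrow> 'a" where
  "act a b c d = (\<lambda>v\<in>V. case coords v of (x, y) \<Rightarrow> \<theta> (a * x + b * y) (c * x + d * y))"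

lemma coords_spec:
  assumes "v \<in> V" "coords v = (x, y)"
  shows "nz x y" "v = \<theta> x y"
proof -
  have "\<exists>q. case q of (x, y) \<Rightarrow> nz x y \<and> v = \<theta> x y" using \<theta>_surj'[OF assms(1)] by auto
  then have "case coords v of (x, y) \<Rightarrow> nz x y \<and> v = \<theta> x y" unfolding coords_def by (rule someI_ex)
  then show "nz x y" "v = \<theta> x y" using assms(2) by auto
qed

text \<open>By Cramer's rule, a vector sent to 0 modulo p would be annihilated by the determinant,
  which is a unit.\<close>

lemma nz_act:
  assumes "\<chi> (a * d - b * c) = 1" "nz x y"
  shows "nz (a * x + b * y) (c * x + d * y)"
  unfolding nz_def
proof
  assume *: "int p dvd a * x + b * y \<and> int p dvd c * x + d * y"
  have "(a * d - b * c) * x = d * (a * x + b * y) - b * (c * x + d * y)"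
    "(a * d - b * c) * y = a * (c * x + d * y) - c * (a * x + b * y)" by (simp_all add: algebra_simps)
  then have "int p dvd (a * d - b * c) * x" "int p dvd (a * d - b * c) * y"
    using * by (metis dvd_diff dvd_mult)+
  then show False using assms Legendre_nonzero prime_int by (auto simp: nz_def prime_dvd_mult_iff)
qed

text \<open>Two representatives of a vertex differ by a square factor, which a linear map carries
  along.\<close>

lemma act_\<theta>:
  assumes A: "\<chi> (a * d - b * c) = 1" and xy: "nz x y"
  shows "act a b c d (\<theta> x y) = \<theta> (a * x + b * y) (c * x + d * y)"
proof -
  obtain x' y' where co: "coords (\<theta> x y) = (x', y')" by fastforce
  note spec = coords_spec[OF \<theta>_in'[OF xy] co]
  obtain s where s: "\<chi> s = 1" "[x = s * x'] (mod int p)" "[y = s * y'] (mod int p)"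
    using \<theta>_eq'[OF spec(1) xy] spec(2) by auto
  have "\<theta> (a * x + b * y) (c * x + d * y) = \<theta> (s * (a * x' + b * y')) (s * (c * x' + d * y'))"
  proof (rule \<theta>_cong[OF nz_act[OF A xy]])
    have "[u * x + v * y = u * (s * x') + v * (s * y')] (mod int p)" for u v
      by (intro cong_add cong_mult cong_refl s)
    moreover have "u * (s * x') + v * (s * y') = s * (u * x' + v * y')" for u v by (simp add: algebra_simps)
    ultimately show "[a * x + b * y = s * (a * x' + b * y')] (mod int p)"
      "[c * x + d * y = s * (c * x' + d * y')] (mod int p)" by metis+
  qed
  also have "\<dots> = \<theta> (a * x' + b * y') (c * x' + d * y')"
    by (rule \<theta>_scale[OF nz_act[OF A spec(1)] s(1)])
  finally show ?thesis using co \<theta>_in'[OF xy] by (simp add: act_def)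
qed

text \<open>A matrix multiplies the determinant of two vectors by its own determinant, a square, so
  adjacency is preserved. The adjugate inverts the matrix up to the same square and thus inverts the
  action exactly.\<close>

lemma act_aut:
  assumes A: "\<chi> (a * d - b * c) = 1"
  shows "act a b c d \<in> carrier (aut_group V E)"
proof -
  have A': "\<chi> (d * a - (- b) * (- c)) = 1" using A by (simp add: mult.commute)
  have into: "act a b c d v \<in> V" if A: "\<chi> (a * d - b * c) = 1" and v: "v \<in> V" for a b c d v
  proof -
    obtain x y where "nz x y" "v = \<theta> x y" using \<theta>_surj'[OF v] by blast
    then show ?thesis using act_\<theta>[OF A] nz_act[OF A] \<theta>_in' by simp
  qed
  have left_inv: "act d (- b) (- c) a (act a b c d v) = v"
    if A: "\<chi> (a * d - b * c) = 1" and v: "v \<in> V" for a b c d v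
  proof -
    have A': "\<chi> (d * a - (- b) * (- c)) = 1" using A by (simp add: mult.commute)
    obtain x y where xy: "nz x y" "v = \<theta> x y" using \<theta>_surj'[OF v] by blast
    have "act d (- b) (- c) a (act a b c d v) =
        \<theta> (d * (a * x + b * y) + (- b) * (c * x + d * y)) ((- c) * (a * x + b * y) + a * (c * x + d * y))"
      using xy act_\<theta>[OF A] act_\<theta>[OF A'] nz_act[OF A] by simp
    also have "\<dots> = \<theta> ((a * d - b * c) * x) ((a * d - b * c) * y)" by (simp add: algebra_simps)
    also have "\<dots> = v" using \<theta>_scale[OF xy(1) A] xy(2) by simp
    finally show ?thesis .
  qed
  have "bij_betw (act a b c d) V V"
    by (rule bij_betw_byWitness[where f' = "act d (- b) (- c) a"])
      (use left_inv[OF A] left_inv[OF A'] into[OF A] into[OF A'] in auto)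
  moreover have "E (act a b c d u) (act a b c d v) \<longleftrightarrow> E u v" if uv: "u \<in> V" "v \<in> V" for u v
  proof -
    obtain x y x' y' where xy: "nz x y" "u = \<theta> x y" "nz x' y'" "v = \<theta> x' y'"
      using \<theta>_surj' uv by blast
    have "(a * x + b * y) * (c * x' + d * y') - (c * x + d * y) * (a * x' + b * y') = (a * d - b * c) * (x * y' - y * x')"
      by (simp add: algebra_simps)
    then have "\<chi> ((a * x + b * y) * (c * x' + d * y') - (c * x + d * y) * (a * x' + b * y')) = \<chi> (x * y' - y * x')"
      using A by (simp only: Legendre_facts(4) mult_1)
    then show ?thesis using xy act_\<theta>[OF A] nz_act[OF A] \<theta>_E' by simp
  qed
  moreover have "act a b c d \<in> extensional V" by (simp add: act_def)
  ultimately show ?thesis by (auto simp: aut_group_def Bij_def)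
qed

lemma carrier_eqI:
  assumes f: "f \<in> carrier (aut_group V E)" and g: "g \<in> carrier (aut_group V E)"
    and eq: "\<And>x y. nz x y \<Longrightarrow> f (\<theta> x y) = g (\<theta> x y)"
  shows "f = g"
proof
  fix v
  show "f v = g v"
  proof (cases "v \<in> V")
    case True
    then show ?thesis using \<theta>_surj' eq by metis
  next
    case False
    then show ?thesis using f g by (simp add: carrier_aut_group extensional_def)
  qed
qed

lemma act_mult:
  assumes A: "\<chi> (a * d - b * c) = 1" and B: "\<chi> (a' * d' - b' * c') = 1"
  shows "act a b c d \<otimes>\<^bsub>aut_group V E\<^esub> act a' b' c' d' =
    act (a * a' + b * c') (a * b' + b * d') (c * a' + d * c') (c * b' + d * d')"
    (is "?l = act ?a ?b ?c ?d")
proof -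
  interpret group "aut_group V E" by (rule group_aut_group)
  have "?a * ?d - ?b * ?c = (a * d - b * c) * (a' * d' - b' * c')" by (simp add: algebra_simps)
  then have AB: "\<chi> (?a * ?d - ?b * ?c) = 1" using A B by (simp only: Legendre_facts(4) mult_1)
  show ?thesis
  proof (rule carrier_eqI)
    show "?l \<in> carrier (aut_group V E)" by (intro m_closed act_aut A B)
    show "act ?a ?b ?c ?d \<in> carrier (aut_group V E)" by (rule act_aut[OF AB])
    fix x y assume xy: "nz x y"
    have "?l (\<theta> x y) = act a b c d (act a' b' c' d' (\<theta> x y))"
      using \<theta>_in'[OF xy] by (simp add: mult_aut_group act_aut A B compose_def)
    also have "\<dots> = \<theta> (a * (a' * x + b' * y) + b * (c' * x + d' * y)) (c * (a' * x + b' * y) + d * (c' * x + d' * y))"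
      using act_\<theta>[OF A] act_\<theta>[OF B] nz_act[OF B] xy by simp
    also have "\<dots> = \<theta> (?a * x + ?b * y) (?c * x + ?d * y)" by (simp add: algebra_simps)
    finally show "?l (\<theta> x y) = act ?a ?b ?c ?d (\<theta> x y)" using act_\<theta>[OF AB xy] by simp
  qed
qed

lemma act_cong:
  assumes A: "\<chi> (a * d - b * c) = 1"
    and eq: "[a = a'] (mod int p)" "[b = b'] (mod int p)" "[c = c'] (mod int p)" "[d = d'] (mod int p)"
  shows "act a b c d = act a' b' c' d'"
proof (rule carrier_eqI)
  have "[a * d - b * c = a' * d' - b' * c'] (mod int p)" by (intro cong_diff cong_mult eq)
  then have A': "\<chi> (a' * d' - b' * c') = 1" using A Legendre_facts(1) by metis
  show "act a b c d \<in> carrier (aut_group V E)" "act a' b' c' d' \<in> carrier (aut_group V E)"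
    using act_aut A A' by auto
  fix x y assume xy: "nz x y"
  show "act a b c d (\<theta> x y) = act a' b' c' d' (\<theta> x y)"
    unfolding act_\<theta>[OF A xy] act_\<theta>[OF A' xy]
    by (intro \<theta>_cong[OF nz_act[OF A xy]] cong_add cong_mult eq cong_refl)
qed

lemma act_scalar:
  assumes "\<chi> a = 1 \<or> \<chi> a = - 1" "nz x y"
  shows "act a 0 0 a (\<theta> x y) = \<theta> (a * x) (a * y)"
  using act_\<theta>[of a a 0 0 x y] assms Legendre_facts(4)[of a a] by auto

end

section \<open>The homomorphism from SL(2,p), its kernel, and the stabiliser of a vertex\<close>

context square_class_coordinates
begin

abbreviation SLp where "SLp \<equiv> SL2 (residue_ring (int p))"

abbreviation SL_act :: "int \<times> int \<times> int \<times> int \<Rightarrow> 'a \<Rightarrow> 'a" where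
  "SL_act \<equiv> \<lambda>(a, b, c, d). act a b c d"

lemma p_pos: "0 < int p" "1 < int p"
  using p_gt_2 by auto

lemma det_Legendre: "[a * d - b * c = 1] (mod int p) \<Longrightarrow> \<chi> (a * d - b * c) = 1"
  using Legendre_facts(1)[of _ 1] Legendre_facts(5) by simp

lemma SL_act_carrier: "X \<in> carrier SLp \<Longrightarrow> SL_act X \<in> carrier (aut_group V E)"
  by (cases X) (auto simp: carrier_SL2[OF prime] intro!: act_aut det_Legendre)

lemma SL_act_hom: "group_hom SLp (aut_group V E) SL_act"
proof (intro group_hom.intro group_hom_axioms.intro homI group_SL2 prime group_aut_group)
  fix X Y assume XY: "X \<in> carrier SLp" "Y \<in> carrier SLp"
  obtain a b c d a' b' c' d' where eq: "X = (a, b, c, d)" "Y = (a', b', c', d')" by (metis prod_cases4)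
  have det: "\<chi> (a * d - b * c) = 1" "\<chi> (a' * d' - b' * c') = 1"
    using XY unfolding eq carrier_SL2[OF prime] by (auto intro: det_Legendre)
  let ?a = "a * a' + b * c'" and ?b = "a * b' + b * d'" and ?c = "c * a' + d * c'" and ?d = "c * b' + d * d'"
  have "?a * ?d - ?b * ?c = (a * d - b * c) * (a' * d' - b' * c')" by (simp add: algebra_simps)
  then have "\<chi> (?a * ?d - ?b * ?c) = 1" using det by (simp only: Legendre_facts(4) mult_1)
  then have "act (?a mod int p) (?b mod int p) (?c mod int p) (?d mod int p) = act ?a ?b ?c ?d"
    by (intro act_cong[symmetric]) simp_all
  then show "SL_act (X \<otimes>\<^bsub>SLp\<^esub> Y) = SL_act X \<otimes>\<^bsub>aut_group V E\<^esub> SL_act Y"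
    using act_mult[OF det] by (simp add: eq mult_SL2[OF prime])
qed (rule SL_act_carrier)

lemma act_one: "act 1 0 0 1 = \<one>\<^bsub>aut_group V E\<^esub>"
proof (rule carrier_eqI)
  show "act 1 0 0 1 \<in> carrier (aut_group V E)" by (rule act_aut) (simp add: Legendre_facts(5))
  show "\<one>\<^bsub>aut_group V E\<^esub> \<in> carrier (aut_group V E)"
    using group.is_monoid[OF group_aut_group] by (rule monoid.one_closed)
  show "act 1 0 0 1 (\<theta> x y) = \<one>\<^bsub>aut_group V E\<^esub> (\<theta> x y)" if "nz x y" for x y
    using that act_scalar[of 1 x y] \<theta>_in' by (simp add: one_aut_group Legendre_facts(5))
qed

text \<open>The solutions are 1 and -1, and -1 is a square. Hence scalar matrices of determinant one
  act trivially.\<close>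

lemma square_eq_1_Legendre:
  assumes "[a * a = 1] (mod int p)"
  shows "\<chi> a = 1"
proof -
  have "int p dvd (a - 1) * (a + 1)" using assms by (simp add: cong_iff_dvd_diff algebra_simps)
  then have "int p dvd a - 1 \<or> int p dvd a + 1" using prime_int by (simp add: prime_dvd_mult_iff)
  then have "[a = 1] (mod int p) \<or> [a = - 1] (mod int p)" by (simp add: cong_iff_dvd_diff)
  then show ?thesis using Legendre_facts(1,5) Legendre_minus_one by metis
qed

text \<open>The vectors (1, 0), (0, 1) and (1, 1) are all eigenvectors, so the matrix is scalar,
  with entry 1 or -1 by its determinant. As e differs from this entry by a square factor, it is a
  square. The case e = 1 yields the kernel; for a nonresidue e the hypotheses conflict, so the
  antipodal map is not in the image.\<close>

lemma act_eq_scalar_imp: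
  assumes det: "[a * d - b * c = 1] (mod int p)" and e: "\<chi> e = 1 \<or> \<chi> e = - 1"
    and eq: "act a b c d = act e 0 0 e"
  shows "int p dvd b" "int p dvd c" "[a = d] (mod int p)" "\<chi> e = 1"
proof -
  have A: "\<chi> (a * d - b * c) = 1" by (rule det_Legendre[OF det])
  have val: "\<exists>t. \<chi> t = 1 \<and> [e * x = t * (a * x + b * y)] (mod int p) \<and> [e * y = t * (c * x + d * y)] (mod int p)"
    if xy: "nz x y" for x y
  proof -
    have "\<theta> (a * x + b * y) (c * x + d * y) = \<theta> (e * x) (e * y)"
      using act_\<theta>[OF A xy] act_scalar[OF e xy] eq by simp
    then show ?thesis using \<theta>_eq'[OF nz_act[OF A xy]] nz_scale[of e] xy e Legendre_nonzero by simp
  qed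
  have unit: "int p dvd x" if "\<chi> t = 1" "[0 = t * x] (mod int p)" for t x
  proof -
    have "int p dvd t * x" using that(2) by (simp add: cong_sym_eq[of 0] cong_0_iff)
    then show ?thesis using that(1) Legendre_nonzero prime_int by (auto simp: prime_dvd_mult_iff)
  qed
  obtain t where t: "\<chi> t = 1" "[e = t * a] (mod int p)" "[0 = t * c] (mod int p)"
    using val[OF nz_10(1)] by auto
  show c: "int p dvd c" using unit t(1,3) .
  obtain s where s: "\<chi> s = 1" "[0 = s * b] (mod int p)" using val[OF nz_10(2)] by auto
  show b: "int p dvd b" using unit s .
  obtain u where u: "\<chi> u = 1" "[e = u * (a + b)] (mod int p)" "[e = u * (c + d)] (mod int p)"
    using val[OF nz_10(3)[of 1]] by auto
  have "[u * (a + b) = u * (c + d)] (mod int p)" using u(2,3) cong_sym cong_trans by blast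
  then have "int p dvd u * ((a + b) - (c + d))" by (simp add: cong_iff_dvd_diff right_diff_distrib)
  then have "int p dvd (a + b) - (c + d)"
    using u(1) Legendre_nonzero prime_int by (auto simp: prime_dvd_mult_iff)
  then have "int p dvd ((a + b) - (c + d)) + (c - b)" by (rule dvd_add) (rule dvd_diff[OF c b])
  then show ad: "[a = d] (mod int p)" by (simp add: cong_iff_dvd_diff)
  have b0: "[0 = b] (mod int p)" using b by (simp add: cong_iff_dvd_diff)
  have "[a * a - 0 * c = a * d - b * c] (mod int p)"
    by (intro cong_diff cong_mult cong_refl ad b0)
  then have "[a * a = a * d - b * c] (mod int p)" by simp
  then have "\<chi> a = 1" using det cong_trans square_eq_1_Legendre by blast
  then show "\<chi> e = 1" using t Legendre_facts(1)[OF t(2)] by (simp add: Legendre_facts(4))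
qed

text \<open>\<open>PSL2\<close> is the quotient by the centre, whereas the homomorphism theorem
  divides by the kernel. Both consist of the scalar matrices.\<close>

lemma kernel_SL_act: "kernel SLp (aut_group V E) SL_act = group_center SLp"
proof (intro subset_antisym subsetI)
  fix X assume X: "X \<in> kernel SLp (aut_group V E) SL_act"
  obtain a b c d where eq: "X = (a, b, c, d)" by (rule prod_cases4)
  have XS: "X \<in> carrier SLp" and one: "act a b c d = act 1 0 0 1"
    using X by (auto simp: kernel_def eq act_one)
  have mem: "{a, b, c, d} \<subseteq> {0..<int p}" "[a * d - b * c = 1] (mod int p)"
    using XS unfolding eq carrier_SL2[OF prime] by auto
  have "int p dvd b" "int p dvd c" "[a = d] (mod int p)"
    using act_eq_scalar_imp[OF mem(2) _ one] Legendre_facts(5) by auto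
  then have "b = 0" "c = 0" "a = d" using mem(1) by (auto simp: cong_def dest: zdvd_imp_le intro: ccontr)
  then show "X \<in> group_center SLp"
    using XS by (auto simp: group_center_def eq mult_SL2[OF prime] mult.commute)
next
  fix X assume X: "X \<in> group_center SLp"
  obtain a b c d where eq: "X = (a, b, c, d)" by (rule prod_cases4)
  have XS: "X \<in> carrier SLp" and comm: "\<And>Y. Y \<in> carrier SLp \<Longrightarrow> X \<otimes>\<^bsub>SLp\<^esub> Y = Y \<otimes>\<^bsub>SLp\<^esub> X"
    using X by (auto simp: group_center_def)
  have mem: "{a, b, c, d} \<subseteq> {0..<int p}" "[a * d - b * c = 1] (mod int p)"
    using XS unfolding eq carrier_SL2[OF prime] by auto
  \<comment> \<open>Commuting with the two elementary transvections already forces a matrix to be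
    scalar.\<close>
  have "(1, 1, 0, 1) \<in> carrier SLp" "(1, 0, 1, 1) \<in> carrier SLp"
    using p_pos by (simp_all add: carrier_SL2[OF prime])
  from comm[OF this(1)] comm[OF this(2)]
  have "[a = a + c] (mod int p)" "[a + b = b + d] (mod int p)" "[a + b = a] (mod int p)"
    by (simp_all add: eq mult_SL2[OF prime] cong_def add.commute)
  then have bc: "[c = 0] (mod int p)" "[a = d] (mod int p)" "[b = 0] (mod int p)"
    by (simp_all add: cong_iff_dvd_diff)
  have A: "\<chi> (a * d - b * c) = 1" by (rule det_Legendre[OF mem(2)])
  have act: "act a b c d = act a 0 0 a"
    by (rule act_cong[OF A]) (use bc cong_sym in auto)
  have "[a * a - 0 * c = a * d - b * c] (mod int p)"
    by (intro cong_diff cong_mult cong_refl bc(2) cong_sym[OF bc(3)])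
  then have "\<chi> a = 1" using mem(2) cong_trans square_eq_1_Legendre by fastforce
  then have "act a 0 0 a = act 1 0 0 1"
    using Legendre_facts(4)[of a a] Legendre_facts(5)
    by (intro carrier_eqI act_aut) (simp_all add: act_scalar \<theta>_scale)
  then show "X \<in> kernel SLp (aut_group V E) SL_act" using XS act by (simp add: kernel_def eq act_one)
qed

lemma neighbour_10: "E (\<theta> 1 0) v \<longleftrightarrow> (\<exists>i. v = \<theta> i 1)"
proof
  assume E: "E (\<theta> 1 0) v"
  obtain x y where xy: "nz x y" "v = \<theta> x y" using \<theta>_surj' E_dom[OF E] by blast
  then have y: "\<chi> y = 1" using E \<theta>_E'[OF nz_10(1) xy(1)] by simp
  obtain z where z: "[y * z = 1] (mod int p)" using exists_inverse Legendre_nonzero y by blast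
  have "\<theta> (y * (x * z)) (y * 1) = \<theta> (x * z) 1" by (rule \<theta>_scale[OF nz_10(3) y])
  moreover have "\<theta> x y = \<theta> (y * (x * z)) (y * 1)"
    using cong_mult[OF cong_refl[of x] z] by (intro \<theta>_cong[OF xy(1)]) (simp_all add: ac_simps cong_sym)
  ultimately show "\<exists>i. v = \<theta> i 1" using xy(2) by auto
next
  assume "\<exists>i. v = \<theta> i 1"
  then show "E (\<theta> 1 0) v" using \<theta>_E'[OF nz_10(1) nz_10(3)] Legendre_facts(5) by auto
qed

lemma label_eq: "\<theta> i 1 = \<theta> j 1 \<longleftrightarrow> [i = j] (mod int p)"
proof
  assume "\<theta> i 1 = \<theta> j 1"
  then obtain a where a: "[j = a * i] (mod int p)" "[1 = a] (mod int p)"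
    using \<theta>_eq'[OF nz_10(3) nz_10(3)] by auto
  have "[a * i = 1 * i] (mod int p)" by (intro cong_mult cong_refl cong_sym[OF a(2)])
  then show "[i = j] (mod int p)" using a(1) cong_sym cong_trans by (metis mult_1)
qed (intro \<theta>_cong nz_10 cong_refl)

lemma E_label: "E (\<theta> i 1) (\<theta> j 1) \<longleftrightarrow> \<chi> (i - j) = 1"
  using \<theta>_E'[OF nz_10(3) nz_10(3)] by simp

lemma obtain_nonresidue: obtains e where "\<chi> e = - 1"
  using exists_nonresidue[OF prime p_gt_2] by blast

text \<open>The neighbours of \<open>\<theta> 1 0\<close> carry the Paley graph, so Burnside's
  theorem applies to the labels i of \<open>\<theta> i 1\<close>. The multiplier is a residue
  because the labels 0 and 1 are adjacent and have adjacent images.\<close>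

lemma stabilizer_affine:
  assumes g: "aut g" "g (\<theta> 1 0) = \<theta> 1 0"
  obtains a b where "\<chi> a = 1" "\<And>i. g (\<theta> i 1) = \<theta> (a * i + b) 1"
proof -
  have "\<forall>i. \<exists>j. g (\<theta> i 1) = \<theta> j 1"
    using aut_E[OF g(1), of "\<theta> 1 0"] g(2) \<theta>_in' nz_10 neighbour_10 by metis
  then obtain \<pi> where \<pi>: "\<And>i. g (\<theta> i 1) = \<theta> (\<pi> i) 1" by metis
  define U where "U = {d \<in> {1..<int p}. \<chi> d = 1}"
  have U_iff: "d mod int p \<in> U \<longleftrightarrow> \<chi> d = 1" for d
  proof -
    have "\<chi> (d mod int p) = \<chi> d" by (rule Legendre_facts(1)) simp
    moreover have "1 \<le> d mod int p" if d: "\<chi> d = 1"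
    proof -
      have "d mod int p \<noteq> 0"
        using Legendre_nonzero[OF disjI1[OF d]] unfolding dvd_eq_mod_eq_0 .
      moreover have "0 \<le> d mod int p" using p_pos by simp
      ultimately show ?thesis by linarith
    qed
    moreover have "d mod int p < int p" using p_pos by simp
    ultimately show ?thesis unfolding U_def by auto
  qed
  have pres: "\<chi> (\<pi> y - \<pi> x) = 1 \<longleftrightarrow> \<chi> (y - x) = 1" for x y
    using aut_E[OF g(1) \<theta>_in'[OF nz_10(3)] \<theta>_in'[OF nz_10(3)], of y x] by (simp add: \<pi> E_label)
  have "\<exists>a b. \<forall>x. [\<pi> x = a * x + b] (mod int p)"
  proof (rule connection_set_preserving_imp_affine[OF prime])
    show "U \<subseteq> {1..<int p}" by (auto simp: U_def)
    show "U \<noteq> {}" using U_iff[of 1] Legendre_facts(5) by auto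
    obtain e where "\<chi> e = - 1" using obtain_nonresidue .
    then have "e mod int p \<notin> U" "\<chi> (e mod int p) = - 1"
      using U_iff[of e] Legendre_facts(1)[of "e mod int p" e] by auto
    moreover have "e mod int p \<noteq> 0" using calculation(2) Legendre_facts(2)[of 0] by (metis dvd_0_right zero_neq_neg_one)
    moreover have "0 \<le> e mod int p" "e mod int p < int p" using p_pos by simp_all
    ultimately have "e mod int p \<notin> U" "e mod int p \<in> {1..<int p}"
      unfolding atLeastLessThan_iff by linarith+
    then show "U \<noteq> {1..<int p}" by blast
    show "int p - u \<in> U" if "u \<in> U" for u
    proof -
      have "\<chi> (int p - u) = \<chi> (- u)" by (rule Legendre_facts(1)) (simp add: cong_iff_dvd_diff)
      then show ?thesis using that Legendre_minus[OF prime p_gt_2 Legendre_minus_one, of u] by (auto simp: U_def)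
    qed
    show "[\<pi> x = \<pi> y] (mod int p) \<longleftrightarrow> [x = y] (mod int p)" for x y
      using aut_eq[OF g(1) \<theta>_in'[OF nz_10(3)] \<theta>_in'[OF nz_10(3)], of x y] by (simp add: \<pi> label_eq)
    show "(\<pi> y - \<pi> x) mod int p \<in> U \<longleftrightarrow> (y - x) mod int p \<in> U" for x y
      by (simp add: U_iff pres)
  qed
  then obtain a b where ab: "\<And>x. [\<pi> x = a * x + b] (mod int p)" by blast
  have "\<chi> (\<pi> 1 - \<pi> 0) = 1" using pres[of 1 0] Legendre_facts(5) by simp
  moreover have "[\<pi> 1 - \<pi> 0 = (a * 1 + b) - (a * 0 + b)] (mod int p)" by (intro cong_diff ab)
  ultimately have "\<chi> a = 1" using Legendre_facts(1) by fastforce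
  moreover have "g (\<theta> i 1) = \<theta> (a * i + b) 1" for i using \<pi> ab label_eq by simp
  ultimately show ?thesis using that by blast
qed

lemma neighbour_label_iff: "nz x y \<Longrightarrow> E (\<theta> i 1) (\<theta> x y) \<longleftrightarrow> \<chi> (i * y - x) = 1"
  using \<theta>_E'[OF nz_10(3)] by simp

text \<open>A vertex is recognised by its adjacencies to the fixed vertices. Neighbours of
  \<open>\<theta> 1 0\<close> are fixed by assumption; on the axis y = 0 the pattern on the labels
  is everything or nothing; for the remaining vertices it is a translate of the nonresidues, which
  determines its shift.\<close>

lemma rigid:
  assumes f: "aut f" "f (\<theta> 1 0) = \<theta> 1 0" "\<And>i. f (\<theta> i 1) = \<theta> i 1" and v: "v \<in> V"
  shows "f v = v"
proof -
  obtain x y where xy: "nz x y" "v = \<theta> x y" using \<theta>_surj'[OF v] by blast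
  obtain x' y' where xy': "nz x' y'" "f v = \<theta> x' y'" using \<theta>_surj'[OF aut_in[OF f(1) v]] by blast
  have pat: "\<chi> (i * y - x) = 1 \<longleftrightarrow> \<chi> (i * y' - x') = 1" for i
    using aut_E[OF f(1) \<theta>_in'[OF nz_10(3)] v, of i] f(3) xy xy' neighbour_label_iff by simp
  have up: "\<chi> y = 1 \<longleftrightarrow> \<chi> y' = 1"
    using aut_E[OF f(1) \<theta>_in'[OF nz_10(1)] v] f(2) xy xy' \<theta>_E'[OF nz_10(1)] by simp
  have all_or_none: "\<chi> (i * y - x) = \<chi> x" if "int p dvd y" for i x y
  proof -
    have "\<chi> (i * y - x) = \<chi> (- x)" using that by (intro Legendre_facts(1)) (simp add: cong_iff_dvd_diff)
    then show ?thesis using Legendre_minus[OF prime p_gt_2 Legendre_minus_one, of x] by simp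
  qed
  have pattern: "\<exists>k. [y * k = x] (mod int p) \<and> (\<forall>i. \<chi> (i * y - x) = 1 \<longleftrightarrow> \<chi> (i - k) = - 1)"
    if y: "\<chi> y = - 1" for x y
  proof -
    obtain b where b: "[y * b = 1] (mod int p)" using exists_inverse Legendre_nonzero y by blast
    have k: "[y * (b * x) = x] (mod int p)" using cong_mult[OF b cong_refl[of x]] by (simp add: mult.assoc)
    have "\<chi> (i * y - x) = - \<chi> (i - b * x)" for i
    proof -
      have "\<chi> (i * y - x) = \<chi> (i * y - y * (b * x))"
        by (intro Legendre_facts(1) cong_diff cong_refl cong_sym[OF k])
      also have "i * y - y * (b * x) = y * (i - b * x)" by (simp add: algebra_simps)
      finally show ?thesis using y by (simp add: Legendre_facts(4))
    qed
    then show ?thesis using k by (intro exI[of _ "b * x"]) auto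
  qed
  \<comment> \<open>A constant pattern is never a translate of the nonresidues: the translate by k
    contains e + k, for a nonresidue e, but not 1 + k.\<close>
  have mixed: False if "int p dvd y1" "\<chi> y2 = - 1" "\<And>i. \<chi> (i * y1 - x1) = 1 \<longleftrightarrow> \<chi> (i * y2 - x2) = 1" for x1 y1 x2 y2
  proof -
    obtain k where k: "\<And>i. \<chi> (i * y2 - x2) = 1 \<longleftrightarrow> \<chi> (i - k) = - 1" using pattern \<open>\<chi> y2 = - 1\<close> by blast
    obtain e where "\<chi> e = - 1" using obtain_nonresidue .
    then show False using k[of "e + k"] k[of "1 + k"] that(3) all_or_none[OF that(1)] Legendre_facts(5) by fastforce
  qed
  consider "\<chi> y = 1" | "int p dvd y" "int p dvd y'" | "\<chi> y = - 1" "\<chi> y' = - 1"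
    using up mixed[of y y' x x', OF _ _ pat] mixed[of y' y x' x, OF _ _ pat[symmetric]]
      Legendre_facts(2,3)[of y] Legendre_facts(2,3)[of y'] by auto
  then show ?thesis
  proof cases
    case 1
    then have "E (\<theta> 1 0) v" using \<theta>_E'[OF nz_10(1) xy(1)] xy(2) by simp
    then show ?thesis using neighbour_10 f(3) by auto
  next
    case 2
    have on_axis: "\<theta> x y = \<theta> 1 0" if "nz x y" "int p dvd y" "\<chi> x = 1" for x y
      using that \<theta>_scale[OF nz_10(1) that(3)] by (metis \<theta>_cong cong_0_iff cong_refl mult.right_neutral mult_zero_right)
    have axis_eq: "\<theta> x y = \<theta> x' y'"
      if "nz x y" "nz x' y'" "int p dvd y" "int p dvd y'" "\<chi> x = - 1" "\<chi> x' = - 1"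
    proof -
      have nx: "\<not> int p dvd x" using that Legendre_nonzero by blast
      obtain b where b: "[x * b = 1] (mod int p)" using exists_inverse[OF nx] by blast
      have "\<chi> (x' * b) = 1" using Legendre_inverse[OF prime p_gt_2 b] that by (simp add: Legendre_facts(4))
      moreover have "[x' = x' * b * x] (mod int p)"
        using cong_mult[OF cong_refl[of x'] b] by (simp add: ac_simps cong_sym)
      moreover have "[y' = x' * b * y] (mod int p)" using that by (simp add: cong_iff_dvd_diff)
      ultimately show ?thesis using \<theta>_eq'[OF that(1,2)] by blast
    qed
    have nx: "\<not> int p dvd x" "\<not> int p dvd x'" using xy(1) xy'(1) 2 by (auto simp: nz_def)
    have "\<chi> x = 1 \<longleftrightarrow> \<chi> x' = 1" using pat[of 0] all_or_none[OF 2(1), of 0 x] all_or_none[OF 2(2), of 0 x'] by simp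
    then show ?thesis
      using on_axis[OF xy(1) 2(1)] on_axis[OF xy'(1) 2(2)] axis_eq[OF xy(1) xy'(1) 2] xy(2) xy'(2)
        nx Legendre_facts(2,3)[of x] Legendre_facts(2,3)[of x'] by metis
  next
    case 3
    obtain k where k: "[y * k = x] (mod int p)" "\<And>i. \<chi> (i * y - x) = 1 \<longleftrightarrow> \<chi> (i - k) = - 1"
      using pattern[OF 3(1)] by blast
    obtain k' where k': "[y' * k' = x'] (mod int p)" "\<And>i. \<chi> (i * y' - x') = 1 \<longleftrightarrow> \<chi> (i - k') = - 1"
      using pattern[OF 3(2)] by blast
    have "\<chi> (i - (k' - k)) = - 1 \<longleftrightarrow> \<chi> i = - 1" for i
      using pat[of "i + k"] k(2)[of "i + k"] k'(2)[of "i + k"] by (simp add: algebra_simps)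
    then have kk: "[k' = k] (mod int p)"
      using Legendre_class_determines_shift[OF prime p_gt_2 Legendre_minus_one] by (simp add: cong_iff_dvd_diff)
    obtain b where b: "[y * b = 1] (mod int p)" using exists_inverse Legendre_nonzero 3(1) by blast
    have "\<chi> (y' * b) = 1" using Legendre_inverse[OF prime p_gt_2 b] 3 by (simp add: Legendre_facts(4))
    moreover have yb: "[y' = y' * b * y] (mod int p)"
      using cong_mult[OF cong_refl[of y'] b] by (simp add: ac_simps cong_sym)
    moreover have "[x' = y' * b * x] (mod int p)"
    proof -
      have "[x' = y' * k] (mod int p)" using k'(1) cong_mult[OF cong_refl[of y'] kk] cong_sym cong_trans by blast
      also have "[y' * k = (y' * b * y) * k] (mod int p)" by (intro cong_mult[OF yb] cong_refl)
      also have "(y' * b * y) * k = y' * b * (y * k)" by simp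
      also have "[y' * b * (y * k) = y' * b * x] (mod int p)" by (intro cong_mult cong_refl k(1))
      finally show ?thesis .
    qed
    ultimately have "\<theta> x y = \<theta> x' y'" using \<theta>_eq'[OF xy(1) xy'(1)] by blast
    then show ?thesis using xy(2) xy'(2) by simp
  qed
qed

end

section \<open>Automorphisms as products of linear and antipodal maps\<close>

context square_class_coordinates
begin

text \<open>The inverse of one automorphism composed with the other fixes
  \<open>\<theta> 1 0\<close> and all its neighbours, so rigidity applies.\<close>

lemma agree_imp_eq:
  assumes f: "f \<in> carrier (aut_group V E)" and g: "g \<in> carrier (aut_group V E)"
    and eq: "f (\<theta> 1 0) = g (\<theta> 1 0)" "\<And>i. f (\<theta> i 1) = g (\<theta> i 1)"
  shows "f = g"
proof (rule carrier_eqI[OF f g])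
  have auts: "aut f" "aut g" using f g by (auto simp: carrier_aut_group)
  have h: "aut (\<lambda>v. inv_into V g (f v))"
    using aut_comp[OF aut_inv[OF auts(2)] auts(1)] by (simp add: comp_def)
  fix x y assume xy: "nz x y"
  have "inv_into V g (f (\<theta> x y)) = \<theta> x y"
    by (rule rigid[OF h]) (simp_all add: eq aut_inv_left[OF auts(2)] \<theta>_in' nz_10 xy)
  moreover have "g (inv_into V g (f (\<theta> x y))) = f (\<theta> x y)"
    using aut_in[OF auts(1) \<theta>_in'[OF xy]] auts(2) by (auto simp: graph_aut_def bij_betw_def f_inv_into_f)
  ultimately show "f (\<theta> x y) = g (\<theta> x y)" by simp
qed

context
  fixes \<epsilon> :: int
  assumes \<epsilon>: "\<chi> \<epsilon> = - 1"
begin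

text \<open>A nonsquare scalar has square determinant, so it acts; it exchanges the two square
  classes on each line. All nonresidues give the same map.\<close>

definition antipode :: "'a \<Rightarrow> 'a" where "antipode = act \<epsilon> 0 0 \<epsilon>"

lemma antipode_carrier: "antipode \<in> carrier (aut_group V E)"
  unfolding antipode_def by (rule act_aut) (simp add: Legendre_facts(4) \<epsilon>)

lemma antipode_\<theta>: "nz x y \<Longrightarrow> antipode (\<theta> x y) = \<theta> (\<epsilon> * x) (\<epsilon> * y)"
  unfolding antipode_def by (rule act_scalar) (use \<epsilon> in auto)

lemma antipode_antipode:
  assumes "v \<in> V"
  shows "antipode (antipode v) = v"
proof -
  obtain x y where xy: "nz x y" "v = \<theta> x y" using \<theta>_surj'[OF assms] by blast
  have "nz (\<epsilon> * x) (\<epsilon> * y)" using xy(1) nz_scale[of \<epsilon>] Legendre_nonzero \<epsilon> by simp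
  then have "antipode (antipode v) = \<theta> (\<epsilon> * \<epsilon> * x) (\<epsilon> * \<epsilon> * y)"
    using xy by (simp add: antipode_\<theta> mult.assoc)
  also have "\<dots> = v" unfolding xy(2) by (rule \<theta>_scale[OF xy(1)]) (simp add: Legendre_facts(4) \<epsilon>)
  finally show ?thesis .
qed

lemma antipode_square: "antipode \<otimes>\<^bsub>aut_group V E\<^esub> antipode = \<one>\<^bsub>aut_group V E\<^esub>"
  unfolding mult_aut_group[OF antipode_carrier antipode_carrier] unfolding one_aut_group
  using antipode_antipode by (auto simp: compose_def fun_eq_iff)

lemma antipode_commute:
  assumes "X \<in> carrier SLp"
  shows "antipode \<otimes>\<^bsub>aut_group V E\<^esub> SL_act X = SL_act X \<otimes>\<^bsub>aut_group V E\<^esub> antipode"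
proof -
  obtain a b c d where eq: "X = (a, b, c, d)" by (rule prod_cases4)
  have det: "\<chi> (a * d - b * c) = 1" "\<chi> (\<epsilon> * \<epsilon> - 0 * 0) = 1"
    using assms by (auto simp: eq carrier_SL2[OF prime] Legendre_facts(4) \<epsilon> intro: det_Legendre)
  show ?thesis
    unfolding eq antipode_def using act_mult[OF det] act_mult[OF det(2,1)] by (simp add: mult.commute)
qed

lemma antipode_not_SL_act:
  assumes "X \<in> carrier SLp"
  shows "SL_act X \<noteq> antipode"
proof
  assume eq: "SL_act X = antipode"
  obtain a b c d where X: "X = (a, b, c, d)" by (rule prod_cases4)
  then have "[a * d - b * c = 1] (mod int p)" "act a b c d = act \<epsilon> 0 0 \<epsilon>"
    using assms eq by (auto simp: carrier_SL2[OF prime] antipode_def)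
  then have "\<chi> \<epsilon> = 1" using act_eq_scalar_imp(4) \<epsilon> by blast
  then show False using \<epsilon> by simp
qed

lemma SL_residues:
  assumes "[a * d - b * c = 1] (mod int p)"
  shows "(a mod int p, b mod int p, c mod int p, d mod int p) \<in> carrier SLp"
    and "SL_act (a mod int p, b mod int p, c mod int p, d mod int p) = act a b c d"
proof -
  have "[a mod int p * (d mod int p) - b mod int p * (c mod int p) = a * d - b * c] (mod int p)"
    by (intro cong_diff cong_mult) simp_all
  then show "(a mod int p, b mod int p, c mod int p, d mod int p) \<in> carrier SLp"
    using assms p_pos cong_trans by (auto simp: carrier_SL2[OF prime])
  have "act a b c d = act (a mod int p) (b mod int p) (c mod int p) (d mod int p)"
    by (intro act_cong det_Legendre assms) simp_all
  then show "SL_act (a mod int p, b mod int p, c mod int p, d mod int p) = act a b c d" by simp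
qed

text \<open>
  The matrix with rows \<open>(s, b / s)\<close> and \<open>(0, 1 / s)\<close> sends the line through \<open>(i, 1)\<close> to that through
  \<open>(s\<^sup>2 i + b, 1)\<close>, but multiplies square classes by that of \<open>s\<close>; the scalar \<open>e\<close> below corrects this.
\<close>

lemma stabilizer_factor:
  assumes k: "k \<in> carrier (aut_group V E)" "k (\<theta> 1 0) = \<theta> 1 0"
  shows "\<exists>X\<in>carrier SLp. k = SL_act X \<or> k = SL_act X \<otimes>\<^bsub>aut_group V E\<^esub> antipode"
proof -
  interpret A: group "aut_group V E" by (rule group_aut_group)
  obtain a b where a: "\<chi> a = 1" and ab: "\<And>i. k (\<theta> i 1) = \<theta> (a * i + b) 1"
    using stabilizer_affine[of k] k by (auto simp: carrier_aut_group)
  obtain s where s: "[a = s ^ 2] (mod int p)" using a Legendre_eq_1_iff[OF prime p_gt_2] by blast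
  have ns: "\<not> int p dvd s"
    using cong_dvd_iff[OF s] Legendre_nonzero a by (auto simp: power2_eq_square)
  obtain s' where s': "[s * s' = 1] (mod int p)" using exists_inverse[OF ns] by blast
  define e where "e = (if \<chi> s = 1 then 1 else \<epsilon>)"
  have se: "\<chi> s * \<chi> e = 1"
    using ns Legendre_facts(2,3)[of s] Legendre_facts(5) \<epsilon> by (auto simp: e_def)
  have s'e: "\<chi> s' * \<chi> e = 1" using se Legendre_inverse[OF prime p_gt_2 s'] by simp
  have "\<chi> e * \<chi> e = 1" using \<epsilon> Legendre_facts(5) by (simp add: e_def)
  then have e2: "\<chi> (e * e - 0 * 0) = 1" by (simp add: Legendre_facts(4))
  have det: "[s * s' - b * s' * 0 = 1] (mod int p)" using s' by simp
  let ?M = "act s (b * s') 0 s' \<otimes>\<^bsub>aut_group V E\<^esub> act e 0 0 e"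
  have "\<chi> (s * e) = 1" "\<chi> (s' * e) = 1" using se s'e by (simp_all add: Legendre_facts(4))
  then have det_M: "\<chi> (s * e * (s' * e) - b * s' * e * 0) = 1" by (simp add: Legendre_facts(4))
  have M: "?M = act (s * e) (b * s' * e) 0 (s' * e)"
    using act_mult[OF det_Legendre[OF det] e2] by simp
  have "k = ?M"
  proof (rule agree_imp_eq[OF k(1)])
    show "?M \<in> carrier (aut_group V E)"
      by (intro A.m_closed act_aut det_Legendre det e2)
    have "?M (\<theta> 1 0) = \<theta> (s * e * 1) (s * e * 0)"
      unfolding M using act_\<theta>[OF det_M nz_10(1)] by simp
    also have "\<dots> = \<theta> 1 0" by (rule \<theta>_scale[OF nz_10(1) \<open>\<chi> (s * e) = 1\<close>])
    finally show "k (\<theta> 1 0) = ?M (\<theta> 1 0)" using k(2) by simp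
    fix i
    have "?M (\<theta> i 1) = \<theta> (s * e * i + b * s' * e * 1) (0 * i + s' * e * 1)"
      unfolding M by (rule act_\<theta>[OF det_M nz_10(3)])
    also have "\<dots> = \<theta> (s' * e * (a * i + b)) (s' * e * 1)"
    proof (rule \<theta>_cong[OF nz_act[OF det_M nz_10(3)]])
      have "[s' * e * (a * i + b) = s' * e * (s ^ 2 * i + b)] (mod int p)"
        by (intro cong_mult cong_add cong_refl s)
      also have "s' * e * (s ^ 2 * i + b) = (s * s') * (s * e * i) + b * s' * e * 1"
        by (simp add: algebra_simps power2_eq_square)
      also have "[(s * s') * (s * e * i) + b * s' * e * 1 = 1 * (s * e * i) + b * s' * e * 1] (mod int p)"
        by (intro cong_mult cong_add cong_refl s')
      finally show "[s * e * i + b * s' * e * 1 = s' * e * (a * i + b)] (mod int p)" by (simp add: cong_sym)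
    qed simp
    also have "\<dots> = \<theta> (a * i + b) 1" by (rule \<theta>_scale[OF nz_10(3) \<open>\<chi> (s' * e) = 1\<close>])
    finally show "k (\<theta> i 1) = ?M (\<theta> i 1)" using ab by simp
  qed
  moreover have "act s (b * s') 0 s' \<in> carrier (aut_group V E)" by (intro act_aut det_Legendre det)
  ultimately have "k = act s (b * s') 0 s' \<or> k = act s (b * s') 0 s' \<otimes>\<^bsub>aut_group V E\<^esub> antipode"
    by (auto simp: e_def act_one antipode_def)
  then show ?thesis using SL_residues[OF det] by metis
qed

text \<open>\<open>SL(2,p)\<close> is transitive on nonzero vectors, since each is the first column
  of a matrix of determinant one. Composing with the inverse of such a matrix reduces to
  automorphisms fixing \<open>\<theta> 1 0\<close>.\<close>

lemma aut_factor:
  assumes g: "g \<in> carrier (aut_group V E)"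
  shows "\<exists>X\<in>carrier SLp. g = SL_act X \<or> g = SL_act X \<otimes>\<^bsub>aut_group V E\<^esub> antipode"
proof -
  interpret H: group_hom SLp "aut_group V E" SL_act by (rule SL_act_hom)
  have ag: "aut g" using g by (simp add: carrier_aut_group)
  have u: "\<theta> 1 0 \<in> V" by (intro \<theta>_in' nz_10)
  obtain x y where xy: "nz x y" "g (\<theta> 1 0) = \<theta> x y" using \<theta>_surj'[OF aut_in[OF ag u]] by blast
  have "\<exists>b d. [x * d - b * y = 1] (mod int p)"
  proof (cases "int p dvd x")
    case True
    then obtain c where "[y * c = 1] (mod int p)" using xy(1) exists_inverse by (auto simp: nz_def)
    then show ?thesis by (intro exI[of _ "- c"] exI[of _ 0]) (simp add: mult.commute)
  next
    case False
    then obtain c where "[x * c = 1] (mod int p)" using exists_inverse by blast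
    then show ?thesis by (intro exI[of _ 0] exI[of _ c]) simp
  qed
  then obtain b d where det: "[x * d - b * y = 1] (mod int p)" by blast
  obtain X where X: "X \<in> carrier SLp" "SL_act X = act x b y d" using SL_residues[OF det] by blast
  define k where "k = inv\<^bsub>aut_group V E\<^esub> SL_act X \<otimes>\<^bsub>aut_group V E\<^esub> g"
  have XA: "SL_act X \<in> carrier (aut_group V E)" using X(1) by (rule SL_act_carrier)
  have kA: "k \<in> carrier (aut_group V E)" unfolding k_def using XA g by simp
  have gk: "g = SL_act X \<otimes>\<^bsub>aut_group V E\<^esub> k" unfolding k_def using XA g by (simp add: H.H.m_assoc[symmetric])
  have "SL_act X (k (\<theta> 1 0)) = SL_act X (\<theta> 1 0)"
  proof -
    have "SL_act X (k (\<theta> 1 0)) = g (\<theta> 1 0)" using gk u by (simp add: mult_aut_group[OF XA kA] compose_def)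
    also have "\<dots> = SL_act X (\<theta> 1 0)" using X(2) xy(2) act_\<theta>[OF det_Legendre[OF det] nz_10(1)] by simp
    finally show ?thesis .
  qed
  then have "k (\<theta> 1 0) = \<theta> 1 0"
    using aut_eq[of "SL_act X" "k (\<theta> 1 0)" "\<theta> 1 0"] XA kA u aut_in[of k] by (simp add: carrier_aut_group)
  then obtain Y where Y: "Y \<in> carrier SLp" "k = SL_act Y \<or> k = SL_act Y \<otimes>\<^bsub>aut_group V E\<^esub> antipode"
    using stabilizer_factor[OF kA] by blast
  have "SL_act (X \<otimes>\<^bsub>SLp\<^esub> Y) = SL_act X \<otimes>\<^bsub>aut_group V E\<^esub> SL_act Y" using X(1) Y(1) by (rule H.hom_mult)
  then have "g = SL_act (X \<otimes>\<^bsub>SLp\<^esub> Y) \<or> g = SL_act (X \<otimes>\<^bsub>SLp\<^esub> Y) \<otimes>\<^bsub>aut_group V E\<^esub> antipode"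
    using gk Y XA SL_act_carrier[OF Y(1)] antipode_carrier by (auto simp: H.H.m_assoc)
  then show ?thesis using X(1) Y(1) by (intro bexI[of _ "X \<otimes>\<^bsub>SLp\<^esub> Y"]) auto
qed

text \<open>\<open>the_elem\<close> extracts the one value taken on a coset of the kernel. The
  antipodal map has order two, commutes with the linear action and lies outside its image, which
  makes the product map an injective homomorphism; \<open>aut_factor\<close> makes it
  surjective.\<close>

lemma iso_from_PSL2:
  "(\<lambda>(X, k). the_elem (SL_act ` X) \<otimes>\<^bsub>aut_group V E\<^esub> (if k = 0 then \<one>\<^bsub>aut_group V E\<^esub> else antipode))
    \<in> iso (PSL2 p \<times>\<times> integer_mod_group 2) (aut_group V E)"
proof -
  interpret H: group_hom SLp "aut_group V E" SL_act by (rule SL_act_hom)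
  let ?A = "aut_group V E" and ?K = "kernel SLp (aut_group V E) SL_act"
  define G where "G X = the_elem (SL_act ` X)" for X
  define z where "z k = (if k = 0 then \<one>\<^bsub>?A\<^esub> else antipode)" for k :: int
  have PSL: "PSL2 p = SLp Mod ?K" by (simp add: PSL2_def Let_def kernel_SL_act)
  have carrier2: "carrier (integer_mod_group 2) = {0, 1}" by (auto simp: carrier_integer_mod_group)
  have zA: "z k \<in> carrier ?A" for k using antipode_carrier by (simp add: z_def)
  have z_add: "z ((k + l) mod 2) = z k \<otimes>\<^bsub>?A\<^esub> z l" if "k \<in> {0, 1}" "l \<in> {0, 1}" for k l
    using that antipode_square antipode_carrier by (auto simp: z_def)
  have G_coset: "G (?K #>\<^bsub>SLp\<^esub> g) = SL_act g" if g: "g \<in> carrier SLp" for g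
  proof -
    have "SL_act ` (?K #>\<^bsub>SLp\<^esub> g) = {SL_act g}"
    proof (intro subset_antisym subsetI)
      fix y assume "y \<in> SL_act ` (?K #>\<^bsub>SLp\<^esub> g)"
      then obtain h where "h \<in> ?K" "y = SL_act (h \<otimes>\<^bsub>SLp\<^esub> g)" unfolding r_coset_def by blast
      then show "y \<in> {SL_act g}" using g H.hom_mult[of h g] SL_act_carrier[OF g] by (simp add: kernel_def)
    next
      fix y assume "y \<in> {SL_act g}"
      moreover have "\<one>\<^bsub>SLp\<^esub> \<in> ?K" by (simp add: kernel_def)
      ultimately show "y \<in> SL_act ` (?K #>\<^bsub>SLp\<^esub> g)"
        unfolding r_coset_def using g H.G.l_one by force
    qed
    then show ?thesis by (simp add: G_def)
  qed
  have repr: "\<exists>g\<in>carrier SLp. X = ?K #>\<^bsub>SLp\<^esub> g \<and> G X = SL_act g" if "X \<in> carrier (PSL2 p)" for X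
    using that G_coset unfolding PSL carrier_FactGroup by blast
  have GA: "G X \<in> carrier ?A" if X: "X \<in> carrier (PSL2 p)" for X
  proof -
    obtain g where "g \<in> carrier SLp" "G X = SL_act g" using repr[OF X] by blast
    then show ?thesis using SL_act_carrier[of g] by simp
  qed
  have G_mult: "G (X \<otimes>\<^bsub>PSL2 p\<^esub> Y) = G X \<otimes>\<^bsub>?A\<^esub> G Y" if "X \<in> carrier (PSL2 p)" "Y \<in> carrier (PSL2 p)" for X Y
    using H.FactGroup_hom that unfolding PSL G_def by (simp add: hom_def)
  have z_comm: "z k \<otimes>\<^bsub>?A\<^esub> G X = G X \<otimes>\<^bsub>?A\<^esub> z k" if X: "X \<in> carrier (PSL2 p)" for X k
  proof -
    obtain g where "g \<in> carrier SLp" "G X = SL_act g" using repr[OF X] by blast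
    then show ?thesis using antipode_commute[of g] GA[OF X] by (simp add: z_def)
  qed
  have G_inj: "X = Y" if "X \<in> carrier (PSL2 p)" "Y \<in> carrier (PSL2 p)" "G X = G Y" for X Y
    using H.FactGroup_inj_on that unfolding PSL G_def by (meson inj_onD)
  have not_anti: "G X \<otimes>\<^bsub>?A\<^esub> antipode \<noteq> G Y" if XY: "X \<in> carrier (PSL2 p)" "Y \<in> carrier (PSL2 p)" for X Y
  proof
    assume eq: "G X \<otimes>\<^bsub>?A\<^esub> antipode = G Y"
    obtain g h where gh: "g \<in> carrier SLp" "G X = SL_act g" "h \<in> carrier SLp" "G Y = SL_act h"
      using repr XY by blast
    have "antipode = inv\<^bsub>?A\<^esub> SL_act g \<otimes>\<^bsub>?A\<^esub> SL_act h"
      using eq gh SL_act_carrier antipode_carrier by (metis H.H.inv_solve_left)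
    also have "\<dots> = SL_act (inv\<^bsub>SLp\<^esub> g \<otimes>\<^bsub>SLp\<^esub> h)" using gh H.hom_mult[of "inv\<^bsub>SLp\<^esub> g" h] H.hom_inv[of g] by simp
    finally show False using antipode_not_SL_act[of "inv\<^bsub>SLp\<^esub> g \<otimes>\<^bsub>SLp\<^esub> h"] gh by simp
  qed
  have "(\<lambda>(X, k). G X \<otimes>\<^bsub>?A\<^esub> z k) \<in> iso (PSL2 p \<times>\<times> integer_mod_group 2) ?A"
  proof (rule isoI)
    show "(\<lambda>(X, k). G X \<otimes>\<^bsub>?A\<^esub> z k) \<in> hom (PSL2 p \<times>\<times> integer_mod_group 2) ?A"
    proof (rule homI)
      fix x assume "x \<in> carrier (PSL2 p \<times>\<times> integer_mod_group 2)"
      then show "(case x of (X, k) \<Rightarrow> G X \<otimes>\<^bsub>?A\<^esub> z k) \<in> carrier ?A" using GA zA by auto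
    next
      fix x y assume "x \<in> carrier (PSL2 p \<times>\<times> integer_mod_group 2)" "y \<in> carrier (PSL2 p \<times>\<times> integer_mod_group 2)"
      then obtain X k Y l where xy: "x = (X, k)" "y = (Y, l)" "X \<in> carrier (PSL2 p)" "Y \<in> carrier (PSL2 p)"
        "k \<in> {0, 1}" "l \<in> {0, 1}" unfolding carrier_DirProd carrier2 by blast
      have "G X \<otimes>\<^bsub>?A\<^esub> G Y \<otimes>\<^bsub>?A\<^esub> (z k \<otimes>\<^bsub>?A\<^esub> z l) = G X \<otimes>\<^bsub>?A\<^esub> (G Y \<otimes>\<^bsub>?A\<^esub> z k) \<otimes>\<^bsub>?A\<^esub> z l"
        using GA[OF xy(3)] GA[OF xy(4)] zA by (simp add: H.H.m_assoc)
      also have "\<dots> = G X \<otimes>\<^bsub>?A\<^esub> z k \<otimes>\<^bsub>?A\<^esub> (G Y \<otimes>\<^bsub>?A\<^esub> z l)"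
        unfolding z_comm[OF xy(4), of k, symmetric] using GA[OF xy(3)] GA[OF xy(4)] zA by (simp add: H.H.m_assoc)
      finally show "(case x \<otimes>\<^bsub>PSL2 p \<times>\<times> integer_mod_group 2\<^esub> y of (X, k) \<Rightarrow> G X \<otimes>\<^bsub>?A\<^esub> z k) =
          (case x of (X, k) \<Rightarrow> G X \<otimes>\<^bsub>?A\<^esub> z k) \<otimes>\<^bsub>?A\<^esub> (case y of (X, k) \<Rightarrow> G X \<otimes>\<^bsub>?A\<^esub> z k)"
        using G_mult[OF xy(3,4)] z_add[OF xy(5,6)] by (simp add: xy(1,2))
    qed
    show "bij_betw (\<lambda>(X, k). G X \<otimes>\<^bsub>?A\<^esub> z k) (carrier (PSL2 p \<times>\<times> integer_mod_group 2)) (carrier ?A)"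
      unfolding bij_betw_def
    proof
      show "inj_on (\<lambda>(X, k). G X \<otimes>\<^bsub>?A\<^esub> z k) (carrier (PSL2 p \<times>\<times> integer_mod_group 2))"
      proof (rule inj_onI, clarsimp simp: carrier2)
        fix X k Y l
        assume XY: "X \<in> carrier (PSL2 p)" "Y \<in> carrier (PSL2 p)" and kl: "k = 0 \<or> k = 1" "l = 0 \<or> l = 1"
          and eq: "G X \<otimes>\<^bsub>?A\<^esub> z k = G Y \<otimes>\<^bsub>?A\<^esub> z l"
        have "k = l"
          using eq kl not_anti[OF XY] not_anti[OF XY(2,1)] GA[OF XY(1)] GA[OF XY(2)] by (auto simp: z_def)
        moreover then have "G X = G Y" using eq GA[OF XY(1)] GA[OF XY(2)] zA by simp
        ultimately show "X = Y \<and> k = l" using G_inj XY by blast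
      qed
      show "(\<lambda>(X, k). G X \<otimes>\<^bsub>?A\<^esub> z k) ` carrier (PSL2 p \<times>\<times> integer_mod_group 2) = carrier ?A"
      proof (intro subset_antisym subsetI)
        fix g assume "g \<in> carrier ?A"
        then obtain h where h: "h \<in> carrier SLp" "g = SL_act h \<or> g = SL_act h \<otimes>\<^bsub>?A\<^esub> antipode"
          using aut_factor by blast
        have mem: "?K #>\<^bsub>SLp\<^esub> h \<in> carrier (PSL2 p)" unfolding PSL carrier_FactGroup using h(1) by blast
        have "g = G (?K #>\<^bsub>SLp\<^esub> h) \<otimes>\<^bsub>?A\<^esub> z 0 \<or> g = G (?K #>\<^bsub>SLp\<^esub> h) \<otimes>\<^bsub>?A\<^esub> z 1"
          using h SL_act_carrier[OF h(1)] by (auto simp: G_coset z_def)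
        then show "g \<in> (\<lambda>(X, k). G X \<otimes>\<^bsub>?A\<^esub> z k) ` carrier (PSL2 p \<times>\<times> integer_mod_group 2)"
          using mem by (force simp: carrier2)
      qed (use GA zA in auto)
    qed
  qed
  then show ?thesis unfolding G_def z_def .
qed

lemma group_PSL2: "group (PSL2 p)"
proof -
  interpret H: group_hom SLp "aut_group V E" SL_act by (rule SL_act_hom)
  show ?thesis
    using normal.factorgroup_is_group[OF H.normal_kernel] by (simp add: PSL2_def Let_def kernel_SL_act)
qed

theorem aut_group_iso: "aut_group V E \<cong> PSL2 p \<times>\<times> integer_mod_group 2"
  using group.iso_sym[OF DirProd_group[OF group_PSL2 group_integer_mod_group]] iso_from_PSL2
  by (auto simp: is_iso_def)

end

end

section \<open>Distances and fibres\<close>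

context square_class_coordinates
begin

text \<open>A vanishing determinant makes the vectors proportional, and the factor is either a
  square or a nonsquare. So each line carries one antipodal pair.\<close>

lemma \<theta>_proportional:
  assumes "nz x y" "nz x' y'" "int p dvd x * y' - y * x'" "\<chi> \<epsilon> = - 1"
  shows "\<theta> x' y' = \<theta> x y \<or> \<theta> x' y' = antipode \<epsilon> (\<theta> x y)"
proof -
  have det: "[x * y' = y * x'] (mod int p)" using assms(3) by (simp add: cong_iff_dvd_diff)
  have "\<exists>s. [x' = s * x] (mod int p) \<and> [y' = s * y] (mod int p)"
  proof (cases "int p dvd x")
    case True
    then obtain b where b: "[y * b = 1] (mod int p)" using assms(1) exists_inverse by (auto simp: nz_def)
    have "[x' = (y * b) * x'] (mod int p)" using cong_mult[OF b cong_refl[of x']] by (simp add: cong_sym)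
    also have "(y * b) * x' = b * (y * x')" by simp
    also have "[b * (y * x') = b * (x * y')] (mod int p)" by (intro cong_mult cong_refl cong_sym[OF det])
    also have "b * (x * y') = y' * b * x" by simp
    finally show ?thesis using cong_mult[OF cong_refl[of y'] b]
      by (intro exI[of _ "y' * b"]) (simp add: ac_simps cong_sym)
  next
    case False
    then obtain b where b: "[x * b = 1] (mod int p)" using exists_inverse by blast
    have "[y' = (x * b) * y'] (mod int p)" using cong_mult[OF b cong_refl[of y']] by (simp add: cong_sym)
    also have "(x * b) * y' = b * (x * y')" by simp
    also have "[b * (x * y') = b * (y * x')] (mod int p)" by (intro cong_mult cong_refl det)
    also have "b * (y * x') = x' * b * y" by simp
    finally show ?thesis using cong_mult[OF cong_refl[of x'] b]
      by (intro exI[of _ "x' * b"]) (simp add: ac_simps cong_sym)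
  qed
  then obtain s where s: "[x' = s * x] (mod int p)" "[y' = s * y] (mod int p)" by blast
  have ns: "\<not> int p dvd s"
    using assms(2) cong_dvd_iff[OF s(1)] cong_dvd_iff[OF s(2)] by (auto simp: nz_def)
  have eq: "\<theta> x' y' = \<theta> (s * x) (s * y)" by (rule \<theta>_cong[OF assms(2) s])
  consider "\<chi> s = 1" | "\<chi> s = - 1" using Legendre_facts(2,3)[of s] ns by blast
  then show ?thesis
  proof cases
    case 1
    then show ?thesis using eq \<theta>_scale[OF assms(1)] by simp
  next
    case 2
    have n\<epsilon>: "\<not> int p dvd \<epsilon>" using Legendre_nonzero assms(4) by simp
    obtain b where b: "[\<epsilon> * b = 1] (mod int p)" using exists_inverse[OF n\<epsilon>] by blast
    have "\<chi> (s * b) = 1" using Legendre_inverse[OF prime p_gt_2 b] assms(4) 2 by (simp add: Legendre_facts(4))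
    moreover have "[s * w = s * b * (\<epsilon> * w)] (mod int p)" for w
      using cong_mult[OF cong_refl[of "s * w"] b] by (simp add: ac_simps cong_sym)
    ultimately have "\<theta> (\<epsilon> * x) (\<epsilon> * y) = \<theta> (s * x) (s * y)"
      using assms(1) nz_scale n\<epsilon> ns by (intro \<theta>_eq'[THEN iffD2]) auto
    then show ?thesis using eq antipode_\<theta>[OF assms(4,1)] by simp
  qed
qed

context
  fixes \<epsilon> :: int
  assumes \<epsilon>: "\<chi> \<epsilon> = - 1"
begin

abbreviation opp where "opp \<equiv> antipode \<epsilon>"

lemma opp_in: "v \<in> V \<Longrightarrow> opp v \<in> V"
  using antipode_carrier[OF \<epsilon>] aut_in by (simp add: carrier_aut_group)

lemma opp_opp: "v \<in> V \<Longrightarrow> opp (opp v) = v"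
  by (rule antipode_antipode[OF \<epsilon>])

lemma opp_neq:
  assumes "v \<in> V"
  shows "opp v \<noteq> v"
proof
  assume eq: "opp v = v"
  obtain x y where xy: "nz x y" "v = \<theta> x y" using \<theta>_surj'[OF assms] by blast
  have n: "nz (\<epsilon> * x) (\<epsilon> * y)" using xy(1) nz_scale Legendre_nonzero \<epsilon> by simp
  then obtain a where a: "\<chi> a = 1" "[\<epsilon> * x = a * x] (mod int p)" "[\<epsilon> * y = a * y] (mod int p)"
    using eq antipode_\<theta>[OF \<epsilon> xy(1)] \<theta>_eq'[OF xy(1) n] xy(2) by auto
  then have "int p dvd (\<epsilon> - a) * x" "int p dvd (\<epsilon> - a) * y"
    by (simp_all add: cong_iff_dvd_diff left_diff_distrib)
  then have "int p dvd \<epsilon> - a" using xy(1) prime_int by (auto simp: nz_def prime_dvd_mult_iff)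
  then have "\<chi> \<epsilon> = \<chi> a" by (intro Legendre_facts(1)) (simp add: cong_iff_dvd_diff)
  then show False using a \<epsilon> by simp
qed

text \<open>Multiplying one of two vectors by a nonresidue reverses the sign of the symbol of their
  determinant, and that symbol is 0 only on a common line.\<close>

lemma opp_relations:
  assumes uv: "u \<in> V" "v \<in> V"
  shows "\<not> E u (opp u)" and "E u x \<Longrightarrow> \<not> E x (opp u)"
    and "v \<noteq> u \<Longrightarrow> v \<noteq> opp u \<Longrightarrow> E u (opp v) \<longleftrightarrow> \<not> E u v"
    and "v \<noteq> u \<Longrightarrow> v \<noteq> opp u \<Longrightarrow> \<not> E u v \<Longrightarrow> \<exists>x. E u x \<and> E x v"
proof -
  have twist: "E v (opp u) \<longleftrightarrow> \<chi> (x * y' - y * x') = - 1"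
    if xy: "nz x y" "nz x' y'" "u = \<theta> x y" "v = \<theta> x' y'" for u v x y x' y'
  proof -
    have n: "nz (\<epsilon> * x) (\<epsilon> * y)" using xy(1) nz_scale Legendre_nonzero \<epsilon> by simp
    have "x' * (\<epsilon> * y) - y' * (\<epsilon> * x) = \<epsilon> * - (x * y' - y * x')" by (simp add: algebra_simps)
    then have "\<chi> (x' * (\<epsilon> * y) - y' * (\<epsilon> * x)) = - \<chi> (x * y' - y * x')"
      using Legendre_minus[OF prime p_gt_2 Legendre_minus_one, of "x * y' - y * x'"] \<epsilon>
      by (simp only: Legendre_facts(4))
    then show ?thesis using \<theta>_E'[OF xy(2) n] xy antipode_\<theta>[OF \<epsilon> xy(1)] by auto
  qed
  obtain x y x' y' where xy: "nz x y" "u = \<theta> x y" "nz x' y'" "v = \<theta> x' y'" using \<theta>_surj' uv by metis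
  show "\<not> E u (opp u)" using twist[OF xy(1,1,2,2)] Legendre_facts(2)[of 0] by (simp add: mult.commute)
  show "\<not> E w (opp u)" if w: "E u w" for w
  proof -
    obtain s t where st: "nz s t" "w = \<theta> s t" using \<theta>_surj' E_dom[OF w] by blast
    then have "\<chi> (x * t - y * s) = 1" using w \<theta>_E'[OF xy(1) st(1)] xy(2) by simp
    then show ?thesis using twist[OF xy(1) st(1) xy(2) st(2)] by simp
  qed
  assume neq: "v \<noteq> u" "v \<noteq> opp u"
  then have "\<not> int p dvd x * y' - y * x'"
    using \<theta>_proportional[OF xy(1,3) _ \<epsilon>] xy(2,4) by blast
  then have unit: "\<chi> (x * y' - y * x') = 1 \<or> \<chi> (x * y' - y * x') = - 1"
    using Legendre_facts(2,3) by blast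
  have "x' * y - y' * x = - (x * y' - y * x')" by (simp add: algebra_simps)
  then have "\<chi> (x' * y - y' * x) = \<chi> (x * y' - y * x')"
    by (simp only: Legendre_minus[OF prime p_gt_2 Legendre_minus_one])
  then have "E u (opp v) \<longleftrightarrow> \<chi> (x * y' - y * x') = - 1"
    using twist[OF xy(3,1,4,2)] by simp
  then show "E u (opp v) \<longleftrightarrow> \<not> E u v" using unit \<theta>_E'[OF xy(1,3)] xy(2,4) by auto
  assume "\<not> E u v"
  then have d: "\<chi> (x * y' - y * x') = - 1" using unit \<theta>_E'[OF xy(1,3)] xy(2,4) by auto
  \<comment> \<open>The sum of the two vectors, scaled by the nonresidue: its determinants with both
    vectors are \<open>\<epsilon>\<close> times the determinant of the pair, a nonresidue, hence
    residues.\<close>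
  let ?s = "\<epsilon> * (x + x')" and ?t = "\<epsilon> * (y + y')"
  have det: "x * ?t - y * ?s = \<epsilon> * (x * y' - y * x')" "?s * y' - ?t * x' = \<epsilon> * (x * y' - y * x')"
    by (simp_all add: algebra_simps)
  have one: "\<chi> (\<epsilon> * (x * y' - y * x')) = 1" using d \<epsilon> by (simp add: Legendre_facts(4))
  have n: "nz ?s ?t"
  proof (rule ccontr)
    assume "\<not> nz ?s ?t"
    then have "int p dvd ?s" "int p dvd ?t" unfolding nz_def by blast+
    then have "int p dvd x * ?t - y * ?s" using dvd_diff dvd_mult by blast
    then show False using one det(1) Legendre_nonzero by metis
  qed
  then show "\<exists>x. E u x \<and> E x v"
    using \<theta>_E'[OF xy(1) n] \<theta>_E'[OF n xy(3)] det one xy(2,4) by (intro exI[of _ "\<theta> ?s ?t"]) simp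
qed

end

lemma exists_neighbour: "u \<in> V \<Longrightarrow> \<exists>v. E u v"
  using valency[of u] p_gt_2 by (metis Collect_empty_eq card.empty not_less_zero)

text \<open>Equality and adjacency are decided in both graphs by the same conditions on integers, so
  matching equal coordinates is well defined, injective and preserves edges.\<close>

lemma coordinates_iso:
  assumes "square_class_coordinates V' E' p \<theta>'"
  shows "\<exists>f. bij_betw f V V' \<and> (\<forall>u\<in>V. \<forall>v\<in>V. E' (f u) (f v) \<longleftrightarrow> E u v)"
proof -
  interpret B: square_class_coordinates V' E' p \<theta>' by (rule assms)
  define f where "f v = (case coords v of (x, y) \<Rightarrow> \<theta>' x y)" for v
  have \<theta>_iff: "\<theta>' x y = \<theta>' x' y' \<longleftrightarrow> \<theta> x y = \<theta> x' y'" if "nz x y" "nz x' y'" for x y x' y'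
    unfolding \<theta>_eq'[OF that] B.\<theta>_eq'[OF that] by (rule refl)
  have f: "f (\<theta> x y) = \<theta>' x y" if xy: "nz x y" for x y
  proof -
    obtain x' y' where co: "coords (\<theta> x y) = (x', y')" by fastforce
    have "\<theta>' x y = \<theta>' x' y'"
      using coords_spec[OF \<theta>_in'[OF xy] co] \<theta>_iff[OF xy] by blast
    then show ?thesis by (simp add: f_def co)
  qed
  have "bij_betw f V V'"
    unfolding bij_betw_def
  proof
    show "inj_on f V"
    proof (rule inj_onI)
      fix u v assume uv: "u \<in> V" "v \<in> V" "f u = f v"
      then show "u = v" using \<theta>_surj' f \<theta>_iff by metis
    qed
    show "f ` V = V'"
    proof (intro subset_antisym subsetI)
      fix w assume "w \<in> V'"
      then obtain x y where "nz x y" "w = \<theta>' x y" using B.\<theta>_surj' by blast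
      then show "w \<in> f ` V" using f \<theta>_in' by (metis image_eqI)
    next
      fix w assume "w \<in> f ` V"
      then obtain v where v: "v \<in> V" "w = f v" by blast
      obtain x y where "nz x y" "v = \<theta> x y" using \<theta>_surj'[OF v(1)] by blast
      then show "w \<in> V'" using v f B.\<theta>_in' by simp
    qed
  qed
  moreover have "E' (f u) (f v) \<longleftrightarrow> E u v" if uv: "u \<in> V" "v \<in> V" for u v
  proof -
    obtain x y x' y' where "nz x y" "u = \<theta> x y" "nz x' y'" "v = \<theta> x' y'" using \<theta>_surj' uv by metis
    then show ?thesis using \<theta>_E' B.\<theta>_E' f by simp
  qed
  ultimately show ?thesis by blast
qed

end

section \<open>Distances and geodesics of the given digraph\<close>

locale pair_simple_graph = simple_graph "pverts G" "\<lambda>u v. (u, v) \<in> parcs G" for G :: "'a pair_pre_digraph"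
begin

abbreviation E where "E \<equiv> \<lambda>u v. (u, v) \<in> parcs G"

lemma vwalk_singleton: "u \<in> pverts G \<Longrightarrow> vwalk [u] (with_proj G)"
  by (simp add: vwalk_def)

lemma vwalk_Cons: "vwalk (u # v # w) (with_proj G) \<longleftrightarrow> E u v \<and> vwalk (v # w) (with_proj G)"
  using E_dom[of u v] by (auto simp: vwalk_def)

lemma gdist_le:
  assumes "vwalk w (with_proj G)"
  shows "gdist G (hd w) (last w) \<le> length w - 1"
  unfolding gdist_def by (rule Least_le) (use assms in auto)

text \<open>\<open>w0\<close> certifies that v can be reached from u; otherwise the least length
  would be an unspecified number.\<close>

lemma gdist_attained:
  assumes "vwalk w0 (with_proj G)" "hd w0 = u" "last w0 = v"
  obtains w where "vwalk w (with_proj G)" "hd w = u" "last w = v" "length w = Suc (gdist G u v)"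
proof -
  have "\<exists>w. vwalk w (with_proj G) \<and> hd w = u \<and> last w = v \<and> vwalk_length w = gdist G u v"
    unfolding gdist_def by (rule LeastI_ex) (use assms in blast)
  then obtain w where w: "vwalk w (with_proj G)" "hd w = u" "last w = v" "length w - 1 = gdist G u v" by auto
  then have "w \<noteq> []" by (auto simp: vwalk_def)
  then have "length w = Suc (gdist G u v)" using w(4) by (cases w) auto
  then show ?thesis using that w by blast
qed

lemma gdist_lower:
  assumes walk: "vwalk w0 (with_proj G)" "hd w0 = u" "last w0 = v"
  shows "gdist G u v = 0 \<Longrightarrow> u = v" and "gdist G u v = 1 \<Longrightarrow> E u v"
    and "gdist G u v = 2 \<Longrightarrow> \<exists>x. E u x \<and> E x v"
proof -
  obtain w where w: "vwalk w (with_proj G)" "hd w = u" "last w = v" "length w = Suc (gdist G u v)"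
    using gdist_attained[OF walk] .
  show "u = v" if "gdist G u v = 0"
    using w that by (auto simp: length_Suc_conv)
  show "E u v" if "gdist G u v = 1"
    using w that by (auto simp: length_Suc_conv vwalk_Cons)
  show "\<exists>x. E u x \<and> E x v" if "gdist G u v = 2"
    using w that by (auto simp: length_Suc_conv vwalk_Cons numeral_2_eq_2)
qed

lemma gdist_0: "u \<in> pverts G \<Longrightarrow> gdist G u u = 0"
  using gdist_le[OF vwalk_singleton[of u]] by simp

lemma gdist_1:
  assumes "E u v"
  shows "gdist G u v = 1"
proof -
  have w: "vwalk [u, v] (with_proj G)" using assms E_dom by (simp add: vwalk_Cons vwalk_singleton)
  have "gdist G u v \<noteq> 0" using gdist_lower(1)[of "[u, v]" u v] w assms E_irrefl by auto
  moreover have "gdist G u v \<le> 1" using gdist_le[OF w] by simp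
  ultimately show ?thesis by simp
qed

lemma gdist_2:
  assumes "E u x" "E x v" "u \<noteq> v" "\<not> E u v"
  shows "gdist G u v = 2"
proof -
  have w: "vwalk [u, x, v] (with_proj G)" using assms E_dom by (simp add: vwalk_Cons vwalk_singleton)
  have "gdist G u v \<noteq> 0" "gdist G u v \<noteq> 1" using gdist_lower(1,2)[of "[u, x, v]" u v] w assms by auto
  moreover have "gdist G u v \<le> 2" using gdist_le[OF w] by simp
  ultimately show ?thesis by simp
qed

lemma gdist_3:
  assumes "E u x" "E x y" "E y v" "u \<noteq> v" "\<not> E u v" "\<And>x. E u x \<Longrightarrow> \<not> E x v"
  shows "gdist G u v = 3"
proof -
  have w: "vwalk [u, x, y, v] (with_proj G)" using assms E_dom by (simp add: vwalk_Cons vwalk_singleton)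
  have "gdist G u v \<noteq> 0" "gdist G u v \<noteq> 1" "gdist G u v \<noteq> 2" using gdist_lower[of "[u, x, y, v]" u v] w assms by auto
  moreover have "gdist G u v \<le> 3" using gdist_le[OF w] by simp
  ultimately show ?thesis by simp
qed

lemma geodesics_1: "w \<in> geodesics G 1 \<longleftrightarrow> (\<exists>u v. w = [u, v] \<and> E u v)"
  using gdist_1 E_dom E_irrefl
  by (auto simp: geodesics_def vpath_def length_Suc_conv vwalk_Cons vwalk_singleton)

lemma geodesics_2: "w \<in> geodesics G 2 \<longleftrightarrow> (\<exists>u v x. w = [u, v, x] \<and> E u v \<and> E v x \<and> u \<noteq> x \<and> \<not> E u x)"
proof
  assume w: "w \<in> geodesics G 2"
  then obtain u v x where eq: "w = [u, v, x]" by (auto simp: geodesics_def length_Suc_conv numeral_2_eq_2)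
  have "gdist G u x = 2" "E u v" "E v x" "u \<noteq> x"
    using w by (auto simp: geodesics_def eq vpath_def vwalk_Cons)
  moreover then have "\<not> E u x" using gdist_1 by fastforce
  ultimately show "\<exists>u v x. w = [u, v, x] \<and> E u v \<and> E v x \<and> u \<noteq> x \<and> \<not> E u x" using eq by blast
next
  assume "\<exists>u v x. w = [u, v, x] \<and> E u v \<and> E v x \<and> u \<noteq> x \<and> \<not> E u x"
  then obtain u v x where eq: "w = [u, v, x]" and *: "E u v" "E v x" "u \<noteq> x" "\<not> E u x" by blast
  have "gdist G u x = 2" by (rule gdist_2[OF *])
  moreover have "u \<noteq> v" "v \<noteq> x" using * E_irrefl by auto
  ultimately show "w \<in> geodesics G 2"
    using * E_dom by (simp add: geodesics_def eq vpath_def vwalk_Cons vwalk_singleton)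
qed

lemma AutGraph_eq: "AutGraph G = aut_group (pverts G) E"
  by (simp add: AutGraph_def graph_auts_def aut_group_def)

lemma AutGraph_aut: "g \<in> carrier (AutGraph G) \<Longrightarrow> aut g"
  by (simp add: AutGraph_eq carrier_aut_group)

end

lemma pair_graph_imp_pair_simple_graph:
  assumes "pair_graph G"
  shows "pair_simple_graph G"
proof -
  interpret P: pair_graph G by (rule assms)
  show ?thesis
  proof unfold_locales
    show "finite (pverts G)" by (rule P.pair_finite_verts)
    show "u \<in> pverts G \<and> v \<in> pverts G" if "(u, v) \<in> parcs G" for u v
      using that P.in_arcsD1 P.in_arcsD2 by blast
    show "(v, u) \<in> parcs G" if "(u, v) \<in> parcs G" for u v
      using that P.pair_sym_arcs by (simp add: symmetric_def sym_def)
    show "(u, u) \<notin> parcs G" for u using P.no_loops' by blast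
  qed
qed

context pair_simple_graph
begin

lemma connected_closed_subset:
  assumes conn: "Digraph_Component.connected (with_proj G)"
    and S: "S \<subseteq> pverts G" "r \<in> S" "\<And>u v. u \<in> S \<Longrightarrow> E u v \<Longrightarrow> v \<in> S"
  shows "S = pverts G"
proof -
  have "v \<in> S" if "v \<in> pverts G" for v
  proof -
    have "(r, v) \<in> rtrancl_on (pverts G) (symcl (parcs G))"
      using conn S that unfolding connected_conv by auto
    then show ?thesis
    proof (induction rule: rtrancl_on_induct)
      case (step y z)
      then show ?case using S(3) E_sym by (auto simp: symcl_def)
    qed (rule S)
  qed
  then show ?thesis using S(1) by blast
qed

lemma valency_card:
  assumes "has_valency G p" "u \<in> pverts G"
  shows "card {v. E u v} = p"
proof -
  have "out_arcs (with_proj G) u = Pair u ` {v. E u v}" by (auto simp: out_arcs_def)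
  then have "out_degree (with_proj G) u = card {v. E u v}"
    by (simp add: out_degree_def card_image inj_on_def)
  then show ?thesis using assms by (simp add: has_valency_def)
qed

lemma gdist_set: "{gdist G u v | u v. u \<in> pverts G \<and> v \<in> pverts G} = (\<lambda>(u, v). gdist G u v) ` (pverts G \<times> pverts G)"
  by auto

text \<open>Otherwise every vertex together with its neighbours is closed under adjacency and
  exhausts the graph. Applied at one end of a pair realising the diameter, this bounds the diameter
  by 1.\<close>

lemma exists_2_geodesic:
  assumes conn: "Digraph_Component.connected (with_proj G)" and diam: "2 \<le> gdiam G"
  shows "\<exists>u v w. E u v \<and> E v w \<and> u \<noteq> w \<and> \<not> E u w"
proof (rule ccontr)
  assume none: "\<not> ?thesis"
  have "pverts G \<noteq> {}" using conn by (simp add: connected_conv)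
  then have "gdiam G \<in> {gdist G u v | u v. u \<in> pverts G \<and> v \<in> pverts G}"
    unfolding gdiam_def gdist_set by (intro Max_in) (auto simp: finite_V)
  then obtain u v where uv: "u \<in> pverts G" "v \<in> pverts G" "gdiam G = gdist G u v" by blast
  have "insert u {w. E u w} = pverts G"
    by (rule connected_closed_subset[OF conn, of _ u]) (use none uv E_dom in blast)+
  then have "v = u \<or> E u v" using uv by blast
  then show False using uv diam gdist_0[of u] gdist_1[of u v] by auto
qed

lemma two_geodesic_transitive_imp_coordinates:
  assumes conn: "Digraph_Component.connected (with_proj G)" and prime: "Factorial_Ring.prime p"
    and val: "has_valency G p" and geo: "s_geodesic_transitive G 2" and arc: "\<not> s_arc_transitive G 2"
  shows "\<exists>\<theta>. square_class_coordinates (pverts G) E p \<theta>"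
proof -
  have t: "transitive_on_seqs G (geodesics G 1)" "transitive_on_seqs G (geodesics G 2)"
    using geo by (auto simp: s_geodesic_transitive_def)
  have arc_trans: "\<exists>g. aut g \<and> g u = u' \<and> g v = v'" if "E u v" "E u' v'" for u v u' v'
  proof -
    have "[u, v] \<in> geodesics G 1" "[u', v'] \<in> geodesics G 1" using that geodesics_1 by blast+
    then obtain g where "g \<in> carrier (AutGraph G)" "map g [u, v] = [u', v']"
      using t(1) unfolding transitive_on_seqs_def by blast
    then show ?thesis using AutGraph_aut by auto
  qed
  have geo_trans: "\<exists>g. aut g \<and> g u = u' \<and> g v = v' \<and> g w = w'"
    if "E u v" "E v w" "u \<noteq> w" "\<not> E u w" "E u' v'" "E v' w'" "u' \<noteq> w'" "\<not> E u' w'" for u v w u' v' w'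
  proof -
    have "[u, v, w] \<in> geodesics G 2" "[u', v', w'] \<in> geodesics G 2" using that geodesics_2 by blast+
    then obtain g where "g \<in> carrier (AutGraph G)" "map g [u, v, w] = [u', v', w']"
      using t(2) unfolding transitive_on_seqs_def by blast
    then show ?thesis using AutGraph_aut by auto
  qed
  have triangle: "\<exists>u v w. E u v \<and> E v w \<and> E u w"
  proof (rule ccontr)
    assume none: "\<not> ?thesis"
    have "s_arcs G 1 \<subseteq> geodesics G 1"
    proof
      fix w assume "w \<in> s_arcs G 1"
      then show "w \<in> geodesics G 1"
        unfolding geodesics_1 by (auto simp: s_arcs_def length_Suc_conv vwalk_Cons)
    qed
    moreover have "s_arcs G 2 \<subseteq> geodesics G 2"
    proof
      fix w assume w: "w \<in> s_arcs G 2"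
      then have "length w = Suc (Suc (Suc 0))" by (simp add: s_arcs_def)
      then obtain a b c where eq: "w = [a, b, c]" by (auto simp: length_Suc_conv)
      have "E a b" "E b c" "a \<noteq> c" using w by (auto simp: s_arcs_def eq vwalk_Cons)
      then show "w \<in> geodesics G 2" unfolding geodesics_2 using none eq by blast
    qed
    ultimately have "transitive_on_seqs G (s_arcs G 1)" "transitive_on_seqs G (s_arcs G 2)"
      using t unfolding transitive_on_seqs_def by blast+
    moreover have "{1..2} = {1, 2 :: nat}" by auto
    ultimately show False using arc by (simp add: s_arc_transitive_def)
  qed
  have two: "\<exists>u v w. E u v \<and> E v w \<and> u \<noteq> w \<and> \<not> E u w"
    using exists_2_geodesic[OF conn] geo by (simp add: s_geodesic_transitive_def)
  interpret P: prime_geodesic_graph "pverts G" E p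
  proof
    show "Factorial_Ring.prime p" by (rule prime)
    show "card {v. E u v} = p" if "u \<in> pverts G" for u using valency_card[OF val that] .
  qed (fact arc_trans geo_trans triangle two)+
  obtain r where r: "r \<in> pverts G" using conn by (auto simp: connected_conv)
  show ?thesis
    by (rule P.exists_square_class_coordinates[OF r]) (rule connected_closed_subset[OF conn])
qed

end

section \<open>Antipodal structure read off from the coordinates\<close>

locale coordinatized_graph =
  pair_simple_graph G + square_class_coordinates "pverts G" "\<lambda>u v. (u, v) \<in> parcs G" p \<theta>
  for G :: "'a pair_pre_digraph" and p :: nat and \<theta> :: "int \<Rightarrow> int \<Rightarrow> 'a"
begin

lemma exists_vertex: "\<exists>r. r \<in> pverts G"
  using \<theta>_in'[OF nz_10(1)] by blast

text \<open>The vectors (1, 0), (0, 1) and (1, 1) form a triangle; the last two are adjacent because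
  -1 is a square.\<close>

lemma not_bipartite: "\<not> bipartite G"
proof
  assume "bipartite G"
  then obtain U W where UW: "U \<inter> W = {}" "parcs G \<subseteq> U \<times> W \<union> W \<times> U" unfolding bipartite_def by blast
  then have alternate: "a \<in> U \<longleftrightarrow> b \<notin> U" if "E a b" for a b using that by blast
  have "E (\<theta> 1 0) (\<theta> 0 1)" "E (\<theta> 1 0) (\<theta> 1 1)" "E (\<theta> 0 1) (\<theta> 1 1)"
    using neighbour_10[of "\<theta> 0 1"] neighbour_10[of "\<theta> 1 1"] E_label[of 0 1] Legendre_minus_one by auto
  then show False using alternate by metis
qed

context
  fixes \<epsilon> :: int
  assumes \<epsilon>: "\<chi> \<epsilon> = - 1"
begin

lemmas opp_in' = opp_in[OF \<epsilon>]
lemmas opp_opp' = opp_opp[OF \<epsilon>]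
lemmas opp_neq' = opp_neq[OF \<epsilon>]
lemmas opp_rel = opp_relations[OF \<epsilon>]

abbreviation (input) opp' where "opp' \<equiv> antipode \<epsilon>"

text \<open>A neighbour of u and the antipode of u are distinct, nonadjacent and not antipodal, so
  they have a common neighbour, which completes a walk of length 3. A shorter one would make u
  adjacent to its antipode or give the two a common neighbour.\<close>

lemma gdist_opp:
  assumes u: "u \<in> pverts G"
  shows "gdist G u (opp' u) = 3"
proof -
  obtain a where a: "E u a" using exists_neighbour[OF u] by blast
  have aV: "a \<in> pverts G" using E_dom[OF a] by simp
  have "opp' u \<noteq> a" using a opp_rel(1)[OF u u] by metis
  moreover have "opp' u \<noteq> opp' a" using opp_opp'[OF u] opp_opp'[OF aV] a E_irrefl by metis
  moreover have "\<not> E a (opp' u)" using opp_rel(2)[OF u u a] .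
  ultimately obtain x where "E a x" "E x (opp' u)" using opp_rel(4)[OF aV opp_in'[OF u]] by blast
  then show ?thesis
    using gdist_3[OF a] opp_neq'[OF u] opp_rel(1)[OF u u] opp_rel(2)[OF u u] by metis
qed

lemma gdist_cases:
  assumes uv: "u \<in> pverts G" "v \<in> pverts G"
  shows "gdist G u v = (if v = u then 0 else if v = opp' u then 3 else if E u v then 1 else 2)"
  using gdist_0[OF uv(1)] gdist_opp[OF uv(1)] gdist_1[of u v] opp_rel(4)[OF uv] gdist_2[of u _ v] by auto

lemma gdist_eq_3_iff: "u \<in> pverts G \<Longrightarrow> v \<in> pverts G \<Longrightarrow> gdist G u v = 3 \<longleftrightarrow> v = opp' u"
  using gdist_cases[of u v] opp_neq'[of u] by auto

lemma gdiam_eq_3: "gdiam G = 3"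
  unfolding gdiam_def gdist_set
proof (rule Max_eqI)
  show "finite ((\<lambda>(u, v). gdist G u v) ` (pverts G \<times> pverts G))" using finite_V by simp
  show "y \<le> 3" if "y \<in> (\<lambda>(u, v). gdist G u v) ` (pverts G \<times> pverts G)" for y
    using that gdist_cases by auto
  obtain r where r: "r \<in> pverts G" using exists_vertex by blast
  then show "3 \<in> (\<lambda>(u, v). gdist G u v) ` (pverts G \<times> pverts G)"
    using gdist_opp[OF r] opp_in'[OF r] by force
qed

definition fibres :: "'a set set" where "fibres = (\<lambda>u. {u, opp' u}) ` pverts G"

lemma fibre_eq_iff:
  assumes "u \<in> pverts G" "v \<in> pverts G"
  shows "{u, opp' u} = {v, opp' v} \<longleftrightarrow> v = u \<or> v = opp' u"
  using opp_opp'[OF assms(1)] opp_opp'[OF assms(2)] by (auto simp: doubleton_eq_iff)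

lemma antipodal: "antipodal_with_fibres G fibres" if conn: "Digraph_Component.connected (with_proj G)"
proof -
  have "partition_on (pverts G) fibres"
  proof (rule partition_onI)
    show "\<Union> fibres = pverts G" using opp_in' by (auto simp: fibres_def)
    show "disjnt B C" if BC: "B \<in> fibres" "C \<in> fibres" "B \<noteq> C" for B C
    proof -
      obtain u v where uv: "u \<in> pverts G" "v \<in> pverts G" "B = {u, opp' u}" "C = {v, opp' v}"
        using BC(1,2) unfolding fibres_def by blast
      then have "v \<noteq> u" "v \<noteq> opp' u" using BC(3) fibre_eq_iff by auto
      moreover then have "opp' v \<noteq> u" "opp' v \<noteq> opp' u" using opp_opp' uv(1,2) by metis+
      ultimately show ?thesis unfolding uv disjnt_def by auto
    qed
  qed (auto simp: fibres_def)
  moreover have "parcs (distance_graph G 3) = (\<Union>B\<in>fibres. {(u, v). u \<in> B \<and> v \<in> B \<and> u \<noteq> v})"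
  proof -
    have "parcs (distance_graph G 3) = {(u, v). u \<in> pverts G \<and> v = opp' u}"
      using gdist_eq_3_iff opp_in' by (auto simp: distance_graph_def)
    also have "\<dots> = (\<Union>B\<in>fibres. {(u, v). u \<in> B \<and> v \<in> B \<and> u \<noteq> v})"
      using opp_in' opp_opp' opp_neq' by (force simp: fibres_def)
    finally show ?thesis .
  qed
  ultimately show ?thesis
    using conn by (simp add: antipodal_with_fibres_def gdiam_eq_3 disjoint_union_of_complete_def distance_graph_def)
qed

lemma card_fibre: "B \<in> fibres \<Longrightarrow> card B = 2"
  using opp_neq' by (force simp: fibres_def)

lemma unique_neighbour_in_fibre:
  assumes uv: "u \<in> pverts G" "v \<in> pverts G" "{u, opp' u} \<noteq> {v, opp' v}"
  shows "\<exists>!w. w \<in> {v, opp' v} \<and> E u w"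
  using opp_rel(3)[OF uv(1,2)] fibre_eq_iff[OF uv(1,2)] uv(3) by blast

text \<open>Each fibre other than that of a vertex r contains exactly one neighbour of r, so there
  are p of these.\<close>

lemma card_fibres: "card fibres = p + 1"
proof -
  obtain r where r: "r \<in> pverts G" using exists_vertex by blast
  let ?f = "\<lambda>u. {u, opp' u}"
  have NV: "{v. E r v} \<subseteq> pverts G" using E_dom by blast
  have neq: "v \<noteq> r" "v \<noteq> opp' r" if "E r v" for v
    using that E_irrefl opp_rel(1)[OF r r] by auto
  have inj: "inj_on ?f {v. E r v}"
  proof (rule inj_onI)
    fix v w assume vw: "v \<in> {v. E r v}" "w \<in> {v. E r v}" "?f v = ?f w"
    then have V: "v \<in> pverts G" "w \<in> pverts G" using NV by auto
    have "\<not> E r (opp' v)" using opp_rel(3)[OF r V(1)] neq[of v] vw(1) by simp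
    then show "v = w" using fibre_eq_iff[OF V] vw by auto
  qed
  have "fibres = insert (?f r) (?f ` {v. E r v})"
  proof (intro subset_antisym subsetI)
    fix B assume "B \<in> fibres"
    then obtain u where u: "u \<in> pverts G" "B = ?f u" by (auto simp: fibres_def)
    show "B \<in> insert (?f r) (?f ` {v. E r v})"
    proof (cases "?f r = ?f u")
      case False
      then obtain w where "w \<in> ?f u" "E r w" using unique_neighbour_in_fibre[OF r u(1)] by blast
      moreover then have "?f w = ?f u" using opp_opp'[OF u(1)] by auto
      ultimately show ?thesis using u(2) by blast
    qed (use u in simp)
  qed (use r NV in \<open>auto simp: fibres_def\<close>)
  moreover have "?f r \<notin> ?f ` {v. E r v}"
    using neq fibre_eq_iff[OF r] NV by auto
  moreover have "finite {v. E r v}" using finite_subset[OF NV finite_V] .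
  ultimately show ?thesis using card_image[OF inj] valency[OF r] by simp
qed

lemma quotient_complete: "complete_digraph (p + 1) (with_proj (quotient_graph G fibres))"
  unfolding complete_digraph_pair_def
proof (intro conjI)
  show "finite (pverts (quotient_graph G fibres))" using finite_V by (simp add: quotient_graph_def fibres_def)
  show "card (pverts (quotient_graph G fibres)) = p + 1" by (simp add: quotient_graph_def card_fibres)
  have "\<exists>u\<in>B. \<exists>v\<in>C. (u, v) \<in> parcs G" if BC: "B \<in> fibres" "C \<in> fibres" "B \<noteq> C" for B C
  proof -
    obtain u v where "u \<in> pverts G" "v \<in> pverts G" "B = {u, opp' u}" "C = {v, opp' v}"
      using BC(1,2) unfolding fibres_def by blast
    then show ?thesis using unique_neighbour_in_fibre[of u v] BC(3) by blast
  qed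
  then show "parcs (quotient_graph G fibres) =
      {(u, v). (u, v) \<in> pverts (quotient_graph G fibres) \<times> pverts (quotient_graph G fibres) \<and> u \<noteq> v}"
    by (auto simp: quotient_graph_def)
qed

lemma covers: "covers_quotient G fibres"
  unfolding covers_quotient_def
proof (clarify)
  fix B C u assume BC: "(B, C) \<in> parcs (quotient_graph G fibres)" and u: "u \<in> B"
  then have *: "B \<in> fibres" "C \<in> fibres" "B \<noteq> C" by (auto simp: quotient_graph_def)
  obtain b v where bv: "b \<in> pverts G" "v \<in> pverts G" "B = {b, opp' b}" "C = {v, opp' v}"
    using *(1,2) unfolding fibres_def by blast
  have "u \<in> pverts G" "B = {u, opp' u}" using u bv opp_in' opp_opp'[OF bv(1)] by auto
  then show "\<exists>!v. v \<in> C \<and> (u, v) \<in> parcs G"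
    using unique_neighbour_in_fibre[of u v] bv *(3) by simp
qed

text \<open>The antipode of a vertex is the only other vertex that is neither adjacent to it nor
  shares a neighbour with it, a description that automorphisms respect.\<close>

lemma aut_opp:
  assumes g: "aut g" and u: "u \<in> pverts G"
  shows "g (opp' u) = opp' (g u)"
proof (rule ccontr)
  assume neq: "g (opp' u) \<noteq> opp' (g u)"
  have V: "opp' u \<in> pverts G" "g u \<in> pverts G" "g (opp' u) \<in> pverts G"
    using opp_in'[OF u] aut_in[OF g] u by auto
  have "g (opp' u) \<noteq> g u" using aut_eq[OF g V(1) u] opp_neq'[OF u] by simp
  moreover have "\<not> E (g u) (g (opp' u))" using aut_E[OF g u V(1)] opp_rel(1)[OF u u] by simp
  ultimately obtain x where x: "E (g u) x" "E x (g (opp' u))" using opp_rel(4)[OF V(2,3)] neq by blast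
  obtain y where y: "y \<in> pverts G" "g y = x" using aut_surj[OF g] E_dom[OF x(1)] by blast
  then have "E u y" "E y (opp' u)" using x aut_E[OF g u y(1)] aut_E[OF g y(1) V(1)] by auto
  then show False using opp_rel(2)[OF u u] by blast
qed

text \<open>The diameter is 3, and a 3-geodesic is a 2-geodesic followed by the antipode of its
  first vertex. Automorphisms commute with the antipodal map, so transitivity on 2-geodesics carries
  over.\<close>

lemma geodesic_transitiveI:
  assumes "s_geodesic_transitive G 2"
  shows "Defs.geodesic_transitive G"
proof -
  have t: "transitive_on_seqs G (geodesics G 1)" "transitive_on_seqs G (geodesics G 2)"
    using assms by (auto simp: s_geodesic_transitive_def)
  have geodesic_3: "\<exists>a b c. w = [a, b, c, opp' a] \<and> a \<in> pverts G \<and> [a, b, c] \<in> geodesics G 2"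
    if w: "w \<in> geodesics G 3" for w
  proof -
    have "length w = Suc (Suc (Suc (Suc 0)))" using w by (simp add: geodesics_def)
    then obtain a b c d where eq: "w = [a, b, c, d]" by (auto simp: length_Suc_conv)
    have *: "E a b" "E b c" "E c d" "a \<noteq> c" "gdist G a d = 3"
      using w by (auto simp: geodesics_def eq vpath_def vwalk_Cons)
    have V: "a \<in> pverts G" "d \<in> pverts G" using E_dom *(1,3) by blast+
    have "\<not> E a c"
    proof
      assume "E a c"
      then have "vwalk [a, c, d] (with_proj G)" using *(3) V(2) by (simp add: vwalk_Cons vwalk_singleton)
      then show False using gdist_le[of "[a, c, d]"] *(5) by simp
    qed
    then have "[a, b, c] \<in> geodesics G 2" using *(1,2,4) geodesics_2[of "[a, b, c]"] by simp
    moreover have "d = opp' a" using *(5) gdist_eq_3_iff[OF V] by simp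
    ultimately show ?thesis using V(1) eq by simp
  qed
  have "transitive_on_seqs G (geodesics G 3)"
    unfolding transitive_on_seqs_def
  proof (intro ballI)
    fix x y assume "x \<in> geodesics G 3" "y \<in> geodesics G 3"
    then obtain a b c a' b' c' where x: "x = [a, b, c, opp' a]" "a \<in> pverts G" "[a, b, c] \<in> geodesics G 2"
      and y: "y = [a', b', c', opp' a']" "[a', b', c'] \<in> geodesics G 2"
      using geodesic_3 by metis
    obtain g where g: "g \<in> carrier (AutGraph G)" "map g [a, b, c] = [a', b', c']"
      using t(2) x(3) y(2) unfolding transitive_on_seqs_def by blast
    then have "map g x = y" using aut_opp[OF AutGraph_aut[OF g(1)] x(2)] x(1) y(1) by auto
    then show "\<exists>g\<in>carrier (AutGraph G). map g x = y" using g(1) by blast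
  qed
  moreover have "{1..3} = {1, 2, 3 :: nat}" by auto
  ultimately show ?thesis using t by (simp add: geodesic_transitive_def s_geodesic_transitive_def gdiam_eq_3)
qed

end

end

text \<open>An arc of a pair digraph is the pair of its ends, so the arc map has to be
  \<open>f\<close> on both components.\<close>

lemma digraph_iso_of_bij:
  assumes "pair_graph G" "pair_graph H" "bij_betw f (pverts G) (pverts H)"
    and f: "\<And>u v. u \<in> pverts G \<Longrightarrow> v \<in> pverts G \<Longrightarrow> (f u, f v) \<in> parcs H \<longleftrightarrow> (u, v) \<in> parcs G"
  shows "digraph_iso (with_proj G) (with_proj H)"
proof -
  interpret G: pair_graph G by fact
  interpret H: pair_graph H by fact
  let ?m = "map_prod f f"
  let ?hom = "\<lparr>iso_verts = f, iso_arcs = ?m, iso_head = snd, iso_tail = fst\<rparr>"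
  have inj: "inj_on f (pverts G)" "f ` pverts G = pverts H" using assms(3) by (auto simp: bij_betw_def)
  have sub: "parcs G \<subseteq> pverts G \<times> pverts G" "parcs H \<subseteq> pverts H \<times> pverts H"
    using G.in_arcsD1 G.in_arcsD2 H.in_arcsD1 H.in_arcsD2 by auto
  have "inj_on ?m (parcs G)"
    using map_prod_inj_on[OF inj(1) inj(1)] sub(1) inj_on_subset by blast
  then have "pre_digraph.digraph_isomorphism (with_proj G) ?hom"
    using inj G.pair_wf_digraph by (simp add: pre_digraph.digraph_isomorphism_def wf_digraph_wp_iff)
  moreover have "?m ` parcs G = parcs H"
  proof (intro subset_antisym subsetI)
    fix e assume e: "e \<in> parcs H"
    then obtain x y where "e = (x, y)" "x \<in> f ` pverts G" "y \<in> f ` pverts G" using sub(2) inj(2) by auto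
    then obtain u v where "u \<in> pverts G" "v \<in> pverts G" "e = (f u, f v)" by auto
    then show "e \<in> ?m ` parcs G" using f e by force
  qed (use f sub(1) in auto)
  then have "with_proj H = app_iso ?hom (with_proj G)"
    using inj(2) by (simp add: app_iso_def with_proj_def)
  ultimately show ?thesis unfolding digraph_iso_def by blast
qed

theorem theorem1p2:
  fixes \<Gamma> :: "'a pair_pre_digraph" and p :: nat
  assumes "pair_graph \<Gamma>"
    and "Digraph_Component.connected (with_proj \<Gamma>)"
    and "Factorial_Ring.prime p"
    and "has_valency \<Gamma> p"
    and "s_geodesic_transitive \<Gamma> 2"
    and "\<not> s_arc_transitive \<Gamma> 2"
  shows "\<not> bipartite \<Gamma> \<and>
    antipodal_double_cover_complete \<Gamma> (p + 1) \<and>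
    [p = 1] (mod 4) \<and>
    geodesic_transitive \<Gamma> \<and>
    (\<forall>\<Delta> :: 'b pair_pre_digraph.
       pair_graph \<Delta> \<and> Digraph_Component.connected (with_proj \<Delta>) \<and> has_valency \<Delta> p \<and>
       s_geodesic_transitive \<Delta> 2 \<and> \<not> s_arc_transitive \<Delta> 2 \<longrightarrow>
       digraph_iso (with_proj \<Gamma>) (with_proj \<Delta>)) \<and>
    AutGraph \<Gamma> \<cong> PSL2 p \<times>\<times> integer_mod_group 2"
proof -
  interpret P: pair_simple_graph \<Gamma> by (rule pair_graph_imp_pair_simple_graph[OF assms(1)])
  obtain \<theta> where \<theta>: "square_class_coordinates (pverts \<Gamma>) (\<lambda>u v. (u, v) \<in> parcs \<Gamma>) p \<theta>"
    using P.two_geodesic_transitive_imp_coordinates assms(2-6) by blast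
  interpret C: coordinatized_graph \<Gamma> p \<theta>
    by (intro coordinatized_graph.intro \<theta> P.pair_simple_graph_axioms)
  obtain \<epsilon> where \<epsilon>: "Legendre \<epsilon> (int p) = - 1" using C.obtain_nonresidue .
  have "antipodal_double_cover_complete \<Gamma> (p + 1)"
    unfolding antipodal_double_cover_complete_def
    using C.antipodal[OF \<epsilon> assms(2)] C.card_fibre[OF \<epsilon>] C.quotient_complete[OF \<epsilon>] C.covers[OF \<epsilon>] by blast
  moreover have "[p = 1] (mod 4)"
    by (rule Legendre_minus_one_imp_cong_1_mod_4[OF C.prime C.p_gt_2 C.Legendre_minus_one])
  moreover have "digraph_iso (with_proj \<Gamma>) (with_proj \<Delta>)"
    if \<Delta>: "pair_graph \<Delta>" "Digraph_Component.connected (with_proj \<Delta>)" "has_valency \<Delta> p"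
      "s_geodesic_transitive \<Delta> 2" "\<not> s_arc_transitive \<Delta> 2" for \<Delta> :: "'b pair_pre_digraph"
  proof -
    interpret D: pair_simple_graph \<Delta> by (rule pair_graph_imp_pair_simple_graph[OF \<Delta>(1)])
    \<comment> \<open>Coordinates exist for \<Delta> over its own vertex type and with the same p;
      any two graphs with such coordinates are isomorphic.\<close>
    obtain \<theta>' where "square_class_coordinates (pverts \<Delta>) (\<lambda>u v. (u, v) \<in> parcs \<Delta>) p \<theta>'"
      using D.two_geodesic_transitive_imp_coordinates \<Delta>(2-5) assms(3) by blast
    then show ?thesis
      using C.coordinates_iso digraph_iso_of_bij[OF assms(1) \<Delta>(1)] by blast
  qed
  moreover have "AutGraph \<Gamma> \<cong> PSL2 p \<times>\<times> integer_mod_group 2"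
    unfolding P.AutGraph_eq by (rule C.aut_group_iso[OF \<epsilon>])
  ultimately show ?thesis
    using C.not_bipartite C.geodesic_transitiveI[OF \<epsilon> assms(5)] by blast
qed

end
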